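(* Let $d\ge 1$ be an integer and $\beta \in (0,d]$. For each $\alpha \in (0,d)$ there exists a constant $C=C(\alpha,\beta,d)>0$ such that $$\left\|I_\alpha \mu \right\|_{\dot{B}^{0,1}_{d/(d-\alpha),1}(\mathbb{R}^d)} \leq C \|\mu\|_{DS_\beta(\mathbb{R}^d)}$$ for all $\mu \in DS_\beta(\mathbb{R}^d)$.
   Context: $M_b(\mathbb{R}^d)$ is the space of finite (signed) Radon measures on $\mathbb{R}^d$; $|\mu|$ denotes total variation. $e^{t\Delta}$, $t>0$, is the heat semigroup: $e^{t\Delta}\mu(x)=\int_{\mathbb{R}^d}(4\pi t)^{-d/2}e^{-|x-y|^2/4t}\,d\mu(y)$. Riesz potential: for $\alpha\in(0,d)$, $I_\alpha \mu(x):= \frac{1}{\Gamma(\alpha/2)} \int_0^\infty t^{\alpha/2-1} e^{t\Delta} \mu(x) \,dt = \frac{1}{\gamma(\alpha)} \int_{\mathbb{R}^d} \frac{d\mu(y)}{|x-y|^{d-\alpha}}$, with $\gamma(\alpha)$ the corresponding normalization constant. $\beta$-atom ($\beta\in(0,d]$): a measure $a\in M_b(\mathbb{R}^d)$ for which there is a cube $Q\subset\mathbb{R}^d$ with sides parallel to the coordinate axes, of side length $l(Q)$, such that (1) $\operatorname{supp} a\subset Q$; (2) $a(Q)=0$; (3) $\sup_{x\in\mathbb{R}^d,\,t>0}|t^{(d-\beta)/2}e^{t\Delta}a(x)|\le l(Q)^{-\beta}$; (4) $|a|(\mathbb{R}^d)\le 1$. $DS_\beta(\mathbb{R}^d)$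 is the set of $\mu\in M_b(\mathbb{R}^d)$ for which there are scalars $\lambda_{i,n}$ and $\beta$-atoms $a_{i,n}$ ($1\le i\le n$, $n\in\mathbb{N}$) with $\limsup_{n\to\infty}\sum_{i=1}^n|\lambda_{i,n}|<+\infty$ and $\mu=\lim_{n\to\infty}\sum_{i=1}^n\lambda_{i,n}a_{i,n}$ weakly-star as measures, i.e. $\int\varphi\,d\mu=\lim_{n\to\infty}\sum_{i=1}^n\lambda_{i,n}\int\varphi\,da_{i,n}$ for all $\varphi\in C_0(\mathbb{R}^d)$. Its norm $\|\mu\|_{DS_\beta(\mathbb{R}^d)}$ is the infimum of $\limsup_{n\to\infty}\sum_{i=1}^n|\lambda_{i,n}|$ over all such representations of $\mu$. Besov--Lorentz norm: $\dot B^{0,1}_{p,1}(\mathbb{R}^d)$ is the homogeneous Besov space of smoothness $0$ and summability $1$ built on the Lorentz space $L^{p,1}(\mathbb{R}^d)$: $\|f\|_{\dot B^{0,1}_{p,1}}=\sum_{j\in\mathbb{Z}}\|\Delta_j f\|_{L^{p,1}(\mathbb{R}^d)}$, where $\Delta_j$ are the Littlewood--Paley projections $\widehat{\Delta_jf}(\xi)=\psi(2^{-j}\xi)\hat f(\xi)$, with $\psi\in C_c^\infty(\mathbb{R}^d\setminus\{0\})$ fixed and $\sum_{j\in\mathbb{Z}}\psi(2^{-j}\xi)=1$ for $\xi\ne0$. *)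

theory Defs
  imports "HOL-Analysis.Analysis"
begin

section \<open>Finite signed Borel measures\<close>

text \<open>
  A finite signed measure is a real-valued set function that is countably additive on the Borel
  sets; its values on other sets are irrelevant. On \<open>\<real>\<^sup>d\<close> every finite Borel
  measure is Radon, so for \<^typ>\<open>real ^ 'n\<close> this is the space \<open>M\<^sub>b\<close>.
\<close>

definition signed_measure :: "('a::topological_space set \<Rightarrow> real) \<Rightarrow> bool" where
  "signed_measure \<mu> \<longleftrightarrow> \<mu> {} = 0 \<and>
     (\<forall>A::nat \<Rightarrow> 'a set. range A \<subseteq> sets borel \<longrightarrow> disjoint_family A \<longrightarrow>
        (\<lambda>i. \<mu> (A i)) sums \<mu> (\<Union>i. A i))"

text \<open>
  The Jordan decomposition, through the upper and lower variations. The coercion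
  \<^const>\<open>ennreal\<close> truncates negative values to \<open>0\<close>, which does not affect the
  supremum because \<open>\<mu> {} = 0\<close>.
\<close>

definition pos_part :: "('a::topological_space set \<Rightarrow> real) \<Rightarrow> 'a measure" where
  "pos_part \<mu> = measure_of UNIV (sets borel)
     (\<lambda>A. SUP B\<in>{B \<in> sets borel. B \<subseteq> A}. ennreal (\<mu> B))"

definition neg_part :: "('a::topological_space set \<Rightarrow> real) \<Rightarrow> 'a measure" where
  "neg_part \<mu> = pos_part (\<lambda>A. - \<mu> A)"

definition total_variation :: "('a::topological_space set \<Rightarrow> real) \<Rightarrow> 'a set \<Rightarrow> ennreal" where
  "total_variation \<mu> A = emeasure (pos_part \<mu>) A + emeasure (neg_part \<mu>) A"

definition signed_integral :: "('a::topological_space set \<Rightarrow> real) \<Rightarrow> ('a \<Rightarrow> real) \<Rightarrow> real" where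
  "signed_integral \<mu> f = (\<integral>x. f x \<partial>pos_part \<mu>) - (\<integral>x. f x \<partial>neg_part \<mu>)"

definition measure_support :: "('a::topological_space set \<Rightarrow> real) \<Rightarrow> 'a set" where
  "measure_support \<mu> = {x. \<forall>U. open U \<longrightarrow> x \<in> U \<longrightarrow> total_variation \<mu> U > 0}"


section \<open>Heat semigroup and Riesz potential\<close>

definition heat :: "real \<Rightarrow> ((real ^ 'n) set \<Rightarrow> real) \<Rightarrow> real ^ 'n \<Rightarrow> real" where
  "heat t \<mu> x = signed_integral \<mu>
     (\<lambda>y. (4 * pi * t) powr (- real CARD('n) / 2) * exp (- (norm (x - y))\<^sup>2 / (4 * t)))"

text \<open>
  For a finite signed measure and \<open>0 < \<alpha> < d\<close> the integral below converges absolutely for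
  almost every \<open>x\<close>, and the resulting function is locally integrable.
\<close>

definition riesz_potential :: "real \<Rightarrow> ((real ^ 'n) set \<Rightarrow> real) \<Rightarrow> real ^ 'n \<Rightarrow> real" where
  "riesz_potential \<alpha> \<mu> x =
     1 / Gamma (\<alpha> / 2) * (LBINT t:{0<..}. t powr (\<alpha> / 2 - 1) * heat t \<mu> x)"


section \<open>Atoms and the space \<open>DS\<^sub>\<beta>\<close>\<close>

definition cube :: "real ^ 'n \<Rightarrow> real \<Rightarrow> (real ^ 'n) set" where
  "cube c l = cbox c (\<chi> i. c $ i + l)"

definition atom :: "real \<Rightarrow> ((real ^ 'n) set \<Rightarrow> real) \<Rightarrow> bool" where
  "atom \<beta> a \<longleftrightarrow> signed_measure a \<and>
     (\<exists>c l. l > 0 \<and>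
        measure_support a \<subseteq> cube c l \<and>
        a (cube c l) = 0 \<and>
        (\<forall>x. \<forall>t>0. \<bar>t powr ((real CARD('n) - \<beta>) / 2) * heat t a x\<bar> \<le> l powr (- \<beta>)) \<and>
        total_variation a UNIV \<le> 1)"

definition C0 :: "('a::real_normed_vector \<Rightarrow> real) set" where
  "C0 = {\<phi>. continuous_on UNIV \<phi> \<and> (\<phi> \<longlongrightarrow> 0) at_infinity}"

definition DS_representation ::
  "real \<Rightarrow> ((real ^ 'n) set \<Rightarrow> real) \<Rightarrow> (nat \<Rightarrow> nat \<Rightarrow> real) \<Rightarrow>
   (nat \<Rightarrow> nat \<Rightarrow> (real ^ 'n) set \<Rightarrow> real) \<Rightarrow> bool" where
  "DS_representation \<beta> \<mu> c a \<longleftrightarrow>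
     (\<forall>n. \<forall>i\<in>{1..n}. atom \<beta> (a i n)) \<and>
     limsup (\<lambda>n. ennreal (\<Sum>i=1..n. \<bar>c i n\<bar>)) < \<infinity> \<and>
     (\<forall>\<phi>\<in>C0. (\<lambda>n. \<Sum>i=1..n. c i n * signed_integral (a i n) \<phi>)
                \<longlonglongrightarrow> signed_integral \<mu> \<phi>)"

definition DS :: "real \<Rightarrow> ((real ^ 'n) set \<Rightarrow> real) set" where
  "DS \<beta> = {\<mu>. signed_measure \<mu> \<and> (\<exists>c a. DS_representation \<beta> \<mu> c a)}"

definition DS_norm :: "real \<Rightarrow> ((real ^ 'n) set \<Rightarrow> real) \<Rightarrow> ennreal" where
  "DS_norm \<beta> \<mu> =
     Inf {limsup (\<lambda>n. ennreal (\<Sum>i=1..n. \<bar>c i n\<bar>)) | c a. DS_representation \<beta> \<mu> c a}"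


section \<open>Smooth functions, Schwartz functions and tempered distributions\<close>

primrec iterated_derivative ::
  "'a list \<Rightarrow> ('a::real_normed_vector \<Rightarrow> 'b::real_normed_vector) \<Rightarrow> 'a \<Rightarrow> 'b" where
  "iterated_derivative [] f = f"
| "iterated_derivative (v # vs) f =
     (\<lambda>x. frechet_derivative (iterated_derivative vs f) (at x) v)"

definition smooth :: "('a::real_normed_vector \<Rightarrow> 'b::real_normed_vector) \<Rightarrow> bool" where
  "smooth f \<longleftrightarrow> (\<forall>vs. iterated_derivative vs f differentiable_on UNIV)"

definition schwartz :: "(real ^ 'n \<Rightarrow> complex) set" where
  "schwartz = {\<phi>. smooth \<phi> \<and>
     (\<forall>vs k. bounded (range (\<lambda>x. (1 + norm x) ^ k *\<^sub>R iterated_derivative vs \<phi> x)))}"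

definition fourier :: "(real ^ 'n \<Rightarrow> complex) \<Rightarrow> real ^ 'n \<Rightarrow> complex" where
  "fourier \<phi> \<xi> = (\<integral>x. cis (- (2 * pi * (x \<bullet> \<xi>))) * \<phi> x \<partial>lborel)"

definition inverse_fourier :: "(real ^ 'n \<Rightarrow> complex) \<Rightarrow> real ^ 'n \<Rightarrow> complex" where
  "inverse_fourier \<phi> x = (\<integral>\<xi>. cis (2 * pi * (x \<bullet> \<xi>)) * \<phi> \<xi> \<partial>lborel)"

text \<open>
  A tempered distribution is given as a functional on test functions, of which only the values on
  \<^const>\<open>schwartz\<close> matter. The Fourier transform, its inverse and multiplication by a
  function are defined by duality.
\<close>

type_synonym 'n distribution = "(real ^ 'n \<Rightarrow> complex) \<Rightarrow> complex"

definition distribution_of :: "(real ^ 'n \<Rightarrow> complex) \<Rightarrow> ('n::finite) distribution" where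
  "distribution_of f \<phi> = (\<integral>x. f x * \<phi> x \<partial>lborel)"

definition represented_by :: "('n::finite) distribution \<Rightarrow> (real ^ 'n \<Rightarrow> complex) \<Rightarrow> bool" where
  "represented_by T g \<longleftrightarrow> g \<in> borel_measurable borel \<and>
     (\<forall>\<phi>\<in>schwartz. integrable lborel (\<lambda>x. g x * \<phi> x) \<and> T \<phi> = distribution_of g \<phi>)"

definition fourier_distribution :: "('n::finite) distribution \<Rightarrow> ('n::finite) distribution" where
  "fourier_distribution T \<phi> = T (fourier \<phi>)"

definition inverse_fourier_distribution :: "('n::finite) distribution \<Rightarrow> ('n::finite) distribution" where
  "inverse_fourier_distribution T \<phi> = T (inverse_fourier \<phi>)"

definition mult_distribution :: "(real ^ 'n \<Rightarrow> complex) \<Rightarrow> ('n::finite) distribution \<Rightarrow> ('n::finite) distribution" where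
  "mult_distribution m T \<phi> = T (\<lambda>\<xi>. m \<xi> * \<phi> \<xi>)"


section \<open>The Besov--Lorentz norm\<close>

definition littlewood_paley_generator :: "(real ^ 'n \<Rightarrow> complex) \<Rightarrow> bool" where
  "littlewood_paley_generator \<psi> \<longleftrightarrow> smooth \<psi> \<and>
     compact (closure {\<xi>. \<psi> \<xi> \<noteq> 0}) \<and> 0 \<notin> closure {\<xi>. \<psi> \<xi> \<noteq> 0} \<and>
     (\<forall>\<xi>. \<xi> \<noteq> 0 \<longrightarrow> ((\<lambda>j::int. \<psi> (2 powi (- j) *\<^sub>R \<xi>)) has_sum 1) UNIV)"

definition littlewood_paley ::
  "(real ^ 'n \<Rightarrow> complex) \<Rightarrow> int \<Rightarrow> ('n::finite) distribution \<Rightarrow> ('n::finite) distribution" where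
  "littlewood_paley \<psi> j T = inverse_fourier_distribution
     (mult_distribution (\<lambda>\<xi>. \<psi> (2 powi (- j) *\<^sub>R \<xi>)) (fourier_distribution T))"

definition decreasing_rearrangement :: "(real ^ 'n \<Rightarrow> complex) \<Rightarrow> real \<Rightarrow> ennreal" where
  "decreasing_rearrangement g t =
     Inf {s. emeasure lborel {x. s < ennreal (norm (g x))} \<le> ennreal t}"

text \<open>The norm of the Lorentz space \<open>L\<^bsup>p,1\<^esup>\<close>.\<close>

definition lorentz1_norm :: "real \<Rightarrow> (real ^ 'n \<Rightarrow> complex) \<Rightarrow> ennreal" where
  "lorentz1_norm p g =
     (\<integral>\<^sup>+t\<in>{0<..}. ennreal (t powr (1 / p - 1)) * decreasing_rearrangement g t \<partial>lborel)"

text \<open>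
  A representing function is unique up to null sets, which do not affect the Lorentz norm. So the
  infimum is the norm of the representing function, and it is \<open>\<infinity>\<close> if there is none.
\<close>

definition lorentz1_norm_distribution :: "real \<Rightarrow> ('n::finite) distribution \<Rightarrow> ennreal" where
  "lorentz1_norm_distribution p T = (INF g\<in>{g. represented_by T g}. lorentz1_norm p g)"

definition besov_lorentz_norm ::
  "(real ^ 'n \<Rightarrow> complex) \<Rightarrow> real \<Rightarrow> ('n::finite) distribution \<Rightarrow> ennreal" where
  "besov_lorentz_norm \<psi> p T =
     (\<Sum>\<^sub>\<infinity>j\<in>(UNIV::int set). lorentz1_norm_distribution p (littlewood_paley \<psi> j T))"

end

theory Submission
  imports Defs "HOL-Probability.Probability"
begin

text \<open>
  Write \<open>d\<close> for the dimension and \<open>p = d / (d - \<alpha>)\<close>. On the Fourier side the \<open>j\<close>-th Littlewood-Paley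
  block of \<open>I\<^sub>\<alpha> \<mu>\<close> is \<open>\<psi> (\<rho> \<xi>) (2 \<pi> \<bar>\<xi>\<bar>)\<^bsup>-\<alpha>\<^esup>\<close> times the transform of \<open>\<mu>\<close>, where
  \<open>\<rho> = 2\<^bsup>-j\<^esup>\<close> is the length scale. Since \<open>\<psi>\<close> lives on an annulus, a Gaussian can be split off this symbol
  at no cost: the block is the heat flow of \<open>\<mu>\<close> at time \<open>\<rho>\<^sup>2\<close>, convolved with a rescaling of one
  integrable kernel whose mass is proportional to \<open>\<rho>\<^bsup>\<alpha>\<^esup>\<close>
  (\<open>riesz_block_represents\<close>, \<open>riesz_block_kernel\<close>). So all that is needed from an atom are \<open>L\<^sup>1\<close> and
  \<open>L\<^sup>\<infinity>\<close> bounds of its heat flow.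

  For an atom on a cube of side \<open>l\<close> put \<open>u = l / \<rho>\<close>. If \<open>u \<le> 1\<close>, the vanishing total mass gains a factor
  \<open>u\<close> in both norms over the bounds of a general measure of mass one. If \<open>u > 1\<close>, the \<open>L\<^sup>1\<close> norm
  is at most one and the bound on the heat flow that an atom satisfies by definition gains \<open>u\<^bsup>-\<beta>\<^esup>\<close> in \<open>L\<^sup>\<infinity>\<close>
  (\<open>atom_heat_estimates\<close>). The \<open>L\<^bsup>p,1\<^esup>\<close> norm is controlled by the geometric mean of the
  \<open>L\<^sup>1\<close> and \<open>L\<^sup>\<infinity>\<close> norms with weights \<open>1 / p\<close> and \<open>1 - 1 / p = \<alpha> / d\<close>. In this mean all powers of \<open>\<rho>\<close>
  cancel, and \<open>u\<close>, respectively \<open>u\<^bsup>-\<beta>\<alpha>/d\<^esup>\<close>, remains (\<open>riesz_block_atom\<close>). Summed over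
  dyadic \<open>\<rho>\<close> this is a two-sided geometric series, bounded independently of \<open>l\<close> (\<open>sum_atom_weight_le\<close>).

  To pass from atoms to their limits one needs the geometric mean bound for linear combinations with a
  constant that does not depend on the number of terms (\<open>lorentz_layers_sum_le\<close>), and the Fatou property
  of the Lorentz norm (\<open>lorentz_layers_liminf\<close>). Weak-star convergence makes the heat flows converge
  pointwise, because heat kernels vanish at infinity, and by dominated convergence the blocks converge
  pointwise as well (\<open>riesz_block_limit\<close>). Fatou's lemma for the sum over \<open>j\<close> completes the estimate
  (\<open>besov_le_representation\<close>).
\<close>

section \<open>The Jordan decomposition of a signed measure\<close>

text \<open>
  The set function from which \<^const>\<open>pos_part\<close> is built. As soon as it is known to be countably
  additive on the Borel sets, it gives the values of that measure.
\<close>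

definition upper_variation :: "('a::topological_space set \<Rightarrow> real) \<Rightarrow> 'a set \<Rightarrow> ennreal" where
  "upper_variation \<mu> A = (SUP B\<in>{B \<in> sets borel. B \<subseteq> A}. ennreal (\<mu> B))"

lemma signed_measure_Un:
  assumes "signed_measure \<mu>" "A \<in> sets borel" "B \<in> sets borel" "A \<inter> B = {}"
  shows "\<mu> (A \<union> B) = \<mu> A + \<mu> B"
proof -
  have "range (binaryset A B) \<subseteq> sets borel" "disjoint_family (binaryset A B)"
    using assms by (auto simp: binaryset_def disjoint_family_on_def)
  then have "(\<lambda>i. \<mu> (binaryset A B i)) sums \<mu> (\<Union>i. binaryset A B i)"
    using assms(1) unfolding signed_measure_def by blast
  moreover have "(\<lambda>i. \<mu> (binaryset A B i)) sums (\<mu> A + \<mu> B)"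
    using assms(1) by (intro binaryset_sums) (auto simp: signed_measure_def)
  ultimately show ?thesis
    by (simp add: UN_binaryset_eq sums_unique2)
qed

lemma signed_measure_Diff:
  assumes "signed_measure \<mu>" "A \<in> sets borel" "B \<in> sets borel" "A \<subseteq> B"
  shows "\<mu> (B - A) = \<mu> B - \<mu> A"
proof -
  have "\<mu> (A \<union> (B - A)) = \<mu> A + \<mu> (B - A)"
    using assms by (intro signed_measure_Un) auto
  moreover have "A \<union> (B - A) = B" using assms(4) by auto
  ultimately show ?thesis by simp
qed

lemma signed_measure_uminus: "signed_measure \<mu> \<Longrightarrow> signed_measure (\<lambda>A. - \<mu> A)"
  unfolding signed_measure_def by (auto intro: sums_minus)

lemma upper_variation_upper: "B \<in> sets borel \<Longrightarrow> B \<subseteq> A \<Longrightarrow> ennreal (\<mu> B) \<le> upper_variation \<mu> A"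
  unfolding upper_variation_def by (rule SUP_upper) auto

lemma upper_variation_least:
  "(\<And>B. B \<in> sets borel \<Longrightarrow> B \<subseteq> A \<Longrightarrow> ennreal (\<mu> B) \<le> c) \<Longrightarrow> upper_variation \<mu> A \<le> c"
  unfolding upper_variation_def by (rule SUP_least) auto

lemma upper_variation_mono: "A \<subseteq> A' \<Longrightarrow> upper_variation \<mu> A \<le> upper_variation \<mu> A'"
  by (intro upper_variation_least upper_variation_upper) auto

lemma upper_variation_empty: "signed_measure \<mu> \<Longrightarrow> upper_variation \<mu> {} = 0"
  unfolding upper_variation_def signed_measure_def
  by (auto intro!: antisym SUP_least)

lemma upper_variation_superadditive:
  assumes "signed_measure \<mu>" "A \<inter> B = {}"
  shows "upper_variation \<mu> A + upper_variation \<mu> B \<le> upper_variation \<mu> (A \<union> B)"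
proof -
  have *: "ennreal (\<mu> C) + ennreal (\<mu> D) \<le> upper_variation \<mu> (A \<union> B)"
    if "C \<in> sets borel" "C \<subseteq> A" "D \<in> sets borel" "D \<subseteq> B" for C D
  proof (cases "\<mu> C \<ge> 0 \<and> \<mu> D \<ge> 0")
    case True
    have "C \<inter> D = {}" using that assms(2) by auto
    then have "ennreal (\<mu> C) + ennreal (\<mu> D) = ennreal (\<mu> (C \<union> D))"
      using signed_measure_Un[OF assms(1) that(1,3)] True by simp
    also have "\<dots> \<le> upper_variation \<mu> (A \<union> B)"
      using that by (intro upper_variation_upper) auto
    finally show ?thesis .
  next
    case False
    then consider "ennreal (\<mu> C) = 0" | "ennreal (\<mu> D) = 0"
      by (metis ennreal_neg linorder_not_le order_less_imp_le)
    then show ?thesis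
    proof cases
      case 1
      then show ?thesis using upper_variation_upper[of D "A \<union> B" \<mu>] that by auto
    next
      case 2
      then show ?thesis using upper_variation_upper[of C "A \<union> B" \<mu>] that by auto
    qed
  qed
  have ne: "{B \<in> sets borel. B \<subseteq> A} \<noteq> {}" "{C \<in> sets borel. C \<subseteq> B} \<noteq> {}"
    using sets.empty_sets by blast+
  have "ennreal (\<mu> C) + upper_variation \<mu> B \<le> upper_variation \<mu> (A \<union> B)"
    if "C \<in> sets borel" "C \<subseteq> A" for C
    unfolding upper_variation_def[of \<mu> B] ennreal_SUP_add_right[OF ne(2)]
    by (rule SUP_least) (use * that in auto)
  then have "(SUP C\<in>{C \<in> sets borel. C \<subseteq> A}. ennreal (\<mu> C) + upper_variation \<mu> B)
      \<le> upper_variation \<mu> (A \<union> B)"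
    by (intro SUP_least) blast
  then show ?thesis
    by (simp only: upper_variation_def[of \<mu> A] ennreal_SUP_add_left[OF ne(1)])
qed

text \<open>
  A competitor for the union is cut into its pieces in the \<open>A i\<close>, which gives one inequality; competitors
  for finitely many of the \<open>A i\<close> are glued together, which gives the other.
\<close>

lemma upper_variation_countably_additive:
  assumes \<mu>: "signed_measure \<mu>"
  shows "countably_additive (sets borel) (upper_variation \<mu>)"
  unfolding countably_additive_def
proof (intro allI impI)
  fix A :: "nat \<Rightarrow> 'a set"
  assume A: "range A \<subseteq> sets borel" "disjoint_family A" "(\<Union>i. A i) \<in> sets borel"
  show "(\<Sum>i. upper_variation \<mu> (A i)) = upper_variation \<mu> (\<Union>i. A i)"
  proof (rule antisym)
    have "(\<Sum>i<n. upper_variation \<mu> (A i)) \<le> upper_variation \<mu> (\<Union>i<n. A i)" for n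
    proof (induction n)
      case 0
      then show ?case by simp
    next
      case (Suc n)
      have "A i \<inter> A n = {}" if "i < n" for i
        using A(2) that by (intro disjoint_family_onD[of A UNIV]) auto
      then have dis: "(\<Union>i<n. A i) \<inter> A n = {}" by blast
      have "(\<Sum>i<Suc n. upper_variation \<mu> (A i))
          \<le> upper_variation \<mu> (\<Union>i<n. A i) + upper_variation \<mu> (A n)"
        using Suc by (simp add: add_right_mono)
      also have "\<dots> \<le> upper_variation \<mu> ((\<Union>i<n. A i) \<union> A n)"
        by (rule upper_variation_superadditive[OF \<mu> dis])
      also have "(\<Union>i<n. A i) \<union> A n = (\<Union>i<Suc n. A i)"
        by (auto simp: less_Suc_eq)
      finally show ?case .
    qed
    also have "upper_variation \<mu> (\<Union>i<n. A i) \<le> upper_variation \<mu> (\<Union>i. A i)" for n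
      by (intro upper_variation_mono) auto
    finally show "(\<Sum>i. upper_variation \<mu> (A i)) \<le> upper_variation \<mu> (\<Union>i. A i)"
      by (intro suminf_le_const) auto
  next
    show "upper_variation \<mu> (\<Union>i. A i) \<le> (\<Sum>i. upper_variation \<mu> (A i))"
    proof (rule upper_variation_least)
      fix B :: "'a set" assume B: "B \<in> sets borel" "B \<subseteq> (\<Union>i. A i)"
      have "range (\<lambda>i. B \<inter> A i) \<subseteq> sets borel" "disjoint_family (\<lambda>i. B \<inter> A i)"
        using A B by (auto simp: disjoint_family_on_def)
      then have "(\<lambda>i. \<mu> (B \<inter> A i)) sums \<mu> (\<Union>i. B \<inter> A i)"
        using \<mu> unfolding signed_measure_def by blast
      moreover have "(\<Union>i. B \<inter> A i) = B" using B by auto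
      ultimately have "(\<lambda>n. \<Sum>i<n. \<mu> (B \<inter> A i)) \<longlonglongrightarrow> \<mu> B"
        by (simp add: sums_def)
      then have lim: "(\<lambda>n. ennreal (\<Sum>i<n. \<mu> (B \<inter> A i))) \<longlonglongrightarrow> ennreal (\<mu> B)"
        by (rule tendsto_ennrealI)
      have "ennreal (\<Sum>i<n. \<mu> (B \<inter> A i)) \<le> (\<Sum>i<n. ennreal (\<mu> (B \<inter> A i)))" for n
      proof (induction n)
        case (Suc n)
        have "ennreal (\<Sum>i<Suc n. \<mu> (B \<inter> A i))
            \<le> ennreal (max 0 (\<Sum>i<n. \<mu> (B \<inter> A i)) + max 0 (\<mu> (B \<inter> A n)))"
          by (intro ennreal_leI) simp
        also have "\<dots> = ennreal (\<Sum>i<n. \<mu> (B \<inter> A i)) + ennreal (\<mu> (B \<inter> A n))"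
          by (subst ennreal_plus) (simp_all only: ennreal_max_0 max.cobounded1)
        finally show ?case
          using Suc by (simp add: order_trans[OF _ add_right_mono])
      qed simp
      also have "(\<Sum>i<n. ennreal (\<mu> (B \<inter> A i))) \<le> (\<Sum>i<n. upper_variation \<mu> (A i))" for n
        using A B by (intro sum_mono upper_variation_upper) auto
      also have "(\<Sum>i<n. upper_variation \<mu> (A i)) \<le> (\<Sum>i. upper_variation \<mu> (A i))" for n
        by (intro sum_le_suminf) auto
      finally show "ennreal (\<mu> B) \<le> (\<Sum>i. upper_variation \<mu> (A i))"
        by (intro LIMSEQ_le_const2[OF lim]) auto
    qed
  qed
qed

lemma space_pos_part [simp]: "space (pos_part \<mu>) = UNIV"
  and sets_pos_part [simp, measurable_cong]: "sets (pos_part \<mu>) = sets borel"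
  and space_neg_part [simp]: "space (neg_part \<mu>) = UNIV"
  and sets_neg_part [simp, measurable_cong]: "sets (neg_part \<mu>) = sets borel"
  unfolding pos_part_def neg_part_def
  by (simp_all add: space_measure_of_conv sets.sigma_sets_eq[of borel, simplified])

lemma emeasure_pos_part:
  assumes "signed_measure \<mu>" "A \<in> sets borel"
  shows "emeasure (pos_part \<mu>) A = upper_variation \<mu> A"
proof (rule emeasure_measure_of[where \<Omega> = UNIV and A = "sets borel"])
  show "pos_part \<mu> = measure_of UNIV (sets borel) (upper_variation \<mu>)"
    by (simp add: pos_part_def upper_variation_def[abs_def])
  show "positive (sets (pos_part \<mu>)) (upper_variation \<mu>)"
    using assms(1) by (simp add: positive_def upper_variation_empty)
  show "countably_additive (sets (pos_part \<mu>)) (upper_variation \<mu>)"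
    using upper_variation_countably_additive[OF assms(1)] by simp
  show "A \<in> sets (pos_part \<mu>)" using assms(2) by simp
qed simp

text \<open>
  The classical exhaustion argument. A set of infinite variation contains \<open>B\<close> with \<open>\<mu> B > 1 + \<bar>\<mu> E\<bar>\<close>;
  then \<open>B\<close> and its complement in \<open>E\<close> both have \<open>\<mu>\<close>-values larger than one in modulus, and one of them
  still has infinite variation. Keeping that one and iterating, the parts thrown away are disjoint and their
  values do not tend to zero.
\<close>

lemma upper_variation_finite:
  assumes \<mu>: "signed_measure \<mu>"
  shows "upper_variation \<mu> UNIV < \<infinity>"
proof (rule ccontr)
  \<comment> \<open>Sets on which the exhaustion can continue.\<close>
  define P where "P E \<longleftrightarrow> E \<in> sets borel \<and> upper_variation \<mu> E = \<infinity>" for E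
  assume "\<not> upper_variation \<mu> UNIV < \<infinity>"
  then have P0: "P UNIV" by (auto simp: P_def less_top[symmetric])
  have step: "\<exists>A. P A \<and> A \<subseteq> E \<and> 1 \<le> \<bar>\<mu> (E - A)\<bar>" if "P E" for E
  proof -
    have E [measurable]: "E \<in> sets borel" and inf: "upper_variation \<mu> E = \<infinity>"
      using that by (auto simp: P_def)
    have "ennreal (1 + \<bar>\<mu> E\<bar>) < upper_variation \<mu> E" by (simp add: inf)
    then obtain B where B: "B \<in> sets borel" "B \<subseteq> E" "ennreal (1 + \<bar>\<mu> E\<bar>) < ennreal (\<mu> B)"
      unfolding upper_variation_def less_SUP_iff by auto
    then have B': "1 + \<bar>\<mu> E\<bar> < \<mu> B" by (subst (asm) ennreal_less_iff) auto
    have d: "\<mu> (E - B) = \<mu> E - \<mu> B" using signed_measure_Diff[OF \<mu>] B by auto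
    have eq: "upper_variation \<mu> E = upper_variation \<mu> B + upper_variation \<mu> (E - B)"
      using plus_emeasure[of B "pos_part \<mu>" "E - B"] B
      by (simp add: emeasure_pos_part \<mu> Un_absorb1)
    show ?thesis
    proof (cases "upper_variation \<mu> B = \<infinity>")
      case True
      then show ?thesis using B B' d by (intro exI[of _ B]) (auto simp: P_def)
    next
      case False
      then have "upper_variation \<mu> (E - B) = \<infinity>" using eq inf by (metis ennreal_add_eq_top infinity_ennreal_def)
      moreover have "E - (E - B) = B" using B by auto
      ultimately show ?thesis using B B' by (intro exI[of _ "E - B"]) (auto simp: P_def)
    qed
  qed
  have "\<exists>f. \<forall>n. P (f n) \<and> (f (Suc n) \<subseteq> f n \<and> 1 \<le> \<bar>\<mu> (f n - f (Suc n))\<bar>)"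
    using P0 step by (intro dependent_nat_choice) blast+
  then obtain f where f: "\<And>n. P (f n)" "\<And>n. f (Suc n) \<subseteq> f n" "\<And>n. 1 \<le> \<bar>\<mu> (f n - f (Suc n))\<bar>"
    by blast
  have dec: "f n \<subseteq> f m" if "m \<le> n" for m n
    using that f(2) by (rule lift_Suc_antimono_le[rotated])
  have "disjoint_family (\<lambda>n. f n - f (Suc n))"
    unfolding disjoint_family_on_def
  proof (intro ballI impI)
    fix m n :: nat assume "m \<noteq> n"
    then consider "Suc m \<le> n" | "Suc n \<le> m" by linarith
    then show "(f m - f (Suc m)) \<inter> (f n - f (Suc n)) = {}"
      by cases (use dec in blast)+
  qed
  moreover have "range (\<lambda>n. f n - f (Suc n)) \<subseteq> sets borel"
    using f(1) by (auto simp: P_def)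
  ultimately have "(\<lambda>n. \<mu> (f n - f (Suc n))) sums \<mu> (\<Union>n. f n - f (Suc n))"
    using \<mu> unfolding signed_measure_def by blast
  then have "(\<lambda>n. \<mu> (f n - f (Suc n))) \<longlonglongrightarrow> 0"
    using summable_LIMSEQ_zero sums_summable by blast
  then have "\<forall>\<^sub>F n in sequentially. \<bar>\<mu> (f n - f (Suc n))\<bar> < 1"
    by (auto simp: tendsto_iff dist_real_def dest: spec[of _ 1])
  then show False using f(3) by (auto simp: eventually_sequentially not_less[symmetric])
qed

lemma finite_pos_part: "signed_measure \<mu> \<Longrightarrow> finite_measure (pos_part \<mu>)"
  using upper_variation_finite[of \<mu>] by (intro finite_measureI) (auto simp: emeasure_pos_part)

lemma finite_neg_part: "signed_measure \<mu> \<Longrightarrow> finite_measure (neg_part \<mu>)"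
  unfolding neg_part_def by (intro finite_pos_part signed_measure_uminus)

text \<open>
  Passing from \<open>B\<close> to \<open>A - B\<close> turns the supremum that defines the negative part into the one that defines
  the positive part, shifted by \<open>\<mu> A\<close>.
\<close>

lemma jordan_decomposition:
  assumes \<mu>: "signed_measure \<mu>" and A: "A \<in> sets borel"
  shows "\<mu> A = measure (pos_part \<mu>) A - measure (neg_part \<mu>) A"
proof -
  interpret P: finite_measure "pos_part \<mu>" by (rule finite_pos_part[OF \<mu>])
  interpret N: finite_measure "neg_part \<mu>" by (rule finite_neg_part[OF \<mu>])
  have uP: "\<nu> B \<le> measure (pos_part \<nu>) A" if "B \<in> sets borel" "B \<subseteq> A" "signed_measure \<nu>" for B and \<nu> :: "'a set \<Rightarrow> real"
  proof -
    interpret Q: finite_measure "pos_part \<nu>" by (rule finite_pos_part[OF that(3)])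
    show ?thesis
      using upper_variation_upper[of B A \<nu>] that A
      by (simp add: emeasure_pos_part[symmetric] Q.emeasure_eq_measure)
  qed
  have lP: "measure (pos_part \<nu>) A \<le> c"
    if "signed_measure \<nu>" "\<And>B. B \<in> sets borel \<Longrightarrow> B \<subseteq> A \<Longrightarrow> \<nu> B \<le> c" for c and \<nu> :: "'a set \<Rightarrow> real"
  proof -
    interpret Q: finite_measure "pos_part \<nu>" by (rule finite_pos_part[OF that(1)])
    have "0 \<le> c" using that(2)[of "{}"] that(1) by (simp add: signed_measure_def)
    moreover have "upper_variation \<nu> A \<le> ennreal c"
      by (intro upper_variation_least ennreal_leI that(2))
    ultimately show ?thesis
      using that A by (simp add: emeasure_pos_part[symmetric] Q.emeasure_eq_measure)
  qed
  have N: "neg_part \<mu> = pos_part (\<lambda>A. - \<mu> A)" by (rule neg_part_def)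
  have "measure (neg_part \<mu>) A \<le> measure (pos_part \<mu>) A - \<mu> A"
    unfolding N
  proof (rule lP)
    fix B :: "'a set" assume B: "B \<in> sets borel" "B \<subseteq> A"
    show "- \<mu> B \<le> measure (pos_part \<mu>) A - \<mu> A"
      using uP[of "A - B" \<mu>] signed_measure_Diff[OF \<mu> B(1) A B(2)] A B \<mu> by auto
  qed (rule signed_measure_uminus[OF \<mu>])
  moreover have "measure (pos_part \<mu>) A \<le> measure (neg_part \<mu>) A + \<mu> A"
  proof (rule lP)
    fix B :: "'a set" assume B: "B \<in> sets borel" "B \<subseteq> A"
    show "\<mu> B \<le> measure (neg_part \<mu>) A + \<mu> A"
      using uP[of "A - B" "\<lambda>A. - \<mu> A"] signed_measure_Diff[OF \<mu> B(1) A B(2)] A B 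
        signed_measure_uminus[OF \<mu>] by (auto simp: N)
  qed (rule \<mu>)
  ultimately show ?thesis by simp
qed

text \<open>
  The complement of the support is a union of null open sets, and by second countability countably many of
  them suffice.
\<close>

lemma AE_in_support:
  fixes \<mu> :: "'a::second_countable_topology set \<Rightarrow> real"
  assumes \<mu>: "signed_measure \<mu>" and S: "measure_support \<mu> \<subseteq> S"
  shows "AE x in pos_part \<mu>. x \<in> S" "AE x in neg_part \<mu>. x \<in> S"
proof -
  obtain \<B> :: "'a set set" where \<B>: "countable \<B>" "topological_basis \<B>"
    using ex_countable_basis by blast
  define \<N> where "\<N> = {U \<in> \<B>. total_variation \<mu> U = 0}"
  have op: "open U" if "U \<in> \<N>" for U
    using that \<B>(2) by (auto simp: \<N>_def topological_basis_open)
  have sub: "- S \<subseteq> \<Union>\<N>"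
  proof
    fix x assume "x \<in> - S"
    then have "x \<notin> measure_support \<mu>" using S by auto
    then obtain U where U: "open U" "x \<in> U" "total_variation \<mu> U = 0"
      unfolding measure_support_def by (auto simp: not_gr_zero)
    then obtain B where B: "B \<in> \<B>" "x \<in> B" "B \<subseteq> U"
      using \<B>(2) topological_basisE by metis
    have "total_variation \<mu> B \<le> total_variation \<mu> U"
      using U B \<B>(2) unfolding total_variation_def
      by (intro add_mono emeasure_mono) (auto simp: topological_basis_open)
    then show "x \<in> \<Union>\<N>" using U B by (auto simp: \<N>_def)
  qed
  have c: "countable \<N>" using \<B>(1) by (auto simp: \<N>_def)
  have null: "emeasure (pos_part \<mu>) U = 0" "emeasure (neg_part \<mu>) U = 0" if "U \<in> \<N>" for U
    using that by (auto simp: \<N>_def total_variation_def)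
  have "\<Union>\<N> \<in> null_sets (pos_part \<mu>)" "\<Union>\<N> \<in> null_sets (neg_part \<mu>)"
    using null_sets_UN'[OF c, of id "pos_part \<mu>"] null_sets_UN'[OF c, of id "neg_part \<mu>"] op null
    by (auto simp: null_sets_def)
  then show "AE x in pos_part \<mu>. x \<in> S" "AE x in neg_part \<mu>. x \<in> S"
    using sub by (auto intro!: AE_I')
qed

lemma total_mass_zero:
  fixes \<mu> :: "'a::second_countable_topology set \<Rightarrow> real"
  assumes \<mu>: "signed_measure \<mu>" and S: "measure_support \<mu> \<subseteq> S" "S \<in> sets borel" "\<mu> S = 0"
  shows "measure (pos_part \<mu>) UNIV = measure (neg_part \<mu>) UNIV"
proof -
  have "measure (pos_part \<mu>) UNIV = measure (pos_part \<mu>) S"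
       "measure (neg_part \<mu>) UNIV = measure (neg_part \<mu>) S"
    using AE_in_support[OF \<mu> S(1)] S(2) 
    by (auto intro!: measure_eq_AE)
  then show ?thesis using jordan_decomposition[OF \<mu> S(2)] S(3) by simp
qed

section \<open>The heat kernel and its Fourier transform\<close>

definition heat_kernel :: "real \<Rightarrow> real ^ 'n \<Rightarrow> real" where
  "heat_kernel t x = (4 * pi * t) powr (- real CARD('n) / 2) * exp (- (norm x)\<^sup>2 / (4 * t))"

abbreviation heat_of :: "(real ^ 'n) measure \<Rightarrow> real \<Rightarrow> real ^ 'n \<Rightarrow> real" where
  "heat_of M t x \<equiv> \<integral>y. heat_kernel t (x - y) \<partial>M"

abbreviation heat_symbol :: "real \<Rightarrow> real ^ 'n \<Rightarrow> complex" where
  "heat_symbol t \<xi> \<equiv> complex_of_real (exp (- 4 * pi\<^sup>2 * t * (norm \<xi>)\<^sup>2))"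

abbreviation riesz_multiplier :: "real \<Rightarrow> real ^ 'n \<Rightarrow> real" where
  "riesz_multiplier \<alpha> \<xi> \<equiv> (4 * pi\<^sup>2 * (norm \<xi>)\<^sup>2) powr (- \<alpha> / 2)"

lemma heat_kernel_nonneg [simp]: "0 \<le> heat_kernel t x"
  by (simp add: heat_kernel_def)

lemma measurable_heat_kernel [measurable]:
  "(\<lambda>(t, x). heat_kernel t x) \<in> borel_measurable (borel \<Otimes>\<^sub>M borel)"
  unfolding heat_kernel_def by measurable

lemma heat_kernel_le: "t > 0 \<Longrightarrow> heat_kernel t (x::real^'n) \<le> (4 * pi * t) powr (- real CARD('n) / 2)"
  unfolding heat_kernel_def by (intro mult_left_le) auto

lemma continuous_heat_kernel: "continuous_on UNIV (heat_kernel t)"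
  unfolding heat_kernel_def by (cases "t = 0") (auto intro!: continuous_intros)

lemma nn_integral_lborel_affine:
  fixes f :: "'a::euclidean_space \<Rightarrow> ennreal"
  assumes [measurable]: "f \<in> borel_measurable borel" and c: "c \<noteq> 0"
  shows "(\<integral>\<^sup>+x. f x \<partial>lborel) = ennreal (\<bar>c\<bar> ^ DIM('a)) * (\<integral>\<^sup>+x. f (t + c *\<^sub>R x) \<partial>lborel)"
  by (subst lborel_affine[OF c, of t])
    (simp add: nn_integral_density nn_integral_distr nn_integral_cmult)

lemma integrable_lborel_affine:
  fixes f :: "'a::euclidean_space \<Rightarrow> 'b::{banach, second_countable_topology}"
  assumes f: "integrable lborel f" and c: "c \<noteq> 0"
  shows "integrable lborel (\<lambda>x. f (t + c *\<^sub>R x))"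
  using f f[THEN borel_measurable_integrable] c unfolding integrable_iff_bounded
  by (subst (asm) nn_integral_lborel_affine[where c=c and t=t]) (auto simp: ennreal_mult_less_top)

lemma integrable_lborel_affine_iff:
  fixes f :: "'a::euclidean_space \<Rightarrow> 'b::{banach, second_countable_topology}"
  assumes c: "c \<noteq> 0"
  shows "integrable lborel (\<lambda>x. f (t + c *\<^sub>R x)) \<longleftrightarrow> integrable lborel f"
  using integrable_lborel_affine[of f c t]
    integrable_lborel_affine[of "\<lambda>x. f (t + c *\<^sub>R x)" "1/c" "- (1/c) *\<^sub>R t"] c
  by (auto simp: algebra_simps)

lemma integral_lborel_affine:
  fixes f :: "'a::euclidean_space \<Rightarrow> 'b::{banach, second_countable_topology}"
  assumes c: "c \<noteq> 0"
  shows "(\<integral>x. f x \<partial>lborel) = \<bar>c\<bar> ^ DIM('a) *\<^sub>R (\<integral>x. f (t + c *\<^sub>R x) \<partial>lborel)"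
proof (cases "integrable lborel f")
  case f [measurable]: True
  then show ?thesis
    using c f[THEN borel_measurable_integrable] integrable_lborel_affine[OF f c, of t]
    by (subst lborel_affine[OF c, of t]) (simp add: integral_density integral_distr)
next
  case False
  then show ?thesis
    using c by (simp add: integrable_lborel_affine_iff not_integrable_integral_eq)
qed

lemma 
  fixes f :: "'a::euclidean_space \<Rightarrow> real \<Rightarrow> complex"
  assumes f: "\<And>b. b \<in> Basis \<Longrightarrow> integrable lborel (f b)"
  shows integrable_lborel_prod_Basis: "integrable lborel (\<lambda>x. \<Prod>b\<in>Basis. f b (x \<bullet> b))"
    and integral_lborel_prod_Basis:
      "(\<integral>x. (\<Prod>b\<in>Basis. f b (x \<bullet> b)) \<partial>lborel) = (\<Prod>b\<in>Basis. \<integral>x. f b x \<partial>lborel)"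
proof -
  interpret P: product_sigma_finite "\<lambda>_::'a. lborel :: real measure" ..
  have m: "f b \<in> borel_measurable borel" if "b \<in> Basis" for b
    using f[OF that] by auto
  have m' [measurable]: "(\<lambda>x::'a. \<Prod>b\<in>Basis. f b (x \<bullet> b)) \<in> borel_measurable borel"
    using m by (intro borel_measurable_prod measurable_compose[OF _ m]) auto
  have [measurable]: "(\<lambda>f. \<Sum>b\<in>Basis. f b *\<^sub>R b) \<in> (\<Pi>\<^sub>M b\<in>Basis. lborel) \<rightarrow>\<^sub>M (borel :: 'a measure)"
    by measurable
  show "integrable lborel (\<lambda>x. \<Prod>b\<in>Basis. f b (x \<bullet> b))"
    using P.product_integrable_prod[OF finite_Basis f]
    by (subst lborel_eq) (simp add: integrable_distr_eq)
  show "(\<integral>x. (\<Prod>b\<in>Basis. f b (x \<bullet> b)) \<partial>lborel) = (\<Prod>b\<in>Basis. \<integral>x. f b x \<partial>lborel)"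
    using P.product_integral_prod[OF finite_Basis f]
    by (subst lborel_eq) (simp add: integral_distr)
qed

text \<open>
  Substituting \<open>x = sqrt (2 t) y\<close> turns this integral into the characteristic function of the standard
  normal distribution.
\<close>

lemma fourier_heat_kernel_real:
  fixes \<xi> :: real
  assumes t: "t > 0"
  shows "integrable lborel (\<lambda>x. complex_of_real ((4 * pi * t) powr (- 1 / 2) * exp (- x\<^sup>2 / (4 * t))) * cis (- (2 * pi * (x * \<xi>))))" (is "integrable _ ?f")
    and "(\<integral>x. complex_of_real ((4 * pi * t) powr (- 1 / 2) * exp (- x\<^sup>2 / (4 * t))) * cis (- (2 * pi * (x * \<xi>))) \<partial>lborel)
      = complex_of_real (exp (- 4 * pi\<^sup>2 * t * \<xi>\<^sup>2))"
proof -
  define c where "c = sqrt (2 * t)"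
  have c: "c > 0" "c\<^sup>2 = 2 * t" using t by (auto simp: c_def)
  have eq: "?f (0 + c * y) = (1 / c) *\<^sub>R (std_normal_density y *\<^sub>R iexp ((- (2 * pi * c * \<xi>)) * y))" for y
  proof -
    have "- (c * y)\<^sup>2 / (4 * t) = - y\<^sup>2 / 2"
      using t by (simp add: power_mult_distrib c field_simps)
    moreover have "(4 * pi * t) powr (- 1 / 2) = 1 / c * (1 / sqrt (2 * pi))"
      using t by (simp add: c_def powr_minus powr_half_sqrt[symmetric] powr_mult[symmetric] field_simps)
    ultimately show ?thesis
      by (simp add: std_normal_density_def cis_conv_exp scaleR_conv_of_real mult_ac)
  qed
  have i: "integrable lborel (\<lambda>y. std_normal_density y *\<^sub>R iexp ((- (2 * pi * c * \<xi>)) * y))"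
  proof (rule Bochner_Integration.integrable_bound)
    show "integrable lborel std_normal_density" by simp
  qed (auto)
  show "integrable lborel ?f"
    using c integrable_scaleR_right[OF i, of "1 / c"]
    by (subst lborel_integrable_real_affine_iff[of c _ 0, symmetric]) (simp, simp only: eq)
  have "(\<integral>x. ?f x \<partial>lborel) = \<bar>c\<bar> *\<^sub>R (\<integral>y. ?f (0 + c * y) \<partial>lborel)"
    using c by (intro lborel_integral_real_affine) auto
  also have "\<dots> = (\<integral>y. std_normal_density y *\<^sub>R iexp ((- (2 * pi * c * \<xi>)) * y) \<partial>lborel)"
    using c by (simp only: eq integral_scaleR_right) simp
  also have "\<dots> = char std_normal_distribution (- (2 * pi * c * \<xi>))"
    by (simp add: char_def integral_density normal_density_nonneg)
  also have "\<dots> = complex_of_real (exp (- 4 * pi\<^sup>2 * t * \<xi>\<^sup>2))"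
    by (simp add: char_std_normal_distribution power_mult_distrib c)
  finally show "(\<integral>x. ?f x \<partial>lborel) = \<dots>" .
qed

lemma heat_kernel_prod:
  fixes x :: "real ^ 'n"
  assumes "t > 0"
  shows "heat_kernel t x = (\<Prod>b\<in>Basis. (4 * pi * t) powr (- 1 / 2) * exp (- (x \<bullet> b)\<^sup>2 / (4 * t)))"
proof -
  have "(norm x)\<^sup>2 = (\<Sum>b\<in>Basis. (x \<bullet> b)\<^sup>2)"
    by (subst power2_norm_eq_inner, subst euclidean_inner) (simp add: power2_eq_square)
  moreover have "((4 * pi * t) powr (- 1 / 2)) ^ CARD('n) = (4 * pi * t) powr (- real CARD('n) / 2)"
    using assms by (simp add: powr_power)
  ultimately show ?thesis
    by (simp add: heat_kernel_def prod.distrib exp_sum[symmetric] sum_divide_distrib sum_negf)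
qed

lemma fourier_heat_kernel:
  fixes \<xi> :: "real ^ 'n"
  assumes t: "t > 0"
  shows "integrable lborel (\<lambda>x. complex_of_real (heat_kernel t x) * cis (- (2 * pi * (x \<bullet> \<xi>))))"
    and "(\<integral>x. complex_of_real (heat_kernel t x) * cis (- (2 * pi * (x \<bullet> \<xi>))) \<partial>lborel)
      = complex_of_real (exp (- 4 * pi\<^sup>2 * t * (norm \<xi>)\<^sup>2))"
proof -
  let ?f = "\<lambda>b x. complex_of_real ((4 * pi * t) powr (- 1 / 2) * exp (- x\<^sup>2 / (4 * t))) * cis (- (2 * pi * (x * (\<xi> \<bullet> b))))"
  have "cis (\<Sum>b\<in>A. g b) = (\<Prod>b\<in>A. cis (g b))" if "finite A" for A and g :: "real^'n \<Rightarrow> real"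
    using that by induction (auto simp: cis_mult[symmetric])
  note cis_sum = this[OF finite_Basis]
  have eq: "complex_of_real (heat_kernel t x) * cis (- (2 * pi * (x \<bullet> \<xi>))) = (\<Prod>b\<in>Basis. ?f b (x \<bullet> b))" for x
    by (simp add: heat_kernel_prod[OF t] prod.distrib cis_sum[symmetric] euclidean_inner[of x \<xi>] sum_distrib_left sum_negf)
  show "integrable lborel (\<lambda>x. complex_of_real (heat_kernel t x) * cis (- (2 * pi * (x \<bullet> \<xi>))))"
    unfolding eq by (intro integrable_lborel_prod_Basis fourier_heat_kernel_real t)
  have n: "(norm \<xi>)\<^sup>2 = (\<Sum>b\<in>Basis. (\<xi> \<bullet> b)\<^sup>2)"
    by (subst power2_norm_eq_inner, subst euclidean_inner) (simp add: power2_eq_square)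
  show "(\<integral>x. complex_of_real (heat_kernel t x) * cis (- (2 * pi * (x \<bullet> \<xi>))) \<partial>lborel)
      = complex_of_real (exp (- 4 * pi\<^sup>2 * t * (norm \<xi>)\<^sup>2))"
    unfolding eq integral_lborel_prod_Basis[OF fourier_heat_kernel_real(1)[OF t]] fourier_heat_kernel_real(2)[OF t] n
    by (simp add: exp_sum[symmetric] sum_distrib_left of_real_prod[symmetric] del: of_real_prod)
qed

lemma integrable_heat_kernel:
  fixes y :: "real ^ 'n"
  assumes "t > 0"
  shows "integrable lborel (\<lambda>x. heat_kernel t (x - y))"
    and "(\<integral>x. heat_kernel t (x - y) \<partial>lborel) = 1"
proof -
  have "integrable lborel (\<lambda>x::real^'n. complex_of_real (heat_kernel t x))"
    "(\<integral>x. complex_of_real (heat_kernel t (x::real^'n)) \<partial>lborel) = 1"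
    using fourier_heat_kernel[OF assms, of "0 :: real^'n"] by auto
  then have *: "integrable lborel (\<lambda>x::real^'n. heat_kernel t x)" "(\<integral>x. heat_kernel t (x::real^'n) \<partial>lborel) = 1"
    by (auto simp: complex_of_real_integrable_eq)
  show "integrable lborel (\<lambda>x. heat_kernel t (x - y))"
    using * integrable_lborel_affine_iff[of 1 "heat_kernel t" "- y"] by simp
  show "(\<integral>x. heat_kernel t (x - y) \<partial>lborel) = 1"
    using * integral_lborel_affine[of 1 "heat_kernel t" "- y"] by simp
qed

lemma nn_integral_heat_kernel:
  fixes y :: "real ^ 'n"
  assumes "t > 0"
  shows "(\<integral>\<^sup>+x. ennreal (heat_kernel t (x - y)) \<partial>lborel) = 1"
  using integrable_heat_kernel[OF assms, of y] by (subst nn_integral_eq_integral) auto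

text \<open>
  This makes heat kernels admissible test functions for the weak-star convergence in
  \<^const>\<open>DS_representation\<close>.
\<close>

lemma heat_kernel_C0:
  fixes x :: "real ^ 'n"
  assumes "t > 0"
  shows "(\<lambda>y. heat_kernel t (x - y)) \<in> C0"
proof -
  have 1: "filterlim (\<lambda>y. norm (x - y)) at_top at_infinity"
    unfolding filterlim_at_top
  proof
    fix Z
    show "\<forall>\<^sub>F y in at_infinity. Z \<le> norm (x - y)"
      using eventually_at_infinity[of "\<lambda>y. Z \<le> norm (x - y)"] 
      by (metis add.commute diff_ge_0_iff_ge le_diff_eq norm_minus_commute norm_triangle_ineq2 order_trans)
  qed
  have 2: "((\<lambda>r. (4 * pi * t) powr (- real CARD('n) / 2) * exp (- r\<^sup>2 / (4 * t))) \<longlongrightarrow> 0) at_top"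
    using assms by real_asymp
  have "((\<lambda>y. heat_kernel t (x - y)) \<longlongrightarrow> 0) at_infinity"
    unfolding heat_kernel_def by (rule filterlim_compose[OF 2 1])
  moreover have "continuous_on UNIV (\<lambda>y. heat_kernel t (x - y))"
    by (intro continuous_on_compose2[OF continuous_heat_kernel]) (auto intro!: continuous_intros)
  ultimately show ?thesis by (simp add: C0_def)
qed

section \<open>Lorentz norms of linear combinations and limits\<close>

abbreviation L1_norm :: "('a::euclidean_space \<Rightarrow> complex) \<Rightarrow> ennreal" where
  "L1_norm f \<equiv> \<integral>\<^sup>+x. ennreal (norm (f x)) \<partial>lborel"

definition level_measure :: "('a::euclidean_space \<Rightarrow> complex) \<Rightarrow> real \<Rightarrow> ennreal" where
  "level_measure g u = emeasure lborel {x. u < norm (g x)}"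

lemma level_measure_eq_nn_integral:
  assumes [measurable]: "g \<in> borel_measurable borel"
  shows "level_measure g u = (\<integral>\<^sup>+x. indicator {x. u < norm (g x)} x \<partial>lborel)"
  unfolding level_measure_def by (subst nn_integral_indicator) auto

lemma measurable_level_measure [measurable]:
  assumes [measurable]: "g \<in> borel_measurable borel"
  shows "level_measure g \<in> borel_measurable borel"
proof -
  have "(\<lambda>u. \<integral>\<^sup>+x. indicator {x. u < norm (g x)} x \<partial>lborel) \<in> borel_measurable (borel :: real measure)"
    unfolding indicator_def mem_Collect_eq by measurable
  also have "(\<lambda>u. \<integral>\<^sup>+x. indicator {x. u < norm (g x)} x \<partial>lborel) = level_measure g"
    by (rule ext) (rule level_measure_eq_nn_integral[OF assms, symmetric])
  finally show ?thesis .
qed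

text \<open>
  The norm of \<open>L\<^bsup>p,1\<^esup>\<close> with \<open>\<theta> = 1 / p\<close>, the rearrangement being written as the layer cake
  integral of the sets where the distribution function exceeds \<open>t\<close>. In this form Tonelli and Fatou apply
  directly.
\<close>

definition lorentz_layers :: "real \<Rightarrow> ('a::euclidean_space \<Rightarrow> complex) \<Rightarrow> ennreal" where
  "lorentz_layers \<theta> g = (\<integral>\<^sup>+t\<in>{0<..}. ennreal (t powr (\<theta> - 1)) *
     (\<integral>\<^sup>+u\<in>{0..}. indicator {u. ennreal t < level_measure g u} u \<partial>lborel) \<partial>lborel)"

lemma measurable_layer [measurable]:
  assumes [measurable]: "g \<in> borel_measurable borel"
  shows "(\<lambda>(t::real, u::real). indicator {u. ennreal t < level_measure g u} u :: ennreal) \<in> borel_measurable (borel \<Otimes>\<^sub>M borel)"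
  unfolding indicator_def mem_Collect_eq by measurable

lemma decreasing_rearrangement_le:
  assumes [measurable]: "g \<in> borel_measurable borel"
  shows "decreasing_rearrangement g t \<le>
    (\<integral>\<^sup>+u\<in>{0..}. indicator {u. ennreal t < level_measure g u} u \<partial>lborel)" (is "_ \<le> ?m")
proof (rule dense_le)
  fix s assume s: "s < decreasing_rearrangement g t"
  then have "s \<noteq> \<top>" by auto
  then obtain r where r: "r \<ge> 0" "s = ennreal r" by (cases s) auto
  have sub: "{0..r} \<subseteq> {u. ennreal t < level_measure g u}"
  proof
    fix u assume l: "u \<in> {0..r}"
    have "ennreal u < decreasing_rearrangement g t"
      by (rule le_less_trans[OF _ s]) (use l r in \<open>auto intro: ennreal_leI\<close>)
    then have "\<not> emeasure lborel {x. ennreal u < ennreal (norm (g x))} \<le> ennreal t"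
      unfolding decreasing_rearrangement_def by (meson CollectI Inf_lower leD)
    then show "u \<in> {u. ennreal t < level_measure g u}"
      using l by (simp add: level_measure_def not_le ennreal_less_iff)
  qed
  have "s = emeasure lborel {0..r}" using r by simp
  also have "\<dots> = (\<integral>\<^sup>+u. indicator {0..r} u \<partial>lborel)" by simp
  also have "\<dots> \<le> ?m"
    using sub by (intro nn_integral_mono) (auto simp: indicator_def)
  finally show "s \<le> ?m" .
qed

lemma lorentz1_norm_le_layers:
  assumes "g \<in> borel_measurable borel"
  shows "lorentz1_norm p g \<le> lorentz_layers (1 / p) g"
  unfolding lorentz1_norm_def lorentz_layers_def
  by (intro nn_integral_mono mult_right_mono mult_left_mono decreasing_rearrangement_le assms) auto

text \<open>
  The Fatou property. A strict inequality \<open>u < norm (g x)\<close> is inherited by the approximants from some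
  index on; this gives Fatou first for the distribution functions and then for both layer integrals.
\<close>

lemma lorentz_layers_liminf:
  assumes [measurable]: "g \<in> borel_measurable borel" "\<And>n. f n \<in> borel_measurable borel"
    and lim: "\<And>x. (\<lambda>n. f n x) \<longlonglongrightarrow> g x"
  shows "lorentz_layers \<theta> g \<le> liminf (\<lambda>n. lorentz_layers \<theta> (f n))"
proof -
  have lev: "level_measure g u \<le> liminf (\<lambda>n. level_measure (f n) u)" for u
  proof -
    have "(indicator {x. u < norm (g x)} x :: ennreal) \<le> liminf (\<lambda>n. indicator {x. u < norm (f n x)} x)" for x
    proof (cases "u < norm (g x)")
      case True
      have "(\<lambda>n. norm (f n x)) \<longlonglongrightarrow> norm (g x)" by (intro tendsto_norm lim)
      from order_tendstoD(1)[OF this True]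
      have "\<forall>\<^sub>F n in sequentially. (1::ennreal) \<le> indicator {x. u < norm (f n x)} x"
        by eventually_elim auto
      then have "1 \<le> liminf (\<lambda>n. indicator {x. u < norm (f n x)} x :: ennreal)"
        by (rule Liminf_bounded)
      then show ?thesis using True by simp
    qed auto
    then have "level_measure g u \<le> (\<integral>\<^sup>+x. liminf (\<lambda>n. indicator {x. u < norm (f n x)} x) \<partial>lborel)"
      by (simp add: level_measure_eq_nn_integral nn_integral_mono del: nn_integral_indicator)
    also have "\<dots> \<le> liminf (\<lambda>n. level_measure (f n) u)"
      unfolding level_measure_eq_nn_integral[OF assms(2)] by (intro nn_integral_liminf) auto
    finally show ?thesis .
  qed
  have ind: "(indicator {u. ennreal t < level_measure g u} u :: ennreal)
      \<le> liminf (\<lambda>n. indicator {u. ennreal t < level_measure (f n) u} u)" for t u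
  proof (cases "ennreal t < level_measure g u")
    case True
    then have "ennreal t < liminf (\<lambda>n. level_measure (f n) u)" using lev by (rule less_le_trans)
    from less_LiminfD[OF this]
    have "\<forall>\<^sub>F n in sequentially. (1::ennreal) \<le> indicator {u. ennreal t < level_measure (f n) u} u"
      by eventually_elim auto
    then have "1 \<le> liminf (\<lambda>n. indicator {u. ennreal t < level_measure (f n) u} u :: ennreal)"
      by (rule Liminf_bounded)
    then show ?thesis using True by simp
  qed auto
  have mult: "c * liminf F \<le> liminf (\<lambda>n. c * F n)" for c :: ennreal and F :: "nat \<Rightarrow> ennreal"
    unfolding liminf_SUP_INF SUP_mult_left_ennreal
    by (intro SUP_mono' INF_greatest mult_left_mono INF_lower) auto
  have inner: "(\<integral>\<^sup>+u\<in>{0..}. indicator {u. ennreal t < level_measure g u} u \<partial>lborel)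
     \<le> liminf (\<lambda>n. \<integral>\<^sup>+u\<in>{0..}. indicator {u. ennreal t < level_measure (f n) u} u \<partial>lborel)" for t
  proof -
    have "(\<integral>\<^sup>+u\<in>{0..}. indicator {u. ennreal t < level_measure g u} u \<partial>lborel)
      \<le> (\<integral>\<^sup>+u. liminf (\<lambda>n. indicator {u. ennreal t < level_measure (f n) u} u * indicator {0..} u) \<partial>lborel)"
      using ind mult by (intro nn_integral_mono) (auto simp: indicator_def[of "{0..}"])
    also have "\<dots> \<le> liminf (\<lambda>n. \<integral>\<^sup>+u\<in>{0..}. indicator {u. ennreal t < level_measure (f n) u} u \<partial>lborel)"
      by (intro nn_integral_liminf) measurable
    finally show ?thesis .
  qed
  have "lorentz_layers \<theta> g \<le> (\<integral>\<^sup>+t. liminf (\<lambda>n. ennreal (t powr (\<theta> - 1)) *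
     (\<integral>\<^sup>+u\<in>{0..}. indicator {u. ennreal t < level_measure (f n) u} u \<partial>lborel) * indicator {0<..} t) \<partial>lborel)"
    unfolding lorentz_layers_def
    using order_trans[OF mult_left_mono[OF inner] mult]
    by (intro nn_integral_mono) (auto simp: indicator_def[of "{0<..}"])
  also have "\<dots> \<le> liminf (\<lambda>n. lorentz_layers \<theta> (f n))"
    unfolding lorentz_layers_def by (intro nn_integral_liminf) measurable
  finally show ?thesis .
qed

lemma nn_integral_powr_to_inf:
  assumes "a < -1" "c > 0"
  shows "(\<integral>\<^sup>+x\<in>{c..}. ennreal (x powr a) \<partial>lborel) = ennreal (- (c powr (a + 1)) / (a + 1))"
proof -
  have "(\<integral>\<^sup>+x\<in>{c..}. ennreal (x powr a) \<partial>lborel) = (\<integral>\<^sup>+x. ennreal (indicator {c..} x * x powr a) \<partial>lborel)"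
    by (intro nn_integral_cong) (auto simp: indicator_def)
  also have "\<dots> = ennreal (- (c powr (a + 1)) / (a + 1))"
    using nn_integral_has_integral_lebesgue[OF _ has_integral_powr_to_inf[OF assms]] by simp
  finally show ?thesis .
qed

lemma nn_integral_powr_from_0:
  assumes "a > -1" "c \<ge> 0"
  shows "(\<integral>\<^sup>+x\<in>{0..c}. ennreal (x powr a) \<partial>lborel) = ennreal (c powr (a + 1) / (a + 1))"
proof -
  have "(\<integral>\<^sup>+x\<in>{0..c}. ennreal (x powr a) \<partial>lborel) = (\<integral>\<^sup>+x. ennreal (indicator {0..c} x * x powr a) \<partial>lborel)"
    by (intro nn_integral_cong) (auto simp: indicator_def)
  also have "\<dots> = ennreal (c powr (a + 1) / (a + 1))"
    using nn_integral_has_integral_lebesgue[OF _ has_integral_powr_from_0[OF assms]] by simp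
  finally show ?thesis .
qed

text \<open>
  The integral of the rearrangement over \<open>(0, s]\<close> is the K-functional of the couple \<open>(L\<^sup>1, L\<^sup>\<infinity>)\<close>,
  so it is bounded by any splitting of \<open>g\<close> into a part of height \<open>L\<close> and the excess above \<open>L\<close>.
\<close>

lemma layers_truncated_le:
  assumes [measurable]: "g \<in> borel_measurable borel" and s: "s > 0" and L: "L \<ge> 0"
  shows "(\<integral>\<^sup>+t\<in>{0<..s}. (\<integral>\<^sup>+u\<in>{0..}. indicator {u. ennreal t < level_measure g u} u \<partial>lborel) \<partial>lborel)
    \<le> ennreal (s * L) + (\<integral>\<^sup>+x. ennreal (norm (g x) - L) \<partial>lborel)"
proof -
  let ?D = "level_measure g"
  let ?I = "\<lambda>u. \<integral>\<^sup>+t\<in>{0<..s}. indicator {u. ennreal t < ?D u} u \<partial>lborel"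
  have swap: "(\<integral>\<^sup>+t\<in>{0<..s}. (\<integral>\<^sup>+u\<in>{0..}. indicator {u. ennreal t < ?D u} u \<partial>lborel) \<partial>lborel)
    = (\<integral>\<^sup>+u\<in>{0..}. ?I u \<partial>lborel)"
  proof -
    have "(\<integral>\<^sup>+t\<in>{0<..s}. (\<integral>\<^sup>+u\<in>{0..}. indicator {u. ennreal t < ?D u} u \<partial>lborel) \<partial>lborel)
      = (\<integral>\<^sup>+t. (\<integral>\<^sup>+u. indicator {u. ennreal t < ?D u} u * indicator {0..} u * indicator {0<..s} t \<partial>lborel) \<partial>lborel)"
      by (intro nn_integral_cong nn_integral_multc[symmetric]) measurable
    also have "\<dots> = (\<integral>\<^sup>+u. (\<integral>\<^sup>+t. indicator {u. ennreal t < ?D u} u * indicator {0..} u * indicator {0<..s} t \<partial>lborel) \<partial>lborel)"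
      by (intro lborel_pair.Fubini') measurable
    also have "\<dots> = (\<integral>\<^sup>+u. (\<integral>\<^sup>+t. indicator {u. ennreal t < ?D u} u * indicator {0<..s} t * indicator {0..} u \<partial>lborel) \<partial>lborel)"
      by (simp only: mult_ac)
    also have "\<dots> = (\<integral>\<^sup>+u\<in>{0..}. ?I u \<partial>lborel)"
      by (intro nn_integral_cong nn_integral_multc) measurable
    finally show ?thesis .
  qed
  have min: "?I u \<le> ennreal s"
       "?I u \<le> ?D u" for u
  proof -
    have "?I u \<le> (\<integral>\<^sup>+t. indicator {0<..s} t \<partial>lborel)"
      by (intro nn_integral_mono) (auto simp: indicator_def)
    then show "?I u \<le> ennreal s"
      using s by simp
    show "?I u \<le> ?D u"
    proof (cases "?D u")
      case (real r)
      have "?I u \<le> (\<integral>\<^sup>+t. indicator {0..r} t \<partial>lborel)"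
        using real by (intro nn_integral_mono) (auto simp: indicator_def ennreal_less_iff)
      then show ?thesis using real by simp
    qed auto
  qed
  have "(\<integral>\<^sup>+u\<in>{0..}. ?I u \<partial>lborel)
    \<le> (\<integral>\<^sup>+u. ennreal s * indicator {0..L} u + ?D u * indicator {L<..} u \<partial>lborel)"
    using min by (intro nn_integral_mono) (auto simp: indicator_def)
  also have "\<dots> = ennreal s * ennreal L + (\<integral>\<^sup>+u. ?D u * indicator {L<..} u \<partial>lborel)"
    using L by (subst nn_integral_add) (auto simp: nn_integral_cmult)
  also have "(\<integral>\<^sup>+u. ?D u * indicator {L<..} u \<partial>lborel)
      = (\<integral>\<^sup>+u. (\<integral>\<^sup>+x. indicator {L<..} u * indicator {x. u < norm (g x)} x \<partial>lborel) \<partial>lborel)"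
    by (intro nn_integral_cong) (simp add: level_measure_eq_nn_integral nn_integral_cmult mult.commute del: nn_integral_indicator)
  also have "\<dots> = (\<integral>\<^sup>+x. (\<integral>\<^sup>+u. indicator {L<..} u * indicator {x. u < norm (g x)} x \<partial>lborel) \<partial>lborel)"
  proof -
    have [measurable]: "(\<lambda>(u, x). indicator {L<..} u * indicator {x. u < norm (g x)} x :: ennreal) \<in> borel_measurable (borel \<Otimes>\<^sub>M borel)"
      unfolding indicator_def mem_Collect_eq by measurable
    show ?thesis by (intro pair_sigma_finite.Fubini' pair_sigma_finite.intro sigma_finite_lborel) simp
  qed
  also have "\<dots> = (\<integral>\<^sup>+x. (\<integral>\<^sup>+u. indicator {L<..<norm (g x)} u \<partial>lborel) \<partial>lborel)"
    by (intro nn_integral_cong) (auto simp: indicator_def)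
  also have "\<dots> = (\<integral>\<^sup>+x. ennreal (norm (g x) - L) \<partial>lborel)"
  proof (intro nn_integral_cong)
    fix x
    show "(\<integral>\<^sup>+u. indicator {L<..<norm (g x)} u \<partial>lborel) = ennreal (norm (g x) - L)"
      by (cases "L \<le> norm (g x)") (auto simp: ennreal_neg)
  qed
  finally show ?thesis using swap s L by (simp add: ennreal_mult)
qed

text \<open>
  The weight \<open>t powr (\<theta> - 1)\<close> is decreasing, hence a superposition of indicators of the intervals
  \<open>(0, s]\<close> with density \<open>(1 - \<theta>) s powr (\<theta> - 2)\<close>; on each of these intervals the truncation bound is used
  with a level adapted to \<open>s\<close>.
\<close>

lemma lorentz_layers_le_truncation:
  assumes [measurable]: "g \<in> borel_measurable borel" and \<theta>: "0 < \<theta>" "\<theta> < 1"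
    and L: "\<And>s. s > 0 \<Longrightarrow> L s \<ge> 0" and [measurable]: "h \<in> borel_measurable borel"
    and h: "\<And>s. s > 0 \<Longrightarrow> ennreal (s * L s) + (\<integral>\<^sup>+x. ennreal (norm (g x) - L s) \<partial>lborel) \<le> h s"
  shows "lorentz_layers \<theta> g \<le> ennreal (1 - \<theta>) * (\<integral>\<^sup>+s\<in>{0<..}. ennreal (s powr (\<theta> - 2)) * h s \<partial>lborel)"
proof -
  let ?G = "\<lambda>t. (\<integral>\<^sup>+u\<in>{0..}. indicator {u. ennreal t < level_measure g u} u \<partial>lborel)"
  have w: "ennreal (t powr (\<theta> - 1)) = ennreal (1 - \<theta>) * (\<integral>\<^sup>+s\<in>{t..}. ennreal (s powr (\<theta> - 2)) \<partial>lborel)"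
    if "t > 0" for t
  proof -
    have "\<theta> - 2 + 1 = \<theta> - 1" by simp
    then have "(\<integral>\<^sup>+s\<in>{t..}. ennreal (s powr (\<theta> - 2)) \<partial>lborel) = ennreal (t powr (\<theta> - 1) / (1 - \<theta>))"
      using nn_integral_powr_to_inf[of "\<theta> - 2" t] that \<theta> by (simp add: field_simps minus_divide_right)
    then show ?thesis using \<theta> by (simp add: ennreal_mult[symmetric])
  qed
  have "lorentz_layers \<theta> g = (\<integral>\<^sup>+t. (\<integral>\<^sup>+s. ennreal (1 - \<theta>) * (ennreal (s powr (\<theta> - 2)) * indicator {t..} s) * (?G t * indicator {0<..} t) \<partial>lborel) \<partial>lborel)"
    unfolding lorentz_layers_def
    by (intro nn_integral_cong) (auto simp: indicator_def[of "{0<..}"] w nn_integral_cmult nn_integral_multc)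
  also have "\<dots> = (\<integral>\<^sup>+s. (\<integral>\<^sup>+t. ennreal (1 - \<theta>) * (ennreal (s powr (\<theta> - 2)) * indicator {t..} s) * (?G t * indicator {0<..} t) \<partial>lborel) \<partial>lborel)"
    by (intro lborel_pair.Fubini') (simp add: indicator_def[of "{_..}"], measurable)
  also have "\<dots> = (\<integral>\<^sup>+s. ennreal (1 - \<theta>) * (ennreal (s powr (\<theta> - 2)) * (indicator {0<..} s * (\<integral>\<^sup>+t\<in>{0<..s}. ?G t \<partial>lborel))) \<partial>lborel)"
  proof (intro nn_integral_cong)
    fix s :: real
    have "(\<integral>\<^sup>+t. ennreal (1 - \<theta>) * (ennreal (s powr (\<theta> - 2)) * indicator {t..} s) * (?G t * indicator {0<..} t) \<partial>lborel)
      = (\<integral>\<^sup>+t. ennreal (1 - \<theta>) * (ennreal (s powr (\<theta> - 2)) * indicator {0<..} s) * (?G t * indicator {0<..s} t) \<partial>lborel)"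
      by (intro nn_integral_cong) (auto simp: indicator_def[of "{_..}"] indicator_def[of "{_<..}"] indicator_def[of "{_<.._}"])
    also have "\<dots> = ennreal (1 - \<theta>) * (ennreal (s powr (\<theta> - 2)) * indicator {0<..} s) * (\<integral>\<^sup>+t\<in>{0<..s}. ?G t \<partial>lborel)"
      by (intro nn_integral_cmult) measurable
    finally show "(\<integral>\<^sup>+t. ennreal (1 - \<theta>) * (ennreal (s powr (\<theta> - 2)) * indicator {t..} s) * (?G t * indicator {0<..} t) \<partial>lborel)
      = ennreal (1 - \<theta>) * (ennreal (s powr (\<theta> - 2)) * (indicator {0<..} s * (\<integral>\<^sup>+t\<in>{0<..s}. ?G t \<partial>lborel)))"
      by (simp only: mult.assoc)
  qed
  also have "\<dots> \<le> (\<integral>\<^sup>+s. ennreal (1 - \<theta>) * (ennreal (s powr (\<theta> - 2)) * (indicator {0<..} s * h s)) \<partial>lborel)"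
  proof (rule nn_integral_mono, rule mult_left_mono, rule mult_left_mono)
    fix s :: real
    show "indicator {0<..} s * (\<integral>\<^sup>+t\<in>{0<..s}. ?G t \<partial>lborel) \<le> indicator {0<..} s * h s"
    proof (cases "s > 0")
      case True
      then show ?thesis
        using order_trans[OF layers_truncated_le[OF assms(1) True L[OF True]] h[OF True]] by simp
    qed simp
  qed auto
  also have "\<dots> = ennreal (1 - \<theta>) * (\<integral>\<^sup>+s. ennreal (s powr (\<theta> - 2)) * (indicator {0<..} s * h s) \<partial>lborel)"
    by (intro nn_integral_cmult) measurable
  also have "(\<integral>\<^sup>+s. ennreal (s powr (\<theta> - 2)) * (indicator {0<..} s * h s) \<partial>lborel)
    = (\<integral>\<^sup>+s\<in>{0<..}. ennreal (s powr (\<theta> - 2)) * h s \<partial>lborel)"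
    by (intro nn_integral_cong) (auto simp: mult_ac)
  finally show ?thesis .
qed

lemma nn_integral_powr_min:
  assumes \<theta>: "0 < \<theta>" "\<theta> < 1" and A: "A > 0" and B: "B > 0"
  shows "(\<integral>\<^sup>+s\<in>{0<..}. ennreal (s powr (\<theta> - 2)) * ennreal (min A (s * B)) \<partial>lborel)
    \<le> ennreal ((1 / \<theta> + 1 / (1 - \<theta>)) * (A powr \<theta> * B powr (1 - \<theta>)))"
proof -
  \<comment> \<open>The point where the two entries of the minimum agree.\<close>
  define a where "a = A / B"
  have a: "a > 0" using A B by (simp add: a_def)
  have "(\<integral>\<^sup>+s\<in>{0<..}. ennreal (s powr (\<theta> - 2)) * ennreal (min A (s * B)) \<partial>lborel)
     \<le> (\<integral>\<^sup>+s. ennreal B * (ennreal (s powr (\<theta> - 1)) * indicator {0..a} s) + ennreal A * (ennreal (s powr (\<theta> - 2)) * indicator {a..} s) \<partial>lborel)"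
  proof (intro nn_integral_mono)
    fix s :: real
    have "s powr (\<theta> - 2) * s = s powr (\<theta> - 1)" if "s > 0"
      using powr_add[of s "\<theta> - 2" 1] that by simp
    then have "ennreal (s powr (\<theta> - 2)) * ennreal (s * B) = ennreal B * ennreal (s powr (\<theta> - 1))" if "s > 0"
      using that B by (simp add: ennreal_mult[symmetric] mult_ac)
    moreover have "ennreal (s powr (\<theta> - 2)) * ennreal (min A (s * B)) \<le> ennreal (s powr (\<theta> - 2)) * ennreal (s * B)"
      by (intro mult_left_mono ennreal_leI) auto
    moreover have "ennreal (s powr (\<theta> - 2)) * ennreal (min A (s * B)) \<le> ennreal A * ennreal (s powr (\<theta> - 2))"
      by (subst mult.commute, intro mult_right_mono ennreal_leI) auto
    ultimately show "ennreal (s powr (\<theta> - 2)) * ennreal (min A (s * B)) * indicator {0<..} s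
      \<le> ennreal B * (ennreal (s powr (\<theta> - 1)) * indicator {0..a} s) + ennreal A * (ennreal (s powr (\<theta> - 2)) * indicator {a..} s)"
      by (cases "s > 0"; cases "s \<le> a") (auto simp: indicator_def intro: add_increasing2)
  qed
  also have "\<dots> = ennreal B * (\<integral>\<^sup>+s\<in>{0..a}. ennreal (s powr (\<theta> - 1)) \<partial>lborel) + ennreal A * (\<integral>\<^sup>+s\<in>{a..}. ennreal (s powr (\<theta> - 2)) \<partial>lborel)"
    by (simp add: nn_integral_add nn_integral_cmult)
  also have "(\<integral>\<^sup>+s\<in>{0..a}. ennreal (s powr (\<theta> - 1)) \<partial>lborel) = ennreal (a powr \<theta> / \<theta>)"
    using nn_integral_powr_from_0[of "\<theta> - 1" a] \<theta> a by simp
  also have "(\<integral>\<^sup>+s\<in>{a..}. ennreal (s powr (\<theta> - 2)) \<partial>lborel) = ennreal (a powr (\<theta> - 1) / (1 - \<theta>))"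
  proof -
    have "\<theta> - 2 + 1 = \<theta> - 1" by simp
    then show ?thesis
      using nn_integral_powr_to_inf[of "\<theta> - 2" a] a \<theta> by (simp add: field_simps minus_divide_right)
  qed
  also have "ennreal B * ennreal (a powr \<theta> / \<theta>) + ennreal A * ennreal (a powr (\<theta> - 1) / (1 - \<theta>))
     = ennreal (B * (a powr \<theta> / \<theta>) + A * (a powr (\<theta> - 1) / (1 - \<theta>)))"
    using A B \<theta> by (simp add: ennreal_mult[symmetric] ennreal_plus[symmetric] del: ennreal_plus)
  also have "B * (a powr \<theta> / \<theta>) + A * (a powr (\<theta> - 1) / (1 - \<theta>)) = (1 / \<theta> + 1 / (1 - \<theta>)) * (A powr \<theta> * B powr (1 - \<theta>))"
  proof -
    have "B * a powr \<theta> = A powr \<theta> * B powr (1 - \<theta>)" "A * a powr (\<theta> - 1) = A powr \<theta> * B powr (1 - \<theta>)"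
      using A B by (simp_all add: a_def powr_divide powr_diff field_simps)
    then show ?thesis by (simp add: distrib_right)
  qed
  finally show ?thesis .
qed

text \<open>
  This replaces the triangle inequality of \<open>L\<^bsup>p,1\<^esup>\<close> and bounds each term by the geometric mean of its
  \<open>L\<^sup>1\<close> and \<open>L\<^sup>\<infinity>\<close> bounds at the same time. For every \<open>s\<close> each term is placed as a whole in the
  cheaper of the two spaces, at the cost \<open>min (A i) (s * B i)\<close>. These costs add up, so the constant does not
  depend on the number of terms.
\<close>

lemma lorentz_layers_sum_le:
  fixes f :: "'i \<Rightarrow> 'a::euclidean_space \<Rightarrow> complex"
  assumes I: "finite I" and f [measurable]: "\<And>i. i \<in> I \<Longrightarrow> f i \<in> borel_measurable borel" and \<theta>: "0 < \<theta>" "\<theta> < 1"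
    and A: "\<And>i. i \<in> I \<Longrightarrow> A i > 0" "\<And>i. i \<in> I \<Longrightarrow> L1_norm (f i) \<le> ennreal (A i)"
    and B: "\<And>i. i \<in> I \<Longrightarrow> B i > 0" "\<And>i x. i \<in> I \<Longrightarrow> norm (f i x) \<le> B i"
  shows "lorentz_layers \<theta> (\<lambda>x. \<Sum>i\<in>I. of_real (c i) * f i x)
    \<le> ennreal (1 / \<theta> * (\<Sum>i\<in>I. \<bar>c i\<bar> * (A i powr \<theta> * B i powr (1 - \<theta>))))"
proof -
  \<comment> \<open>The truncation level collects the heights of the terms that are cheaper in \<open>L\<^sup>\<infinity>\<close>.\<close>
  define L where "L s = (\<Sum>i\<in>I. \<bar>c i\<bar> * (if s * B i \<le> A i then B i else 0))" for s
  define h where "h s = (\<Sum>i\<in>I. ennreal \<bar>c i\<bar> * ennreal (min (A i) (s * B i)))" for s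
  let ?g = "\<lambda>x. \<Sum>i\<in>I. of_real (c i) * f i x"
  have [measurable]: "?g \<in> borel_measurable borel" by (intro borel_measurable_sum) measurable
  have [measurable]: "h \<in> borel_measurable borel" unfolding h_def by measurable
  have L0: "L s \<ge> 0" for s
    unfolding L_def using B by (intro sum_nonneg mult_nonneg_nonneg) (auto intro: less_imp_le)
  have key: "ennreal (s * L s) + (\<integral>\<^sup>+x. ennreal (norm (?g x) - L s) \<partial>lborel) \<le> h s" if s: "s > 0" for s
  proof -
    have "norm (?g x) - L s \<le> (\<Sum>i\<in>I. \<bar>c i\<bar> * (if s * B i \<le> A i then 0 else norm (f i x)))" for x
    proof -
      have "norm (?g x) \<le> (\<Sum>i\<in>I. \<bar>c i\<bar> * norm (f i x))"
        using norm_sum[of "\<lambda>i. of_real (c i) * f i x" I] by (simp add: norm_mult)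
      then have "norm (?g x) - L s \<le> (\<Sum>i\<in>I. \<bar>c i\<bar> * norm (f i x) - \<bar>c i\<bar> * (if s * B i \<le> A i then B i else 0))"
        by (simp add: L_def sum_subtractf)
      also have "\<dots> \<le> (\<Sum>i\<in>I. \<bar>c i\<bar> * (if s * B i \<le> A i then 0 else norm (f i x)))"
        using B(2) by (intro sum_mono) (auto intro: mult_left_mono)
      finally show ?thesis .
    qed
    then have "(\<integral>\<^sup>+x. ennreal (norm (?g x) - L s) \<partial>lborel)
      \<le> (\<integral>\<^sup>+x. ennreal (\<Sum>i\<in>I. \<bar>c i\<bar> * (if s * B i \<le> A i then 0 else norm (f i x))) \<partial>lborel)"
      by (intro nn_integral_mono ennreal_leI)
    also have "\<dots> = (\<integral>\<^sup>+x. (\<Sum>i\<in>I. ennreal \<bar>c i\<bar> * (if s * B i \<le> A i then 0 else ennreal (norm (f i x)))) \<partial>lborel)"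
      by (intro nn_integral_cong, subst sum_ennreal[symmetric]) (auto simp: ennreal_mult intro!: sum.cong)
    also have "\<dots> = (\<Sum>i\<in>I. ennreal \<bar>c i\<bar> * (if s * B i \<le> A i then 0 else L1_norm (f i)))"
      by (subst nn_integral_sum) (auto simp: nn_integral_cmult intro!: sum.cong)
    also have "\<dots> \<le> (\<Sum>i\<in>I. ennreal \<bar>c i\<bar> * (if s * B i \<le> A i then 0 else ennreal (A i)))"
      using A(2) by (intro sum_mono mult_left_mono) auto
    finally have 1: "(\<integral>\<^sup>+x. ennreal (norm (?g x) - L s) \<partial>lborel) \<le> \<dots>" .
    have 2: "ennreal (s * L s) = (\<Sum>i\<in>I. ennreal \<bar>c i\<bar> * (if s * B i \<le> A i then ennreal (s * B i) else 0))"
    proof -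
      have "s * L s = (\<Sum>i\<in>I. \<bar>c i\<bar> * (if s * B i \<le> A i then s * B i else 0))"
        by (auto simp: L_def sum_distrib_left intro!: sum.cong)
      then show ?thesis
        using B(1) s by (simp only:, subst sum_ennreal[symmetric]) (auto simp: ennreal_mult less_imp_le intro!: sum.cong)
    qed
    have "ennreal (s * L s) + (\<integral>\<^sup>+x. ennreal (norm (?g x) - L s) \<partial>lborel)
      \<le> (\<Sum>i\<in>I. ennreal \<bar>c i\<bar> * (if s * B i \<le> A i then ennreal (s * B i) else 0) + ennreal \<bar>c i\<bar> * (if s * B i \<le> A i then 0 else ennreal (A i)))"
      using 1 unfolding 2 sum.distrib by (rule add_left_mono)
    also have "\<dots> = h s"
      unfolding h_def by (intro sum.cong) auto
    finally show ?thesis .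
  qed
  have "lorentz_layers \<theta> ?g \<le> ennreal (1 - \<theta>) * (\<integral>\<^sup>+s\<in>{0<..}. ennreal (s powr (\<theta> - 2)) * h s \<partial>lborel)"
    by (rule lorentz_layers_le_truncation[where L = L]) (use L0 key \<theta> in auto)
  also have "(\<integral>\<^sup>+s\<in>{0<..}. ennreal (s powr (\<theta> - 2)) * h s \<partial>lborel)
    = (\<integral>\<^sup>+s. (\<Sum>i\<in>I. ennreal \<bar>c i\<bar> * (ennreal (s powr (\<theta> - 2)) * ennreal (min (A i) (s * B i)) * indicator {0<..} s)) \<partial>lborel)"
    by (intro nn_integral_cong) (auto simp: h_def sum_distrib_left sum_distrib_right mult_ac intro!: sum.cong)
  also have "\<dots> = (\<Sum>i\<in>I. ennreal \<bar>c i\<bar> * (\<integral>\<^sup>+s\<in>{0<..}. ennreal (s powr (\<theta> - 2)) * ennreal (min (A i) (s * B i)) \<partial>lborel))"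
    by (subst nn_integral_sum) (auto simp: nn_integral_cmult)
  also have "\<dots> \<le> (\<Sum>i\<in>I. ennreal \<bar>c i\<bar> * ennreal ((1 / \<theta> + 1 / (1 - \<theta>)) * (A i powr \<theta> * B i powr (1 - \<theta>))))"
    using A(1) B(1) \<theta> by (intro sum_mono mult_left_mono nn_integral_powr_min) auto
  also have "\<dots> = ennreal (\<Sum>i\<in>I. \<bar>c i\<bar> * ((1 / \<theta> + 1 / (1 - \<theta>)) * (A i powr \<theta> * B i powr (1 - \<theta>))))"
    using \<theta> by (subst sum_ennreal[symmetric]) (auto simp: ennreal_mult)
  finally have "lorentz_layers \<theta> ?g \<le> ennreal (1 - \<theta>) * \<dots>"
    by (simp add: mult_left_mono)
  also have "\<dots> = ennreal ((1 - \<theta>) * (\<Sum>i\<in>I. \<bar>c i\<bar> * ((1 / \<theta> + 1 / (1 - \<theta>)) * (A i powr \<theta> * B i powr (1 - \<theta>)))))"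
    using \<theta> by (intro ennreal_mult[symmetric] sum_nonneg) auto
  also have "(1 - \<theta>) * (\<Sum>i\<in>I. \<bar>c i\<bar> * ((1 / \<theta> + 1 / (1 - \<theta>)) * (A i powr \<theta> * B i powr (1 - \<theta>))))
     = (1 - \<theta>) * (1 / \<theta> + 1 / (1 - \<theta>)) * (\<Sum>i\<in>I. \<bar>c i\<bar> * (A i powr \<theta> * B i powr (1 - \<theta>)))"
    by (simp add: sum_distrib_left mult_ac)
  also have "(1 - \<theta>) * (1 / \<theta> + 1 / (1 - \<theta>)) = 1 / \<theta>"
    using \<theta> by (simp add: field_simps)
  finally show ?thesis .
qed

section \<open>Integrability of inverse Fourier transforms\<close>

text \<open>
  Differentiability of order \<open>N\<close> along the single direction \<open>v\<close>, together with vanishing outside \<open>S\<close>. Pure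
  derivatives along basis vectors suffice for decay of the Fourier transform. Prescribing \<open>S\<close> is what allows
  multiplication by functions that are smooth off the origin only.
\<close>

primrec smooth_along ::
  "'a::euclidean_space \<Rightarrow> 'a set \<Rightarrow> nat \<Rightarrow> ('a \<Rightarrow> complex) \<Rightarrow> bool" where
  "smooth_along v S 0 f \<longleftrightarrow> continuous_on UNIV f \<and> (\<forall>x. x \<notin> S \<longrightarrow> f x = 0)"
| "smooth_along v S (Suc N) f \<longleftrightarrow> continuous_on UNIV f \<and> (\<forall>x. x \<notin> S \<longrightarrow> f x = 0) \<and>
     (\<exists>f'. smooth_along v S N f' \<and> (\<forall>x. ((\<lambda>s. f (x + s *\<^sub>R v)) has_vector_derivative f' x) (at 0)))"

lemma smooth_along_continuous: "smooth_along v S N f \<Longrightarrow> continuous_on UNIV f"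
  and smooth_along_zero: "smooth_along v S N f \<Longrightarrow> x \<notin> S \<Longrightarrow> f x = 0"
  by (cases N; simp)+

lemma smooth_along_SucD:
  assumes "smooth_along v S (Suc N) f"
  shows "\<exists>f'. smooth_along v S N f' \<and> (\<forall>x. ((\<lambda>s. f (x + s *\<^sub>R v)) has_vector_derivative f' x) (at 0))"
  using assms by simp

lemma smooth_along_Suc_D: "smooth_along v S (Suc N) f \<Longrightarrow> smooth_along v S N f"
proof (induction N arbitrary: f)
  case (Suc N)
  obtain f' where "smooth_along v S (Suc N) f'"
    "\<And>x. ((\<lambda>s. f (x + s *\<^sub>R v)) has_vector_derivative f' x) (at 0)"
    using smooth_along_SucD[OF Suc.prems] by blast
  then show ?case
    using Suc.IH[of f'] smooth_along_continuous[OF Suc.prems] smooth_along_zero[OF Suc.prems] by auto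
qed auto

lemma smooth_along_add:
  "smooth_along v S N f \<Longrightarrow> smooth_along v S N g \<Longrightarrow> smooth_along v S N (\<lambda>x. f x + g x)"
proof (induction N arbitrary: f g)
  case (Suc N)
  obtain f' where f': "smooth_along v S N f'"
    "\<And>x. ((\<lambda>s. f (x + s *\<^sub>R v)) has_vector_derivative f' x) (at 0)"
    using smooth_along_SucD[OF Suc.prems(1)] by blast
  obtain g' where g': "smooth_along v S N g'"
    "\<And>x. ((\<lambda>s. g (x + s *\<^sub>R v)) has_vector_derivative g' x) (at 0)"
    using smooth_along_SucD[OF Suc.prems(2)] by blast
  show ?case
    unfolding smooth_along.simps
  proof (intro conjI exI[of _ "\<lambda>x. f' x + g' x"] allI impI)
    show "continuous_on UNIV (\<lambda>x. f x + g x)"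
      by (intro continuous_intros smooth_along_continuous[OF Suc.prems(1)] smooth_along_continuous[OF Suc.prems(2)])
  qed (use Suc.IH[OF f'(1) g'(1)] smooth_along_zero Suc.prems in
      \<open>auto intro!: has_vector_derivative_add f'(2) g'(2)\<close>)
qed (auto intro!: continuous_intros)

lemma smooth_along_cmult:
  "smooth_along v S N f \<Longrightarrow> smooth_along v S N (\<lambda>x. c * f x)"
proof (induction N arbitrary: f)
  case (Suc N)
  obtain f' where f': "smooth_along v S N f'"
    "\<And>x. ((\<lambda>s. f (x + s *\<^sub>R v)) has_vector_derivative f' x) (at 0)"
    using smooth_along_SucD[OF Suc.prems(1)] by blast
  show ?case
    unfolding smooth_along.simps
  proof (intro conjI exI[of _ "\<lambda>x. c * f' x"] allI impI)
    show "continuous_on UNIV (\<lambda>x. c * f x)"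
      by (intro continuous_intros smooth_along_continuous[OF Suc.prems])
  qed (use Suc.IH[OF f'(1)] smooth_along_zero Suc.prems in
      \<open>auto intro!: has_vector_derivative_mult_right f'(2)\<close>)
qed (auto intro!: continuous_intros)

text \<open>
  The span of these functions is closed under differentiation along \<open>v\<close> away from the origin, and it contains
  the factor, up to a constant, that turns \<open>\<psi>\<close> into the symbol of a block with a Gaussian split off.
\<close>

definition gauss_monomial :: "real \<Rightarrow> 'a::euclidean_space \<Rightarrow> nat \<Rightarrow> real \<Rightarrow> 'a \<Rightarrow> real" where
  "gauss_monomial c v k b x = (x \<bullet> v) ^ k * (x \<bullet> x) powr b * exp (c * (x \<bullet> x))"

lemma gauss_monomial_deriv:
  assumes "x \<noteq> 0"
  shows "((\<lambda>s. gauss_monomial c v k b (x + s *\<^sub>R v)) has_real_derivative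
     real k * (v \<bullet> v) * gauss_monomial c v (k - 1) b x + 2 * b * gauss_monomial c v (k + 1) (b - 1) x
       + 2 * c * gauss_monomial c v (k + 1) b x) (at 0)"
proof -
  have x: "x \<bullet> x > 0" using assms by simp
  have e1: "(x + s *\<^sub>R v) \<bullet> (x + s *\<^sub>R v) = x \<bullet> x + 2 * s * (x \<bullet> v) + s * s * (v \<bullet> v)" for s
    by (simp add: inner_add_left inner_add_right inner_commute algebra_simps)
  have e2: "(x + s *\<^sub>R v) \<bullet> v = x \<bullet> v + s * (v \<bullet> v)" for s
    by (simp add: inner_add_left)
  let ?q = "\<lambda>s. x \<bullet> x + 2 * s * (x \<bullet> v) + s * s * (v \<bullet> v)"
  have p: "((\<lambda>s. (x \<bullet> v + s * (v \<bullet> v)) ^ k) has_real_derivative real k * (v \<bullet> v) * (x \<bullet> v) ^ (k - 1)) (at 0)"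
    by (auto intro!: derivative_eq_intros)
  have q: "(?q has_real_derivative 2 * (x \<bullet> v)) (at 0)"
    by (auto intro!: derivative_eq_intros)
  have r: "((\<lambda>s. ?q s powr b) has_real_derivative b * (x \<bullet> x) powr (b - 1) * (2 * (x \<bullet> v))) (at 0)"
    using DERIV_chain2[OF has_real_derivative_powr[of "?q 0" b] q] x by simp
  have e: "((\<lambda>s. exp (c * ?q s)) has_real_derivative exp (c * (x \<bullet> x)) * (c * (2 * (x \<bullet> v)))) (at 0)"
    using DERIV_chain2[OF DERIV_exp[of "c * ?q 0"] DERIV_cmult[OF q, of c]] by simp
  show ?thesis
    unfolding gauss_monomial_def e1 e2
    using DERIV_mult[OF DERIV_mult[OF p r] e] by (simp add: algebra_simps)
qed

lemma smooth_along_mult_continuous: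
  assumes S: "closed S" "0 \<notin> S" and f: "smooth_along v S N f"
  shows "continuous (at x) (\<lambda>x. f x * complex_of_real (gauss_monomial c v k b x))"
proof (cases "x \<in> S")
  case True
  then have "x \<noteq> 0" using S by auto
  moreover have "isCont f x"
    using smooth_along_continuous[OF f] by (simp add: continuous_on_eq_continuous_at)
  ultimately show ?thesis
    unfolding gauss_monomial_def by (intro continuous_intros) auto
next
  case False
  then have "\<forall>\<^sub>F y in nhds x. y \<in> - S" using S by (intro eventually_nhds_in_open) auto
  then have "\<forall>\<^sub>F y in nhds x. f y * complex_of_real (gauss_monomial c v k b y) = 0"
    by eventually_elim (simp add: smooth_along_zero[OF f])
  from isCont_cong[OF this] show ?thesis by simp
qed

text \<open>
  The singularity of the monomial at the origin is invisible, because \<open>f\<close> vanishes near it. The induction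
  needs all exponents \<open>k\<close> and \<open>b\<close> at once, since differentiation changes them.
\<close>

lemma smooth_along_gauss_monomial:
  assumes S: "closed S" "0 \<notin> S"
  shows "smooth_along v S N f \<Longrightarrow> smooth_along v S N (\<lambda>x. f x * complex_of_real (gauss_monomial c v k b x))"
proof (induction N arbitrary: f k b)
  case base: 0
  have "continuous (at x) (\<lambda>x. f x * complex_of_real (gauss_monomial c v k b x))" for x
    by (rule smooth_along_mult_continuous[OF S base])
  then show ?case
    using base by (auto simp: continuous_on_eq_continuous_at)
next
  case (Suc N)
  obtain f' where f': "smooth_along v S N f'"
    "\<And>x. ((\<lambda>s. f (x + s *\<^sub>R v)) has_vector_derivative f' x) (at 0)"
    using smooth_along_SucD[OF Suc.prems] by blast
  let ?h = "\<lambda>k b x. complex_of_real (gauss_monomial c v k b x)"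
  define g where "g x = f' x * ?h k b x + (of_real (real k * (v \<bullet> v)) * (f x * ?h (k - 1) b x)
     + (of_real (2 * b) * (f x * ?h (k + 1) (b - 1) x) + of_real (2 * c) * (f x * ?h (k + 1) b x)))" for x
  have "smooth_along v S N g"
    unfolding g_def
    by (intro smooth_along_add smooth_along_cmult Suc.IH f'(1) smooth_along_Suc_D[OF Suc.prems])
  moreover have "((\<lambda>s. f (x + s *\<^sub>R v) * ?h k b (x + s *\<^sub>R v)) has_vector_derivative g x) (at 0)" for x
  proof (cases "x \<in> S")
    case True
    then have "x \<noteq> 0" using S by auto
    note D = has_vector_derivative_of_real[OF gauss_monomial_deriv[OF this]]
    from has_vector_derivative_mult[OF f'(2) D, of x c v k b] show ?thesis
      by (simp add: g_def algebra_simps)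
  next
    case False
    have "open ((\<lambda>s::real. x + s *\<^sub>R v) -` (- S))"
      using S by (intro open_vimage) (auto intro!: continuous_intros)
    moreover have "((\<lambda>_. 0::complex) has_vector_derivative 0) (at (0::real))" by simp
    moreover have "f (x + s *\<^sub>R v) * ?h k b (x + s *\<^sub>R v) = 0" if "s \<in> (\<lambda>s. x + s *\<^sub>R v) -` (- S)" for s
      using smooth_along_zero[OF Suc.prems, of "x + s *\<^sub>R v"] that by simp
    moreover have "0 \<in> (\<lambda>s. x + s *\<^sub>R v) -` (- S)" using False by simp
    ultimately have "((\<lambda>s. f (x + s *\<^sub>R v) * ?h k b (x + s *\<^sub>R v)) has_vector_derivative 0) (at 0)"
      by (rule_tac has_vector_derivative_transform_within_open[where f="\<lambda>_. 0::complex" and f'=0 and S = "(\<lambda>s::real. x + s *\<^sub>R v) -` (- S)"]) simp_all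
    moreover have "g x = 0"
      using False smooth_along_zero[OF Suc.prems] smooth_along_zero[OF f'(1)] by (simp add: g_def)
    ultimately show ?thesis by simp
  qed
  moreover have "continuous (at x) (\<lambda>x. f x * ?h k b x)" for x
    by (rule smooth_along_mult_continuous[OF S Suc.prems])
  ultimately show ?case
    using smooth_along_zero[OF Suc.prems] by (auto simp: continuous_on_eq_continuous_at)
qed

lemma iterated_derivative_zero_outside:
  "x \<notin> closure {x. f x \<noteq> 0} \<Longrightarrow> iterated_derivative vs f x = 0"
proof (induction vs arbitrary: x)
  case Nil
  then show ?case using closure_subset by force
next
  case (Cons v vs)
  have "((\<lambda>_. 0) has_derivative (\<lambda>_. 0)) (at x)" by simp
  then have "(iterated_derivative vs f has_derivative (\<lambda>_. 0)) (at x)"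
    by (rule has_derivative_transform_within_open[where s = "- closure {x. f x \<noteq> 0}"])
      (use Cons in auto)
  from frechet_derivative_at[OF this] show ?case
    by (simp add: fun_eq_iff)
qed

lemma smooth_along_iterated_derivative:
  assumes "smooth f"
  shows "smooth_along v (closure {x. f x \<noteq> 0}) N (iterated_derivative (replicate k v) f)"
proof (induction N arbitrary: k)
  case base: 0
  have "iterated_derivative (replicate k v) f differentiable_on UNIV"
    using assms by (simp add: smooth_def)
  then show ?case
    using iterated_derivative_zero_outside[of _ f "replicate k v"]
    by (auto intro: differentiable_imp_continuous_on)
next
  case (Suc N)
  let ?g = "iterated_derivative (replicate k v) f"
  have d: "?g differentiable_on UNIV"
    using assms by (simp add: smooth_def)
  have "((\<lambda>s. ?g (x + s *\<^sub>R v)) has_vector_derivative iterated_derivative (replicate (Suc k) v) f x) (at 0)" for x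
  proof -
    have "?g differentiable at (x + 0 *\<^sub>R v)" using d by (simp add: differentiable_on_def)
    then have 1: "(?g has_derivative frechet_derivative ?g (at x)) (at (x + 0 *\<^sub>R v))"
      using frechet_derivative_works by auto
    have 2: "((\<lambda>s. x + s *\<^sub>R v) has_derivative (\<lambda>s. s *\<^sub>R v)) (at 0)"
      by (auto intro!: derivative_eq_intros)
    have "linear (frechet_derivative ?g (at x))"
      using 1 has_derivative_linear by blast
    then show ?thesis
      using has_derivative_compose[OF 2 1]
      by (simp add: has_vector_derivative_def linear_cmul)
  qed
  then show ?case
    using Suc.IH[of "Suc k"] iterated_derivative_zero_outside[of _ f "replicate k v"] d
    unfolding smooth_along.simps by (blast intro: differentiable_imp_continuous_on)
qed

lemma smooth_along_integrable:
  assumes "smooth_along v S N f" "compact S"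
  shows "integrable lborel f"
proof -
  have "integrable lborel (\<lambda>x. indicator S x *\<^sub>R f x)"
    using assms smooth_along_continuous continuous_on_subset
    by (intro borel_integrable_compact) blast+
  also have "(\<lambda>x. indicator S x *\<^sub>R f x) = f"
    using smooth_along_zero[OF assms(1)] by (auto simp: indicator_def)
  finally show ?thesis .
qed

lemma vector_derivative_seq:
  fixes g :: "real \<Rightarrow> complex"
  assumes "(g has_vector_derivative g') (at 0)"
  shows "(\<lambda>n. real (Suc n) *\<^sub>R (g (1 / real (Suc n)) - g 0)) \<longlonglongrightarrow> g'"
proof -
  have "((\<lambda>h. (g h - g 0 - h *\<^sub>R g') /\<^sub>R \<bar>h\<bar>) \<longlongrightarrow> 0) (at 0)"
    using assms by (simp add: has_vector_derivative_def has_derivative_at_within)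
  moreover have "filterlim (\<lambda>n. 1 / real (Suc n)) (at 0) sequentially"
    using LIMSEQ_inverse_real_of_nat by (simp add: filterlim_at inverse_eq_divide)
  ultimately have "(\<lambda>n. (g (1 / real (Suc n)) - g 0 - (1 / real (Suc n)) *\<^sub>R g') /\<^sub>R \<bar>1 / real (Suc n)\<bar>) \<longlonglongrightarrow> 0"
    by (rule filterlim_compose)
  also have "(\<lambda>n. (g (1 / real (Suc n)) - g 0 - (1 / real (Suc n)) *\<^sub>R g') /\<^sub>R \<bar>1 / real (Suc n)\<bar>)
     = (\<lambda>n. real (Suc n) *\<^sub>R (g (1 / real (Suc n)) - g 0) - g')"
    by (rule ext) (simp add: scaleR_diff_right del: of_nat_Suc)
  finally show ?thesis by (simp add: LIM_zero_iff)
qed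

lemma integrable_cis_mult:
  fixes f :: "real ^ 'n \<Rightarrow> complex"
  assumes "integrable lborel f"
  shows "integrable lborel (\<lambda>\<xi>. cis (a * (x \<bullet> \<xi>)) * f \<xi>)"
  by (rule Bochner_Integration.integrable_bound[OF assms])
    (use borel_measurable_integrable[OF assms] in \<open>auto simp: norm_mult cis_conv_exp\<close>)

text \<open>
  Translating \<open>f\<close> multiplies its inverse transform by a character. Dividing by the step and letting it tend to
  zero, dominated convergence gives the formula.
\<close>

lemma inverse_fourier_derivative:
  fixes f :: "real ^ 'n \<Rightarrow> complex"
  assumes S: "compact S" and f: "smooth_along v S (Suc N) f" and f': "smooth_along v S N f'"
    and D: "\<And>x. ((\<lambda>s. f (x + s *\<^sub>R v)) has_vector_derivative f' x) (at 0)"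
  shows "inverse_fourier f' x = - (2 * pi * \<i> * of_real (x \<bullet> v)) * inverse_fourier f x"
proof -
  have if1: "integrable lborel f" and if': "integrable lborel f'"
    by (rule smooth_along_integrable[OF f S], rule smooth_along_integrable[OF f' S])
  note [measurable] = borel_measurable_integrable[OF if1] borel_measurable_integrable[OF if']
  let ?h = "\<lambda>n. 1 / real (Suc n)"
  let ?q = "\<lambda>n \<xi>. cis (2 * pi * (x \<bullet> \<xi>)) * (real (Suc n) *\<^sub>R (f (\<xi> + ?h n *\<^sub>R v) - f \<xi>))"
  obtain R where R: "S \<subseteq> cball 0 R"
    using compact_imp_bounded[OF S] bounded_subset_ballD[of S 0] ball_subset_cball[of 0] by (metis order_trans)
  have "bounded (f' ` S)"
    using S by (intro compact_imp_bounded compact_continuous_image)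
      (auto intro: continuous_on_subset[OF smooth_along_continuous[OF f']])
  then obtain M where M0: "\<And>y. y \<in> S \<Longrightarrow> norm (f' y) \<le> M" "M > 0"
    by (auto simp: bounded_pos)
  have M: "norm (f' y) \<le> M" for y
    using M0 smooth_along_zero[OF f', of y] by (cases "y \<in> S") auto
  have D': "((\<lambda>s. f (y + s *\<^sub>R v)) has_vector_derivative f' (y + t *\<^sub>R v)) (at t)" for y t
  proof -
    have "((\<lambda>s. f ((y + t *\<^sub>R v) + s *\<^sub>R v)) \<circ> (\<lambda>s. s - t) has_vector_derivative 1 *\<^sub>R f' (y + t *\<^sub>R v)) (at t)"
      by (intro vector_diff_chain_at) (use D in \<open>auto intro!: derivative_eq_intros\<close>)
    then show ?thesis by (simp add: o_def algebra_simps)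
  qed
  have q_bound: "norm (f (\<xi> + ?h n *\<^sub>R v) - f \<xi>) \<le> M * ?h n" for \<xi> n
  proof -
    have "\<exists>t\<in>{0<..<?h n}. norm (f (\<xi> + ?h n *\<^sub>R v) - f (\<xi> + 0 *\<^sub>R v)) \<le> norm ((?h n - 0) *\<^sub>R f' (\<xi> + t *\<^sub>R v))"
      by (rule mvt_general) (use D' in \<open>auto simp: has_vector_derivative_def intro!: 
        continuous_intros continuous_on_compose2[OF smooth_along_continuous[OF f]]\<close>)
    then obtain t where "norm (f (\<xi> + ?h n *\<^sub>R v) - f \<xi>) \<le> ?h n * norm (f' (\<xi> + t *\<^sub>R v))"
      by auto
    also have "\<dots> \<le> ?h n * M" by (intro mult_left_mono M) auto
    finally show ?thesis by (simp add: mult.commute)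
  qed
  have "(\<lambda>n. \<integral>\<xi>. ?q n \<xi> \<partial>lborel) \<longlonglongrightarrow> (\<integral>\<xi>. cis (2 * pi * (x \<bullet> \<xi>)) * f' \<xi> \<partial>lborel)"
  proof (rule integral_dominated_convergence[where w = "\<lambda>\<xi>. indicator (cball 0 (R + norm v)) \<xi> *\<^sub>R M"])
    show "integrable lborel (\<lambda>\<xi>. indicator (cball (0::real^'n) (R + norm v)) \<xi> *\<^sub>R M)"
      by (intro borel_integrable_compact) auto
    show "AE \<xi> in lborel. (\<lambda>n. ?q n \<xi>) \<longlonglongrightarrow> cis (2 * pi * (x \<bullet> \<xi>)) * f' \<xi>"
      using vector_derivative_seq[OF D] by (intro AE_I2 tendsto_mult tendsto_const) simp
    show "AE \<xi> in lborel. norm (?q n \<xi>) \<le> indicator (cball 0 (R + norm v)) \<xi> *\<^sub>R M" for n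
    proof (intro AE_I2)
      fix \<xi>
      have "norm (?q n \<xi>) = real (Suc n) * norm (f (\<xi> + ?h n *\<^sub>R v) - f \<xi>)"
        by (simp add: norm_mult del: of_nat_Suc)
      also have "\<dots> \<le> real (Suc n) * (M * ?h n)" by (intro mult_left_mono q_bound) auto
      finally have 1: "norm (?q n \<xi>) \<le> M" by (simp del: of_nat_Suc)
      have 2: "?q n \<xi> = 0" if "\<xi> \<notin> cball 0 (R + norm v)"
      proof -
        have "norm (?h n *\<^sub>R v) \<le> norm v" by (simp add: field_simps)
        moreover have "norm \<xi> \<le> norm (\<xi> + ?h n *\<^sub>R v) + norm (?h n *\<^sub>R v)"
          using norm_triangle_ineq4[of "\<xi> + ?h n *\<^sub>R v" "?h n *\<^sub>R v"] by simp
        moreover have "norm \<xi> > R + norm v" using that by simp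
        moreover have "norm y \<le> R" if "y \<in> S" for y using R that by auto
        ultimately have "\<xi> + ?h n *\<^sub>R v \<notin> S" "\<xi> \<notin> S" using norm_ge_zero[of v] by (fastforce simp del: of_nat_Suc)+
        then have "f (\<xi> + ?h n *\<^sub>R v) = 0" "f \<xi> = 0" by - (rule smooth_along_zero[OF f], assumption)+
        then show ?thesis by (simp only:) simp
      qed
      show "norm (?q n \<xi>) \<le> indicator (cball 0 (R + norm v)) \<xi> *\<^sub>R M"
        using 1 2 by (cases "\<xi> \<in> cball 0 (R + norm v)") auto
    qed
  qed (auto simp: cis_conv_exp)
  moreover have "(\<integral>\<xi>. ?q n \<xi> \<partial>lborel) = (real (Suc n) *\<^sub>R (cis (- (2 * pi * ?h n * (x \<bullet> v))) - 1)) * inverse_fourier f x" for n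
  proof -
    let ?c = "cis (- (2 * pi * ?h n * (x \<bullet> v)))"
    have i0: "integrable lborel (\<lambda>\<xi>. cis (2 * pi * (x \<bullet> \<xi>)) * f \<xi>)"
      by (rule integrable_cis_mult[OF if1])
    have sh: "cis (2 * pi * (x \<bullet> \<xi>)) * f (\<xi> + ?h n *\<^sub>R v)
      = ?c * (cis (2 * pi * (x \<bullet> (?h n *\<^sub>R v + 1 *\<^sub>R \<xi>))) * f (?h n *\<^sub>R v + 1 *\<^sub>R \<xi>))" for \<xi>
    proof -
      have e: "2 * pi * (x \<bullet> \<xi>) = - (2 * pi * ?h n * (x \<bullet> v)) + 2 * pi * (x \<bullet> (?h n *\<^sub>R v + 1 *\<^sub>R \<xi>))"
        by (simp add: inner_add_right distrib_left del: of_nat_Suc)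
      have "cis (2 * pi * (x \<bullet> \<xi>)) = ?c * cis (2 * pi * (x \<bullet> (?h n *\<^sub>R v + 1 *\<^sub>R \<xi>)))"
        unfolding cis_mult by (rule arg_cong[OF e])
      moreover have "\<xi> + ?h n *\<^sub>R v = ?h n *\<^sub>R v + 1 *\<^sub>R \<xi>" by (simp add: add.commute)
      ultimately show ?thesis by (simp only: mult.assoc)
    qed
    have i1: "integrable lborel (\<lambda>\<xi>. cis (2 * pi * (x \<bullet> \<xi>)) * f (\<xi> + ?h n *\<^sub>R v))"
      unfolding sh by (intro integrable_mult_right integrable_lborel_affine[OF i0]) auto
    have "(\<integral>\<xi>. cis (2 * pi * (x \<bullet> \<xi>)) * f (\<xi> + ?h n *\<^sub>R v) \<partial>lborel) = ?c * inverse_fourier f x"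
      unfolding sh inverse_fourier_def
      using integral_lborel_affine[of 1 "\<lambda>\<xi>. cis (2 * pi * (x \<bullet> \<xi>)) * f \<xi>" "?h n *\<^sub>R v"] by simp
    then have "(\<integral>\<xi>. cis (2 * pi * (x \<bullet> \<xi>)) * f (\<xi> + ?h n *\<^sub>R v) - cis (2 * pi * (x \<bullet> \<xi>)) * f \<xi> \<partial>lborel)
       = (?c - 1) * inverse_fourier f x"
      by (subst Bochner_Integration.integral_diff[OF i1 i0]) (simp add: inverse_fourier_def left_diff_distrib)
    moreover have "?q n \<xi> = real (Suc n) *\<^sub>R (cis (2 * pi * (x \<bullet> \<xi>)) * f (\<xi> + ?h n *\<^sub>R v) - cis (2 * pi * (x \<bullet> \<xi>)) * f \<xi>)" for \<xi>
      by (simp add: right_diff_distrib del: of_nat_Suc)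
    ultimately show ?thesis by (simp del: of_nat_Suc)
  qed
  moreover have "(\<lambda>n. (real (Suc n) *\<^sub>R (cis (- (2 * pi * ?h n * (x \<bullet> v))) - 1)) * inverse_fourier f x)
     \<longlonglongrightarrow> (- (2 * pi * \<i> * of_real (x \<bullet> v))) * inverse_fourier f x"
  proof (intro tendsto_mult tendsto_const)
    have "((\<lambda>s. exp (s *\<^sub>R (- (2 * pi * \<i> * of_real (x \<bullet> v))))) has_vector_derivative
        exp (0 *\<^sub>R (- (2 * pi * \<i> * of_real (x \<bullet> v)))) * (- (2 * pi * \<i> * of_real (x \<bullet> v)))) (at (0::real))"
      by (rule exp_scaleR_has_vector_derivative_right)
    from vector_derivative_seq[OF this]
    show "(\<lambda>n. real (Suc n) *\<^sub>R (cis (- (2 * pi * ?h n * (x \<bullet> v))) - 1)) \<longlonglongrightarrow> - (2 * pi * \<i> * of_real (x \<bullet> v))"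
      by (simp add: cis_conv_exp scaleR_conv_of_real mult_ac del: of_nat_Suc)
  qed
  ultimately show ?thesis
    unfolding inverse_fourier_def[of f'] by (metis (no_types, lifting) LIMSEQ_unique tendsto_cong_limit ext)
qed

lemma inverse_fourier_decay:
  fixes f :: "real ^ 'n \<Rightarrow> complex"
  assumes S: "compact S"
  shows "smooth_along v S N f \<Longrightarrow> \<exists>C. \<forall>x. \<bar>x \<bullet> v\<bar> ^ N * norm (inverse_fourier f x) \<le> C"
proof (induction N arbitrary: f)
  case 0
  have "norm (inverse_fourier f x) \<le> (\<integral>\<xi>. norm (f \<xi>) \<partial>lborel)" for x
    unfolding inverse_fourier_def
    using integral_norm_bound[of lborel "\<lambda>\<xi>. cis (2 * pi * (x \<bullet> \<xi>)) * f \<xi>"] by (simp add: norm_mult)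
  then show ?case by auto
next
  case (Suc N)
  obtain f' where f': "smooth_along v S N f'"
    "\<And>x. ((\<lambda>s. f (x + s *\<^sub>R v)) has_vector_derivative f' x) (at 0)"
    using smooth_along_SucD[OF Suc.prems] by blast
  obtain C where C: "\<And>x. \<bar>x \<bullet> v\<bar> ^ N * norm (inverse_fourier f' x) \<le> C"
    using Suc.IH[OF f'(1)] by blast
  have "\<bar>x \<bullet> v\<bar> ^ Suc N * norm (inverse_fourier f x) \<le> C / (2 * pi)" for x
    using C[of x] unfolding inverse_fourier_derivative[OF S Suc.prems f'] 
    by (simp add: norm_mult field_simps)
  then show ?case by blast
qed

lemma nn_integral_Gamma_scaled:
  assumes "\<sigma> > 0" "a > 0"
  shows "(\<integral>\<^sup>+t\<in>{0<..}. ennreal (t powr (\<sigma> - 1) * exp (- a * t)) \<partial>lborel) = ennreal (Gamma \<sigma> * a powr (- \<sigma>))"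
proof -
  have "ennreal (Gamma \<sigma>) = (\<integral>\<^sup>+t. ennreal (indicator {0..} t * t powr (\<sigma> - 1) / exp t) \<partial>lborel)"
    by (rule Gamma_conv_nn_integral_real[OF assms(1)])
  also have "\<dots> = ennreal a * (\<integral>\<^sup>+t. ennreal (indicator {0..} (0 + a * t) * (0 + a * t) powr (\<sigma> - 1) / exp (0 + a * t)) \<partial>lborel)"
    using assms by (subst nn_integral_real_affine[where c = a and t = 0]) auto
  also have "(\<integral>\<^sup>+t. ennreal (indicator {0..} (0 + a * t) * (0 + a * t) powr (\<sigma> - 1) / exp (0 + a * t)) \<partial>lborel)
     = (\<integral>\<^sup>+t. ennreal (a powr (\<sigma> - 1)) * (ennreal (t powr (\<sigma> - 1) * exp (- a * t)) * indicator {0<..} t) \<partial>lborel)"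
    using assms by (intro nn_integral_cong)
      (auto simp: indicator_def powr_mult exp_minus field_simps ennreal_mult[symmetric] zero_le_mult_iff)
  also have "\<dots> = ennreal (a powr (\<sigma> - 1)) * (\<integral>\<^sup>+t\<in>{0<..}. ennreal (t powr (\<sigma> - 1) * exp (- a * t)) \<partial>lborel)"
    by (intro nn_integral_cmult) measurable
  finally have eq: "ennreal (Gamma \<sigma>) = ennreal (a powr \<sigma>) * (\<integral>\<^sup>+t\<in>{0<..}. ennreal (t powr (\<sigma> - 1) * exp (- a * t)) \<partial>lborel)"
    using assms by (simp add: mult.assoc[symmetric] ennreal_mult[symmetric] powr_diff)
  have "ennreal (Gamma \<sigma> * a powr (- \<sigma>)) = ennreal (a powr (- \<sigma>)) * ennreal (Gamma \<sigma>)"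
    using assms by (simp add: ennreal_mult[symmetric] Gamma_real_nonneg mult.commute)
  also have "\<dots> = (\<integral>\<^sup>+t\<in>{0<..}. ennreal (t powr (\<sigma> - 1) * exp (- a * t)) \<partial>lborel)"
    unfolding eq using assms by (simp add: mult.assoc[symmetric] ennreal_mult[symmetric] powr_minus)
  finally show ?thesis ..
qed

text \<open>
  The Gamma integral writes the weight as a superposition of Gaussians, whose integrals are known.
\<close>

lemma nn_integral_Bessel_weight_finite:
  "(\<integral>\<^sup>+x. ennreal (1 / (1 + (norm (x::real^'n))\<^sup>2) ^ CARD('n)) \<partial>lborel) < \<infinity>"
proof -
  let ?d = "real CARD('n)"
  have d: "?d > 0" by simp
  have 1: "ennreal (1 / (1 + (norm x)\<^sup>2) ^ CARD('n)) = ennreal (1 / Gamma ?d) *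
      (\<integral>\<^sup>+s\<in>{0<..}. ennreal (s powr (?d - 1) * exp (- (1 + (norm x)\<^sup>2) * s)) \<partial>lborel)" for x :: "real ^ 'n"
  proof -
    have p: "1 + (norm x)\<^sup>2 > 0" by (simp add: add_pos_nonneg)
    have G: "Gamma ?d > 0" using d by (rule Gamma_real_pos)
    then have G': "Gamma ?d \<noteq> 0" by linarith
    have "(1 + (norm x)\<^sup>2) powr (- ?d) = 1 / (1 + (norm x)\<^sup>2) ^ CARD('n)"
      using p by (simp add: powr_minus powr_realpow divide_inverse)
    then show ?thesis
      using p G by (subst nn_integral_Gamma_scaled[OF d p]) (simp add: ennreal_mult[symmetric] G')
  qed
  have 2: "(\<integral>\<^sup>+x. ennreal (s powr (?d - 1) * exp (- (1 + (norm (x::real^'n))\<^sup>2) * s)) * indicator {0<..} s \<partial>lborel)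
     = ennreal (pi powr (?d / 2)) * (ennreal (s powr (?d / 2 - 1) * exp (- 1 * s)) * indicator {0<..} s)" for s
  proof (cases "s > 0")
    case True
    \<comment> \<open>For this time the Gaussian is a multiple of the heat kernel, which has integral one.\<close>
    define t where "t = 1 / (4 * s)"
    have t: "t > 0" using True by (simp add: t_def)
    have "s powr (?d - 1) * exp (- (1 + (norm x)\<^sup>2) * s) = s powr (?d - 1) * exp (- s) * (pi / s) powr (?d / 2) * heat_kernel t x" for x :: "real ^ 'n"
    proof -
      have "4 * pi * t = pi / s" using True by (simp add: t_def)
      moreover have "- (norm x)\<^sup>2 / (4 * t) = - (norm x)\<^sup>2 * s" using True by (simp add: t_def)
      moreover have "(pi / s) powr (?d / 2) * (pi / s) powr (- ?d / 2) = 1"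
        using True by (simp add: powr_add[symmetric])
      ultimately show ?thesis
        by (simp add: heat_kernel_def exp_add[symmetric] algebra_simps)
    qed
    then have "(\<integral>\<^sup>+x. ennreal (s powr (?d - 1) * exp (- (1 + (norm (x::real^'n))\<^sup>2) * s)) * indicator {0<..} s \<partial>lborel)
      = (\<integral>\<^sup>+x. ennreal (s powr (?d - 1) * exp (- s) * (pi / s) powr (?d / 2)) * ennreal (heat_kernel t (x - 0 :: real^'n)) \<partial>lborel)"
      using True by (intro nn_integral_cong) (simp add: ennreal_mult mult.assoc)
    also have "\<dots> = ennreal (s powr (?d - 1) * exp (- s) * (pi / s) powr (?d / 2))"
      using nn_integral_heat_kernel[OF t, of "0::real^'n"] by (subst nn_integral_cmult) auto
    also have "s powr (?d - 1) * exp (- s) * (pi / s) powr (?d / 2) = pi powr (?d / 2) * (s powr (?d / 2 - 1) * exp (- 1 * s))"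
    proof -
      have "s powr (?d - 1) = s powr (?d / 2) * s powr (?d / 2 - 1)"
        by (simp add: powr_add[symmetric])
      then show ?thesis using True by (simp add: powr_divide)
    qed
    finally show ?thesis using True by (simp add: ennreal_mult)
  qed simp
  have "(\<integral>\<^sup>+x. ennreal (1 / (1 + (norm (x::real^'n))\<^sup>2) ^ CARD('n)) \<partial>lborel)
    = ennreal (1 / Gamma ?d) * (\<integral>\<^sup>+x. (\<integral>\<^sup>+s. ennreal (s powr (?d - 1) * exp (- (1 + (norm (x::real^'n))\<^sup>2) * s)) * indicator {0<..} s \<partial>lborel) \<partial>lborel)"
    unfolding 1 by (intro nn_integral_cmult) measurable
  also have "(\<integral>\<^sup>+x. (\<integral>\<^sup>+s. ennreal (s powr (?d - 1) * exp (- (1 + (norm (x::real^'n))\<^sup>2) * s)) * indicator {0<..} s \<partial>lborel) \<partial>lborel)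
    = (\<integral>\<^sup>+s. (\<integral>\<^sup>+x. ennreal (s powr (?d - 1) * exp (- (1 + (norm (x::real^'n))\<^sup>2) * s)) * indicator {0<..} s \<partial>lborel) \<partial>lborel)"
    by (intro pair_sigma_finite.Fubini' pair_sigma_finite.intro sigma_finite_lborel) measurable
  also have "\<dots> = ennreal (pi powr (?d / 2)) * (\<integral>\<^sup>+s\<in>{0<..}. ennreal (s powr (?d / 2 - 1) * exp (- 1 * s)) \<partial>lborel)"
    unfolding 2 by (intro nn_integral_cmult) measurable
  also have "\<dots> = ennreal (pi powr (?d / 2)) * ennreal (Gamma (?d / 2) * 1 powr (- (?d / 2)))"
    using d by (subst nn_integral_Gamma_scaled) auto
  finally show ?thesis by (simp add: ennreal_mult_less_top)
qed

lemma measurable_inverse_fourier [measurable]: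
  fixes f :: "real ^ 'n \<Rightarrow> complex"
  assumes [measurable]: "f \<in> borel_measurable borel"
  shows "inverse_fourier f \<in> borel_measurable borel"
proof -
  have "(\<lambda>x. \<integral>\<xi>. cis (2 * pi * (x \<bullet> \<xi>)) * f \<xi> \<partial>lborel) \<in> borel_measurable borel"
    unfolding cis_conv_exp by measurable
  then show ?thesis by (simp add: inverse_fourier_def[abs_def])
qed

text \<open>
  At every point some coordinate has square at least \<open>norm x\<close> squared over the dimension, so the decay along
  that coordinate is decay in \<open>norm x\<close>. The order \<open>2 d\<close> of decay exceeds the dimension.
\<close>

lemma integrable_inverse_fourier:
  fixes f :: "real ^ 'n \<Rightarrow> complex"
  assumes S: "compact S" and f: "\<And>b. b \<in> Basis \<Longrightarrow> smooth_along b S (2 * CARD('n)) f"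
  shows "integrable lborel (inverse_fourier f)"
proof -
  let ?d = "CARD('n)" and ?F = "inverse_fourier f"
  obtain b0 :: "real ^ 'n" where b0: "b0 \<in> Basis" using nonempty_Basis by blast
  have if1: "integrable lborel f" using smooth_along_integrable[OF f[OF b0] S] .
  note [measurable] = borel_measurable_integrable[OF if1]
  obtain C0 where C0: "\<And>x. norm (?F x) \<le> C0"
  proof -
    have "smooth_along b0 S 0 f" using f[OF b0] smooth_along_continuous smooth_along_zero by (auto simp del: smooth_along.simps(2)) 
    from inverse_fourier_decay[OF S this] show ?thesis using that by auto
  qed
  have "\<forall>b\<in>Basis. \<exists>C. \<forall>x. \<bar>x \<bullet> b\<bar> ^ (2 * ?d) * norm (?F x) \<le> C"
    using inverse_fourier_decay[OF S f] by blast
  then obtain C where C: "\<And>b x. b \<in> Basis \<Longrightarrow> \<bar>x \<bullet> b\<bar> ^ (2 * ?d) * norm (?F x) \<le> C b"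
    by metis
  define M where "M = 2 ^ ?d * (C0 + real ?d ^ ?d * (\<Sum>b\<in>Basis. C b))"
  have Cnn: "0 \<le> C b" if "b \<in> Basis" for b
    by (rule order_trans[OF _ C[OF that, of 0]]) (intro mult_nonneg_nonneg, auto)
  have bound: "norm (?F x) \<le> M * (1 / (1 + (norm x)\<^sup>2) ^ ?d)" for x
  proof -
    \<comment> \<open>Otherwise the squares of the coordinates would add up to less than the squared norm.\<close>
    have "\<exists>b\<in>Basis. (norm x)\<^sup>2 \<le> real ?d * (x \<bullet> b)\<^sup>2"
    proof (rule ccontr)
      assume "\<not> ?thesis"
      then have *: "\<And>b. b \<in> Basis \<Longrightarrow> (x \<bullet> b)\<^sup>2 < (norm x)\<^sup>2 / real ?d" by (auto simp: field_simps not_le)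
      have "(norm x)\<^sup>2 = (\<Sum>b\<in>Basis. (x \<bullet> b)\<^sup>2)"
        by (subst power2_norm_eq_inner, subst euclidean_inner) (simp add: power2_eq_square)
      also have "\<dots> < (\<Sum>b\<in>(Basis::(real^'n) set). (norm x)\<^sup>2 / real ?d)"
        using * by (intro sum_strict_mono) auto
      finally show False by simp
    qed
    then obtain b where b: "b \<in> Basis" "(norm x)\<^sup>2 \<le> real ?d * (x \<bullet> b)\<^sup>2" by blast
    have "((norm x)\<^sup>2) ^ ?d \<le> (real ?d * (x \<bullet> b)\<^sup>2) ^ ?d" using b by (intro power_mono) auto
    also have "\<dots> = real ?d ^ ?d * \<bar>x \<bullet> b\<bar> ^ (2 * ?d)"
      by (simp add: power_mult_distrib power_mult)
    finally have "((norm x)\<^sup>2) ^ ?d * norm (?F x) \<le> real ?d ^ ?d * (\<bar>x \<bullet> b\<bar> ^ (2 * ?d) * norm (?F x))"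
      by (simp add: mult_right_mono mult.assoc[symmetric])
    also have "\<dots> \<le> real ?d ^ ?d * (\<Sum>b\<in>Basis. C b)"
      using C[OF b(1), of x] member_le_sum[OF b(1), of C] Cnn by (intro mult_left_mono) auto
    finally have 1: "((norm x)\<^sup>2) ^ ?d * norm (?F x) \<le> real ?d ^ ?d * (\<Sum>b\<in>Basis. C b)" .
    have "(1 + (norm x)\<^sup>2) ^ ?d \<le> (2 * max 1 ((norm x)\<^sup>2)) ^ ?d"
      by (intro power_mono) auto
    also have "\<dots> = 2 ^ ?d * (max 1 ((norm x)\<^sup>2)) ^ ?d" by (simp add: power_mult_distrib)
    also have "\<dots> \<le> 2 ^ ?d * (1 + ((norm x)\<^sup>2) ^ ?d)"
      by (intro mult_left_mono) (auto simp: max_def)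
    finally have "(1 + (norm x)\<^sup>2) ^ ?d * norm (?F x) \<le> 2 ^ ?d * (1 + ((norm x)\<^sup>2) ^ ?d) * norm (?F x)"
      by (rule mult_right_mono) auto
    also have "\<dots> = 2 ^ ?d * (norm (?F x) + ((norm x)\<^sup>2) ^ ?d * norm (?F x))" by (simp add: algebra_simps)
    also have "\<dots> \<le> M"
      unfolding M_def using 1 C0[of x] by (intro mult_left_mono add_mono) auto
    finally show ?thesis
      by (simp add: field_simps add_pos_nonneg)
  qed
  have "integrable lborel (\<lambda>x. M * (1 / (1 + (norm (x::real^'n))\<^sup>2) ^ ?d))"
    using nn_integral_Bessel_weight_finite[where 'n = 'n]
    by (intro integrable_mult_right integrableI_nonneg) auto
  then show ?thesis
  proof (rule Bochner_Integration.integrable_bound)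
    show "AE x in lborel. norm (?F x) \<le> norm (M * (1 / (1 + (norm x)\<^sup>2) ^ ?d))"
      unfolding real_norm_def by (intro AE_I2 order_trans[OF bound abs_ge_self])
  qed measurable
qed

lemma inverse_fourier_scale:
  fixes m :: "real ^ 'n \<Rightarrow> complex"
  assumes "r > 0"
  shows "inverse_fourier (\<lambda>\<xi>. m (r *\<^sub>R \<xi>)) x = of_real (1 / r ^ CARD('n)) * inverse_fourier m (x /\<^sub>R r)"
proof -
  have "inverse_fourier m (x /\<^sub>R r) = \<bar>r\<bar> ^ CARD('n) *\<^sub>R (\<integral>\<xi>. cis (2 * pi * ((x /\<^sub>R r) \<bullet> (0 + r *\<^sub>R \<xi>))) * m (0 + r *\<^sub>R \<xi>) \<partial>lborel)"
    unfolding inverse_fourier_def using assms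
    by (subst integral_lborel_affine[of r _ 0]) auto
  also have "\<dots> = \<bar>r\<bar> ^ CARD('n) *\<^sub>R inverse_fourier (\<lambda>\<xi>. m (r *\<^sub>R \<xi>)) x"
  proof -
    have e: "r * (inverse r * y) = y" for y using assms by simp
    show ?thesis by (simp add: inverse_fourier_def e)
  qed
  finally show ?thesis using assms by (simp add: scaleR_conv_of_real)
qed

section \<open>The heat flow of an atom\<close>

lemma heat_eq:
  "heat t \<mu> x = heat_of (pos_part \<mu>) t x - heat_of (neg_part \<mu>) t x"
  by (simp add: heat_def signed_integral_def heat_kernel_def)

definition total_mass :: "('a::topological_space set \<Rightarrow> real) \<Rightarrow> real" where
  "total_mass \<mu> = measure (pos_part \<mu>) UNIV + measure (neg_part \<mu>) UNIV"

lemma measurable_integral_heat_kernel: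
  assumes "finite_measure M" and [measurable_cong]: "sets M = sets borel"
  shows "(\<lambda>(t, x). \<integral>y. heat_kernel t (x - y) \<partial>M) \<in> borel_measurable (borel \<Otimes>\<^sub>M borel)"
proof -
  interpret finite_measure M by fact
  show ?thesis by measurable
qed

lemma measurable_heat [measurable]:
  assumes "signed_measure \<mu>"
  shows "(\<lambda>(t, x). heat t \<mu> x) \<in> borel_measurable (borel \<Otimes>\<^sub>M borel)"
  unfolding heat_eq
  using measurable_integral_heat_kernel[OF finite_pos_part[OF assms]]
    measurable_integral_heat_kernel[OF finite_neg_part[OF assms]]
  by (simp add: split_beta')

lemma integrable_heat_kernel_measure:
  fixes x :: "real ^ 'n"
  assumes "finite_measure M" and [measurable_cong]: "sets M = sets borel" and t: "t > 0"
  shows "integrable M (\<lambda>y. heat_kernel t (x - y))"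
proof -
  interpret finite_measure M by fact
  show ?thesis
    by (rule integrable_const_bound[where B = "(4 * pi * t) powr (- real CARD('n) / 2)"])
      (use heat_kernel_le[OF t] in auto)
qed

lemma heat_bounded:
  fixes x :: "real ^ 'n"
  assumes \<mu>: "signed_measure \<mu>" and t: "t > 0"
  shows "\<bar>heat t \<mu> x\<bar> \<le> (4 * pi * t) powr (- real CARD('n) / 2) * total_mass \<mu>"
proof -
  have *: "\<bar>\<integral>y. heat_kernel t (x - y) \<partial>M\<bar> \<le> (4 * pi * t) powr (- real CARD('n) / 2) * measure M UNIV"
    if "finite_measure M" "sets M = sets borel" for M
  proof -
    interpret finite_measure M by fact
    have sp: "space M = UNIV" using sets_eq_imp_space_eq[OF that(2)] by simp
    have "\<bar>\<integral>y. heat_kernel t (x - y) \<partial>M\<bar> \<le> (\<integral>y. (4 * pi * t) powr (- real CARD('n) / 2) \<partial>M)"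
      by (rule order_trans[OF integral_abs_bound], rule integral_mono)
        (use integrable_heat_kernel_measure[OF that t] heat_kernel_le[OF t] in auto)
    then show ?thesis by (simp add: sp mult.commute)
  qed
  show ?thesis
    unfolding heat_eq total_mass_def distrib_left
    using abs_triangle_ineq4[of "\<integral>y. heat_kernel t (x - y) \<partial>pos_part \<mu>" "\<integral>y. heat_kernel t (x - y) \<partial>neg_part \<mu>"]
      *[OF finite_pos_part[OF \<mu>] sets_pos_part] *[OF finite_neg_part[OF \<mu>] sets_neg_part]
    by linarith
qed

lemma nn_integral_heat_le:
  fixes \<mu> :: "(real ^ 'n) set \<Rightarrow> real"
  assumes \<mu>: "signed_measure \<mu>" and t: "t > 0"
  shows "(\<integral>\<^sup>+x. ennreal \<bar>heat t \<mu> x\<bar> \<partial>lborel) \<le> ennreal (total_mass \<mu>)"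
proof -
  have *: "(\<integral>\<^sup>+x. ennreal (heat_of M t x) \<partial>lborel) = ennreal (measure M UNIV)"
    if "finite_measure M" and s [measurable_cong]: "sets M = sets borel" for M :: "(real ^ 'n) measure"
  proof -
    interpret finite_measure M by fact
    have sp: "space M = UNIV" using sets_eq_imp_space_eq[OF s] by simp
    interpret pair_sigma_finite lborel M by standard
    have "(\<integral>\<^sup>+x. ennreal (heat_of M t x) \<partial>lborel)
      = (\<integral>\<^sup>+x. (\<integral>\<^sup>+y. ennreal (heat_kernel t (x - y)) \<partial>M) \<partial>lborel)"
      by (intro nn_integral_cong nn_integral_eq_integral[symmetric] integrable_heat_kernel_measure that t) auto
    also have "\<dots> = (\<integral>\<^sup>+y. (\<integral>\<^sup>+x. ennreal (heat_kernel t (x - y)) \<partial>lborel) \<partial>M)"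
      by (rule Fubini'[symmetric]) measurable
    also have "\<dots> = ennreal (measure M UNIV)"
      by (simp add: nn_integral_heat_kernel[OF t] sp emeasure_eq_measure)
    finally show ?thesis .
  qed
  note fP = finite_pos_part[OF \<mu>] and fN = finite_neg_part[OF \<mu>]
  note [measurable] = measurable_integral_heat_kernel[OF fP] measurable_integral_heat_kernel[OF fN]
  have "(\<integral>\<^sup>+x. ennreal \<bar>heat t \<mu> x\<bar> \<partial>lborel)
    \<le> (\<integral>\<^sup>+x. ennreal (heat_of (pos_part \<mu>) t x) + ennreal (heat_of (neg_part \<mu>) t x) \<partial>lborel)"
    unfolding heat_eq
  proof (intro nn_integral_mono)
    fix x
    have "heat_of (pos_part \<mu>) t x \<ge> 0" "heat_of (neg_part \<mu>) t x \<ge> 0"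
      by (auto intro: integral_nonneg)
    moreover from this have "ennreal \<bar>heat_of (pos_part \<mu>) t x - heat_of (neg_part \<mu>) t x\<bar>
        \<le> ennreal (heat_of (pos_part \<mu>) t x + heat_of (neg_part \<mu>) t x)"
      by (intro ennreal_leI) linarith
    ultimately show "ennreal \<bar>heat_of (pos_part \<mu>) t x - heat_of (neg_part \<mu>) t x\<bar>
        \<le> ennreal (heat_of (pos_part \<mu>) t x) + ennreal (heat_of (neg_part \<mu>) t x)"
      by simp
  qed
  also have "\<dots> = ennreal (measure (pos_part \<mu>) UNIV) + ennreal (measure (neg_part \<mu>) UNIV)"
    by (subst nn_integral_add) (auto simp: *[OF fP] *[OF fN])
  finally show ?thesis by (simp add: total_mass_def)
qed

text \<open>
  The mean value theorem for \<open>exp\<close> bounds the difference by \<open>\<bar>a\<^sup>2 - b\<^sup>2\<bar>\<close> times the larger of the two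
  Gaussians. As \<open>a\<close> and \<open>b\<close> differ by at most \<open>E\<close>, both are at most a constant times \<open>exp (- b\<^sup>2 / 2)\<close>, and
  half of that exponent absorbs the factor \<open>a + b\<close>.
\<close>

lemma gaussian_difference_bound:
  fixes a b \<delta> E :: real
  assumes ab: "0 \<le> a" "0 \<le> b" "\<bar>a - b\<bar> \<le> \<delta>" "\<delta> \<le> E"
  shows "\<bar>exp (- a\<^sup>2) - exp (- b\<^sup>2)\<bar> \<le> \<delta> * ((2 + E) * exp (E\<^sup>2)) * exp (- b\<^sup>2 / 4)"
proof -
  have 1: "\<bar>exp (- u) - exp (- v)\<bar> \<le> \<bar>u - v\<bar> * exp (- min u v)" for u v :: real
  proof -
    have *: "exp (- u) - exp (- v) \<le> (v - u) * exp (- u)" for u v :: real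
    proof -
      have "1 - (v - u) \<le> exp (- (v - u))" using exp_ge_add_one_self[of "- (v - u)"] by linarith
      then have "(1 - (v - u)) * exp (- u) \<le> exp (- (v - u)) * exp (- u)" by (intro mult_right_mono) auto
      then show ?thesis by (simp add: exp_add[symmetric] algebra_simps)
    qed
    show ?thesis
      using *[of u v] *[of v u] by (cases "u \<le> v") (auto simp: min_def abs_if)
  qed
  \<comment> \<open>Compare the exponents: the smaller one is at least half of \<open>b\<^sup>2\<close>, up to \<open>E\<^sup>2\<close>.\<close>
  have "b \<le> a + E" using ab by simp
  then have "b\<^sup>2 \<le> (a + E)\<^sup>2" using ab by (intro power_mono) auto
  also have "\<dots> \<le> 2 * a\<^sup>2 + 2 * E\<^sup>2"
    using zero_le_power2[of "a - E"] by (simp add: power2_eq_square algebra_simps)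
  finally have q: "b\<^sup>2 \<le> 2 * a\<^sup>2 + 2 * E\<^sup>2" .
  have "- (a\<^sup>2) \<le> E\<^sup>2 + (- b\<^sup>2 / 2)" "- (b\<^sup>2) \<le> E\<^sup>2 + (- b\<^sup>2 / 2)"
    using q zero_le_power2[of b] zero_le_power2[of E] by linarith+
  then have "- min (a\<^sup>2) (b\<^sup>2) \<le> E\<^sup>2 + (- b\<^sup>2 / 2)"
    unfolding min_def by (metis (full_types))
  then have 2: "exp (- min (a\<^sup>2) (b\<^sup>2)) \<le> exp (E\<^sup>2) * exp (- b\<^sup>2 / 2)"
    by (simp add: exp_add[symmetric])
  have "\<bar>a\<^sup>2 - b\<^sup>2\<bar> = \<bar>a - b\<bar> * (a + b)"
    using ab by (simp add: power2_eq_square square_diff_square_factored abs_mult mult.commute)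
  also have "\<dots> \<le> \<delta> * (2 * b + E)" using ab by (intro mult_mono) auto
  finally have 3: "\<bar>a\<^sup>2 - b\<^sup>2\<bar> \<le> \<delta> * (2 * b + E)" .
  have 4: "(2 * b + E) * exp (- b\<^sup>2 / 4) \<le> 2 + E"
  proof -
    have "b \<le> 1 + b\<^sup>2 / 4" using zero_le_power2[of "1 - b / 2"] by (simp add: power2_eq_square algebra_simps)
    also have "\<dots> \<le> exp (b\<^sup>2 / 4)" by (rule exp_ge_add_one_self)
    finally have "b * exp (- b\<^sup>2 / 4) \<le> exp (b\<^sup>2 / 4) * exp (- b\<^sup>2 / 4)" by (intro mult_right_mono) auto
    also have "\<dots> = 1" by (simp add: exp_add[symmetric])
    finally have "b * exp (- b\<^sup>2 / 4) \<le> 1" .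
    moreover have "E * exp (- b\<^sup>2 / 4) \<le> E" using ab by (intro mult_left_le) auto
    ultimately show ?thesis by (simp add: distrib_right)
  qed
  have "\<bar>exp (- a\<^sup>2) - exp (- b\<^sup>2)\<bar> \<le> (\<delta> * (2 * b + E)) * (exp (E\<^sup>2) * exp (- b\<^sup>2 / 2))"
    using ab by (intro order_trans[OF 1] mult_mono 2 3) auto
  also have "exp (- b\<^sup>2 / 2) = exp (- b\<^sup>2 / 4) * exp (- b\<^sup>2 / 4)" by (simp add: exp_add[symmetric])
  also have "(\<delta> * (2 * b + E)) * (exp (E\<^sup>2) * (exp (- b\<^sup>2 / 4) * exp (- b\<^sup>2 / 4)))
    = (\<delta> * exp (E\<^sup>2) * exp (- b\<^sup>2 / 4)) * ((2 * b + E) * exp (- b\<^sup>2 / 4))" by simp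
  also have "\<dots> \<le> (\<delta> * exp (E\<^sup>2) * exp (- b\<^sup>2 / 4)) * (2 + E)"
    using ab by (intro mult_left_mono 4) auto
  finally show ?thesis by (simp add: mult_ac)
qed

text \<open>
  If two heat kernels have centres at most \<open>E\<close> diffusion lengths apart, their difference is dominated by a
  kernel at time \<open>4 t\<close>, with a factor that is linear in the distance. Pointwise domination by a kernel gives the \<open>L\<^sup>1\<close> and the \<open>L\<^sup>\<infinity>\<close> bound at once.
\<close>

lemma heat_kernel_difference_bound:
  fixes x y :: "real ^ 'n"
  assumes t: "t > 0" and y: "norm y \<le> E * r" and r: "r \<le> sqrt t" "r \<ge> 0" and E: "E \<ge> 0"
  shows "\<bar>heat_kernel t (x - y) - heat_kernel t x\<bar>
    \<le> 2 ^ CARD('n) * (E * ((2 + E) * exp (E\<^sup>2))) * (r / sqrt t) * heat_kernel (4 * t) x"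
proof -
  define a b where "a = norm (x - y) / (2 * sqrt t)" and "b = norm x / (2 * sqrt t)"
  define \<delta> where "\<delta> = E * (r / sqrt t)"
  have st: "sqrt t > 0" using t by simp
  have ea: "- (norm (x - y))\<^sup>2 / (4 * t) = - a\<^sup>2" and eb: "- (norm x)\<^sup>2 / (4 * t) = - b\<^sup>2"
    and eb': "- (norm x)\<^sup>2 / (4 * (4 * t)) = - b\<^sup>2 / 4"
    using t by (simp_all add: a_def b_def power_divide power_mult_distrib)
  have "\<bar>a - b\<bar> = \<bar>norm (x - y) - norm x\<bar> / (2 * sqrt t)"
    using st by (simp add: a_def b_def diff_divide_distrib[symmetric] abs_divide)
  also have "\<dots> \<le> norm y / (2 * sqrt t)"
    using st norm_triangle_ineq3[of "x - y" x] by (intro divide_right_mono) auto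
  also have "\<dots> \<le> norm y / sqrt t" using st by (simp add: field_simps)
  also have "\<dots> \<le> E * r / sqrt t" using st y by (intro divide_right_mono) auto
  finally have ab: "\<bar>a - b\<bar> \<le> \<delta>" by (simp add: \<delta>_def)
  have "r / sqrt t \<le> 1" using r st by simp
  then have "\<delta> \<le> E" unfolding \<delta>_def using E r by (intro mult_left_le) auto
  then have main: "\<bar>exp (- a\<^sup>2) - exp (- b\<^sup>2)\<bar> \<le> \<delta> * ((2 + E) * exp (E\<^sup>2)) * exp (- b\<^sup>2 / 4)"
    using ab st by (intro gaussian_difference_bound) (auto simp: a_def b_def)
  have p: "(4 * pi * t) powr (- real CARD('n) / 2) = 2 ^ CARD('n) * (4 * pi * (4 * t)) powr (- real CARD('n) / 2)"
  proof -
    have "(4 * pi * (4 * t)) powr (- real CARD('n) / 2) = (2 powr 2) powr (- real CARD('n) / 2) * (4 * pi * t) powr (- real CARD('n) / 2)"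
      by (subst powr_mult[symmetric]) (use t in simp_all)
    also have "(2 powr 2 :: real) powr (- real CARD('n) / 2) = 1 / 2 ^ CARD('n)"
    proof -
      have e: "2 * (- real CARD('n) / 2) = - real CARD('n)" by simp
      show ?thesis unfolding powr_powr e powr_minus_divide by (simp add: powr_realpow)
    qed
    finally show ?thesis by simp
  qed
  have "\<bar>heat_kernel t (x - y) - heat_kernel t x\<bar> = (4 * pi * t) powr (- real CARD('n) / 2) * \<bar>exp (- a\<^sup>2) - exp (- b\<^sup>2)\<bar>"
    unfolding heat_kernel_def ea eb by (subst right_diff_distrib[symmetric]) (simp add: abs_mult)
  also have "\<dots> \<le> (4 * pi * t) powr (- real CARD('n) / 2) * (\<delta> * ((2 + E) * exp (E\<^sup>2)) * exp (- b\<^sup>2 / 4))"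
    by (intro mult_left_mono main) auto
  finally show ?thesis
    unfolding heat_kernel_def[of "4 * t"] eb' p \<delta>_def by (simp add: mult_ac)
qed

text \<open>
  The constant of \<open>heat_kernel_difference_bound\<close> for \<open>E = d\<close>, which is admissible because a cube of side \<open>l\<close>
  in dimension \<open>d\<close> has diameter at most \<open>d l\<close>.
\<close>

definition cancel_const :: "nat \<Rightarrow> real" where
  "cancel_const d = 2 ^ d * (real d * ((2 + real d) * exp ((real d)\<^sup>2)))"

lemma norm_le_of_mem_cube:
  fixes c y :: "real ^ 'n"
  assumes "y \<in> cube c l"
  shows "norm (y - c) \<le> real CARD('n) * l"
proof -
  have "norm (y - c) \<le> (\<Sum>i\<in>UNIV. \<bar>(y - c) $ i\<bar>)" by (rule norm_le_l1_cart)
  also have "\<dots> \<le> (\<Sum>i\<in>(UNIV::'n set). l)"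
  proof (intro sum_mono)
    fix i
    have "c $ i \<le> y $ i \<and> y $ i \<le> c $ i + l" using assms by (simp add: cube_def mem_box_cart)
    then show "\<bar>(y - c) $ i\<bar> \<le> l" by auto
  qed
  finally show ?thesis by simp
qed

text \<open>
  As the total mass vanishes, the kernel may be replaced by its difference from the kernel centred at the
  corner \<open>c\<close> of the cube.
\<close>

lemma heat_cancellation:
  fixes a :: "(real ^ 'n) set \<Rightarrow> real"
  assumes a: "signed_measure a" and supp: "measure_support a \<subseteq> cube c l" and zero: "a (cube c l) = 0"
    and mass: "total_mass a \<le> 1" and l: "0 < l" "l \<le> sqrt t"
  shows "\<bar>heat t a x\<bar> \<le> cancel_const CARD('n) * (l / sqrt t) * heat_kernel (4 * t) (x - c)"
proof -
  have t: "t > 0" using l by (metis real_sqrt_gt_0_iff less_le_trans)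
  let ?B = "cancel_const CARD('n) * (l / sqrt t) * heat_kernel (4 * t) (x - c)"
  have B0: "?B \<ge> 0" using l t by (auto simp: cancel_const_def intro!: mult_nonneg_nonneg)
  have pt: "\<bar>heat_kernel t (x - y) - heat_kernel t (x - c)\<bar> \<le> ?B" if "y \<in> cube c l" for y
    using heat_kernel_difference_bound[OF t norm_le_of_mem_cube[OF that] l(2), of "x - c"] l(1)
    by (simp add: cancel_const_def)
  have *: "\<bar>heat_of M t x - heat_kernel t (x - c) * measure M UNIV\<bar> \<le> ?B * measure M UNIV"
    if "finite_measure M" "sets M = sets borel" "AE y in M. y \<in> cube c l" for M
  proof -
    interpret finite_measure M by fact
    have sp: "space M = UNIV" using sets_eq_imp_space_eq[OF that(2)] by simp
    note i = integrable_heat_kernel_measure[OF that(1,2) t, of x]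
    have "(\<integral>y. heat_kernel t (x - y) - heat_kernel t (x - c) \<partial>M) = heat_of M t x - heat_kernel t (x - c) * measure M UNIV"
      by (subst Bochner_Integration.integral_diff[OF i]) (auto simp: sp mult.commute)
    moreover have "\<bar>\<integral>y. heat_kernel t (x - y) - heat_kernel t (x - c) \<partial>M\<bar> \<le> (\<integral>y. ?B \<partial>M)"
      by (rule order_trans[OF integral_abs_bound], rule integral_mono_AE)
        (use i pt that(3) in \<open>auto intro!: Bochner_Integration.integrable_diff integrable_abs\<close>)
    ultimately show ?thesis by (simp add: sp mult_ac)
  qed
  have S: "cube c l \<in> sets borel" by (simp add: cube_def)
  have eq: "measure (pos_part a) UNIV = measure (neg_part a) UNIV"
    by (rule total_mass_zero[OF a supp S zero])
  have p: "\<bar>heat_of (pos_part a) t x - heat_kernel t (x - c) * measure (pos_part a) UNIV\<bar> \<le> ?B * measure (pos_part a) UNIV"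
    by (rule *[OF finite_pos_part[OF a] sets_pos_part AE_in_support(1)[OF a supp]])
  have n: "\<bar>heat_of (neg_part a) t x - heat_kernel t (x - c) * measure (neg_part a) UNIV\<bar> \<le> ?B * measure (neg_part a) UNIV"
    by (rule *[OF finite_neg_part[OF a] sets_neg_part AE_in_support(2)[OF a supp]])
  have "\<bar>heat t a x\<bar> \<le> ?B * measure (pos_part a) UNIV + ?B * measure (neg_part a) UNIV"
  proof -
    have lin: "\<bar>u - v\<bar> \<le> X + X" if "\<bar>u - w\<bar> \<le> X" "\<bar>v - w\<bar> \<le> X" for u v w X :: real
      using that by linarith
    show ?thesis unfolding heat_eq eq by (rule lin[OF p[unfolded eq] n])
  qed
  also have "\<dots> = ?B * total_mass a" by (simp add: total_mass_def distrib_left)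
  also have "\<dots> \<le> ?B" using B0 mass by (intro mult_left_le) auto
  finally show ?thesis .
qed

lemma atom_total_mass:
  assumes "atom \<beta> a"
  shows "signed_measure a" "total_mass a \<le> 1"
proof -
  show a: "signed_measure a" using assms by (simp add: atom_def)
  interpret P: finite_measure "pos_part a" by (rule finite_pos_part[OF a])
  interpret N: finite_measure "neg_part a" by (rule finite_neg_part[OF a])
  have "total_variation a UNIV \<le> 1" using assms by (auto simp: atom_def)
  then have "ennreal (total_mass a) \<le> 1"
    by (simp add: total_variation_def total_mass_def P.emeasure_eq_measure N.emeasure_eq_measure)
  then show "total_mass a \<le> 1" by simp
qed

text \<open>
  All estimates are in terms of the ratio of the side length to the diffusion length \<open>sqrt t\<close>. The factor
  \<open>t powr (- d / 2)\<close> is the size of the heat kernel itself.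
\<close>

lemma atom_heat_estimates:
  fixes a :: "(real ^ 'n) set \<Rightarrow> real"
  assumes a: "atom \<beta> a"
  obtains l where "l > 0"
    and "\<And>t x. t > 0 \<Longrightarrow> \<bar>heat t a x\<bar> \<le> (l / sqrt t) powr (- \<beta>) * t powr (- real CARD('n) / 2)"
    and "\<And>t x. t > 0 \<Longrightarrow> l \<le> sqrt t \<Longrightarrow> \<bar>heat t a x\<bar> \<le> cancel_const CARD('n) * (l / sqrt t) * t powr (- real CARD('n) / 2)"
    and "\<And>t. t > 0 \<Longrightarrow> l \<le> sqrt t \<Longrightarrow> (\<integral>\<^sup>+x. ennreal \<bar>heat t a x\<bar> \<partial>lborel) \<le> ennreal (cancel_const CARD('n) * (l / sqrt t))"
proof -
  let ?d = "real CARD('n)"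
  obtain c l where l: "l > 0" and supp: "measure_support a \<subseteq> cube c l" and zero: "a (cube c l) = 0"
    and h: "\<And>x t. t > 0 \<Longrightarrow> \<bar>t powr ((?d - \<beta>) / 2) * heat t a x\<bar> \<le> l powr (- \<beta>)"
    using a unfolding atom_def by auto
  note am = atom_total_mass[OF a]
  note canc = heat_cancellation[OF am(1) supp zero am(2) l]
  show thesis
  proof (rule that[OF l])
    fix t :: real and x :: "real ^ 'n" assume t: "t > 0"
    have "t powr ((?d - \<beta>) / 2) * \<bar>heat t a x\<bar> \<le> l powr (- \<beta>)" using h[OF t, of x] by (simp add: abs_mult)
    then have "\<bar>heat t a x\<bar> \<le> l powr (- \<beta>) / t powr ((?d - \<beta>) / 2)" using t by (simp add: field_simps)
    also have "\<dots> = (l / sqrt t) powr (- \<beta>) * t powr (- ?d / 2)"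
    proof -
      have "sqrt t powr (- \<beta>) = t powr (- \<beta> / 2)" using t by (simp add: powr_half_sqrt[symmetric] powr_powr)
      then have "(l / sqrt t) powr (- \<beta>) * t powr (- ?d / 2) = l powr (- \<beta>) * (t powr (- ?d / 2) / t powr (- \<beta> / 2))"
        using t l by (simp add: powr_divide)
      also have "t powr (- ?d / 2) / t powr (- \<beta> / 2) = t powr (- ((?d - \<beta>) / 2))"
        unfolding powr_diff[symmetric] by (simp add: diff_divide_distrib)
      finally show ?thesis by (simp add: powr_minus_divide)
    qed
    finally show "\<bar>heat t a x\<bar> \<le> (l / sqrt t) powr (- \<beta>) * t powr (- ?d / 2)" .
  next
    fix t :: real and x :: "real ^ 'n" assume t: "t > 0" and lt: "l \<le> sqrt t"
    have k0: "0 \<le> cancel_const CARD('n) * (l / sqrt t)" using l t by (auto simp: cancel_const_def)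
    have "heat_kernel (4 * t) (x - c) \<le> (4 * pi * (4 * t)) powr (- ?d / 2)"
      using t by (intro heat_kernel_le) auto
    also have "\<dots> \<le> t powr (- ?d / 2)"
    proof (rule powr_mono2')
      have "1 * t \<le> (16 * pi) * t" using t pi_ge_two by (intro mult_right_mono) auto
      then show "t \<le> 4 * pi * (4 * t)" by simp
    qed (use t in auto)
    finally show "\<bar>heat t a x\<bar> \<le> cancel_const CARD('n) * (l / sqrt t) * t powr (- ?d / 2)"
      using canc[OF lt, of x] mult_left_mono[OF _ k0] order_trans by blast
  next
    fix t :: real assume t: "t > 0" and lt: "l \<le> sqrt t"
    have k0: "0 \<le> cancel_const CARD('n) * (l / sqrt t)" using l t by (auto simp: cancel_const_def)
    have "(\<integral>\<^sup>+x. ennreal \<bar>heat t a x\<bar> \<partial>lborel)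
      \<le> (\<integral>\<^sup>+x. ennreal (cancel_const CARD('n) * (l / sqrt t)) * ennreal (heat_kernel (4 * t) (x - c)) \<partial>lborel)"
      using canc[OF lt] k0 by (intro nn_integral_mono) (auto simp: ennreal_mult[symmetric] intro!: ennreal_leI)
    also have "\<dots> = ennreal (cancel_const CARD('n) * (l / sqrt t))"
      using t by (subst nn_integral_cmult) (auto simp: nn_integral_heat_kernel)
    finally show "(\<integral>\<^sup>+x. ennreal \<bar>heat t a x\<bar> \<partial>lborel) \<le> ennreal (cancel_const CARD('n) * (l / sqrt t))" .
  qed
qed

section \<open>Convolutions and Fourier transforms\<close>

definition kernel_conv :: "(real ^ 'n \<Rightarrow> complex) \<Rightarrow> (real ^ 'n \<Rightarrow> real) \<Rightarrow> real ^ 'n \<Rightarrow> complex" where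
  "kernel_conv k h y = (\<integral>x. k (y - x) * of_real (h x) \<partial>lborel)"

lemma integrable_reflect:
  fixes k :: "real ^ 'n \<Rightarrow> complex"
  assumes "integrable lborel k"
  shows "integrable lborel (\<lambda>x. k (y - x))"
  using integrable_lborel_affine[OF assms, of "-1" y] by simp

lemma integral_reflect:
  fixes k :: "real ^ 'n \<Rightarrow> 'b::{banach, second_countable_topology}"
  shows "(\<integral>x. k (y - x) \<partial>lborel) = (\<integral>x. k x \<partial>lborel)"
  using integral_lborel_affine[of "-1" k y] by simp

lemma integral_shift:
  fixes k :: "real ^ 'n \<Rightarrow> 'b::{banach, second_countable_topology}"
  shows "(\<integral>x. k (x + z) \<partial>lborel) = (\<integral>x. k x \<partial>lborel)"
  using integral_lborel_affine[of 1 k z] by (simp add: add.commute)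

lemma integrable_mult_bounded:
  fixes f g :: "'a \<Rightarrow> complex"
  assumes f: "integrable M f" and [measurable]: "g \<in> borel_measurable M" and g: "\<And>x. norm (g x) \<le> B"
  shows "integrable M (\<lambda>x. f x * g x)"
proof (rule Bochner_Integration.integrable_bound)
  show "integrable M (\<lambda>x. B * norm (f x))" using f by auto
  have "0 \<le> B" using order_trans[OF norm_ge_zero g] by blast
  then show "AE x in M. norm (f x * g x) \<le> norm (B * norm (f x))"
    using g by (intro AE_I2) (simp add: norm_mult mult.commute[of "norm (f _)"] mult_right_mono)
  show "(\<lambda>x. f x * g x) \<in> borel_measurable M" using f by measurable
qed

lemma kernel_conv_measurable [measurable]:
  assumes "integrable lborel k" and [measurable]: "h \<in> borel_measurable borel"
  shows "kernel_conv k h \<in> borel_measurable borel"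
proof -
  note [measurable] = borel_measurable_integrable[OF assms(1)]
  have "(\<lambda>y. \<integral>x. k (y - x) * of_real (h x) \<partial>lborel) \<in> borel_measurable borel" by measurable
  then show ?thesis by (simp add: kernel_conv_def[abs_def])
qed

lemma kernel_conv_bounded:
  assumes k: "integrable lborel k" and [measurable]: "h \<in> borel_measurable borel" and h: "\<And>x. \<bar>h x\<bar> \<le> B"
  shows "norm (kernel_conv k h y) \<le> (\<integral>x. norm (k x) \<partial>lborel) * B"
proof -
  have i: "integrable lborel (\<lambda>x. k (y - x) * of_real (h x))"
    by (rule integrable_mult_bounded[OF integrable_reflect[OF k]]) (use h in auto)
  have "norm (kernel_conv k h y) \<le> (\<integral>x. norm (k (y - x) * of_real (h x)) \<partial>lborel)"
    unfolding kernel_conv_def by (rule integral_norm_bound)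
  also have "\<dots> \<le> (\<integral>x. norm (k (y - x)) * B \<partial>lborel)"
    by (rule integral_mono[OF integrable_norm[OF i] integrable_mult_left[OF integrable_norm[OF integrable_reflect[OF k]]]])
      (use h in \<open>auto simp: norm_mult intro!: mult_left_mono\<close>)
  also have "\<dots> = (\<integral>x. norm (k x) \<partial>lborel) * B"
    using integral_reflect[of "\<lambda>x. norm (k x)" y] by simp
  finally show ?thesis .
qed

text \<open>
  Tonelli for the absolute values. Where the convolution integral diverges its value is \<open>0\<close> by convention,
  which agrees with the bound.
\<close>

lemma nn_integral_kernel_conv_le:
  assumes k: "integrable lborel k" and [measurable]: "h \<in> borel_measurable borel"
  shows "L1_norm (kernel_conv k h)
    \<le> ennreal (\<integral>x. norm (k x) \<partial>lborel) * (\<integral>\<^sup>+x. ennreal \<bar>h x\<bar> \<partial>lborel)"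
proof -
  note [measurable] = borel_measurable_integrable[OF k]
  have "L1_norm (kernel_conv k h)
    \<le> (\<integral>\<^sup>+y. (\<integral>\<^sup>+x. ennreal (norm (k (y - x))) * ennreal \<bar>h x\<bar> \<partial>lborel) \<partial>lborel)"
  proof (intro nn_integral_mono)
    fix y
    have "ennreal (norm (kernel_conv k h y)) \<le> (\<integral>\<^sup>+x. ennreal (norm (k (y - x) * of_real (h x))) \<partial>lborel)"
      unfolding kernel_conv_def
      by (cases "integrable lborel (\<lambda>x. k (y - x) * of_real (h x))")
        (auto simp: not_integrable_integral_eq intro: integral_norm_bound_ennreal)
    then show "ennreal (norm (kernel_conv k h y)) \<le> (\<integral>\<^sup>+x. ennreal (norm (k (y - x))) * ennreal \<bar>h x\<bar> \<partial>lborel)"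
      by (simp add: norm_mult ennreal_mult)
  qed
  also have "\<dots> = (\<integral>\<^sup>+x. (\<integral>\<^sup>+y. ennreal (norm (k (y - x))) * ennreal \<bar>h x\<bar> \<partial>lborel) \<partial>lborel)"
    by (intro pair_sigma_finite.Fubini' pair_sigma_finite.intro sigma_finite_lborel) measurable
  also have "\<dots> = (\<integral>\<^sup>+x. ennreal (\<integral>x. norm (k x) \<partial>lborel) * ennreal \<bar>h x\<bar> \<partial>lborel)"
  proof (intro nn_integral_cong)
    fix x
    have "(\<integral>\<^sup>+y. ennreal (norm (k (y - x))) * ennreal \<bar>h x\<bar> \<partial>lborel)
      = (\<integral>\<^sup>+y. ennreal (norm (k (y - x))) \<partial>lborel) * ennreal \<bar>h x\<bar>"
      by (intro nn_integral_multc) measurable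
    also have "(\<integral>\<^sup>+y. ennreal (norm (k (y - x))) \<partial>lborel) = L1_norm k"
      using nn_integral_lborel_affine[of "\<lambda>y. ennreal (norm (k y))" 1 "- x"] by simp
    also have "\<dots> = ennreal (\<integral>x. norm (k x) \<partial>lborel)"
      using k by (intro nn_integral_eq_integral) auto
    finally show "(\<integral>\<^sup>+y. ennreal (norm (k (y - x))) * ennreal \<bar>h x\<bar> \<partial>lborel)
      = ennreal (\<integral>x. norm (k x) \<partial>lborel) * ennreal \<bar>h x\<bar>" .
  qed
  also have "\<dots> = ennreal (\<integral>x. norm (k x) \<partial>lborel) * (\<integral>\<^sup>+x. ennreal \<bar>h x\<bar> \<partial>lborel)"
    by (intro nn_integral_cmult) measurable
  finally show ?thesis .
qed

text \<open>
  Fubini's integrability criterion in the form in which the double integrals over space and frequency satisfy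
  it: up to phases, the integrand is \<open>f x\<close> times a function whose integral over \<open>y\<close> is the same for all \<open>x\<close>.
\<close>

lemma integrable_product_complex:
  fixes f :: "real ^ 'n \<Rightarrow> complex" and g' :: "real ^ 'n \<Rightarrow> real ^ 'n \<Rightarrow> complex"
    and F :: "real ^ 'n \<Rightarrow> real ^ 'n \<Rightarrow> complex"
  assumes f: "integrable lborel f" and g: "\<And>x. integrable lborel (g' x)"
    and G: "\<And>x. (\<integral>y. norm (g' x y) \<partial>lborel) = c"
    and [measurable]: "(\<lambda>(x, y). F x y) \<in> borel_measurable (borel \<Otimes>\<^sub>M borel)"
    and F: "\<And>x y. norm (F x y) = norm (f x) * norm (g' x y)"
  shows "integrable (lborel \<Otimes>\<^sub>M lborel) (\<lambda>(x, y). F x y)"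
proof -
  show ?thesis
  proof (rule lborel_pair.Fubini_integrable)
    show "(\<lambda>(x, y). F x y) \<in> borel_measurable (lborel \<Otimes>\<^sub>M lborel)" by measurable
    show "integrable lborel (\<lambda>x. \<integral>y. norm (case (x, y) of (x, y) \<Rightarrow> F x y) \<partial>lborel)"
      using f by (simp add: F G)
    show "AE x in lborel. integrable lborel (\<lambda>y. case (x, y) of (x, y) \<Rightarrow> F x y)"
    proof (intro AE_I2)
      fix x
      have "integrable lborel (\<lambda>y. norm (f x) * norm (g' x y))"
        by (intro integrable_mult_right integrable_norm g)
      then show "integrable lborel (\<lambda>y. case (x, y) of (x, y) \<Rightarrow> F x y)"
        by (rule Bochner_Integration.integrable_bound) (auto simp: F)
    qed
  qed
qed

lemma integral_swap_complex:
  fixes F :: "real ^ 'n \<Rightarrow> real ^ 'n \<Rightarrow> complex"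
  assumes "integrable (lborel \<Otimes>\<^sub>M lborel) (\<lambda>(x, y). F x y)"
  shows "(\<integral>x. (\<integral>y. F x y \<partial>lborel) \<partial>lborel) = (\<integral>y. (\<integral>x. F x y \<partial>lborel) \<partial>lborel)"
proof -
  show ?thesis by (rule lborel_pair.Fubini_integral[OF assms, symmetric])
qed

lemma fourier_eq: "fourier f x = (\<integral>\<xi>. cis (- (2 * pi * (x \<bullet> \<xi>))) * f \<xi> \<partial>lborel)"
  by (simp add: fourier_def inner_commute)

lemma fourier_mult_inverse_fourier:
  fixes m \<phi> :: "real ^ 'n \<Rightarrow> complex"
  assumes m: "integrable lborel m" and \<phi>: "integrable lborel \<phi>"
  shows "fourier (\<lambda>\<xi>. m \<xi> * inverse_fourier \<phi> \<xi>) x = (\<integral>y. \<phi> y * inverse_fourier m (y - x) \<partial>lborel)"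
proof -
  note [measurable] = borel_measurable_integrable[OF m] borel_measurable_integrable[OF \<phi>]
  define F where "F \<xi> y = cis (- (2 * pi * (x \<bullet> \<xi>))) * m \<xi> * (cis (2 * pi * (\<xi> \<bullet> y)) * \<phi> y)" for \<xi> y
  have "integrable (lborel \<Otimes>\<^sub>M lborel) (\<lambda>(\<xi>, y). F \<xi> y)"
    by (rule integrable_product_complex[OF m, where g' = "\<lambda>_. \<phi>"])
      (use \<phi> in \<open>auto simp: F_def norm_mult cis_conv_exp\<close>)
  then have "(\<integral>\<xi>. (\<integral>y. F \<xi> y \<partial>lborel) \<partial>lborel) = (\<integral>y. (\<integral>\<xi>. F \<xi> y \<partial>lborel) \<partial>lborel)"
    by (rule integral_swap_complex)
  moreover have "(\<integral>y. F \<xi> y \<partial>lborel) = cis (- (2 * pi * (x \<bullet> \<xi>))) * (m \<xi> * inverse_fourier \<phi> \<xi>)" for \<xi>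
    unfolding F_def inverse_fourier_def by (simp add: mult.assoc)
  moreover have "(\<integral>\<xi>. F \<xi> y \<partial>lborel) = \<phi> y * inverse_fourier m (y - x)" for y
  proof -
    have "F \<xi> y = \<phi> y * (cis (2 * pi * ((y - x) \<bullet> \<xi>)) * m \<xi>)" for \<xi>
    proof -
      have "cis (2 * pi * ((y - x) \<bullet> \<xi>)) = cis (- (2 * pi * (x \<bullet> \<xi>))) * cis (2 * pi * (\<xi> \<bullet> y))"
        unfolding cis_mult by (rule arg_cong[where f = cis]) (simp add: inner_diff_left right_diff_distrib inner_commute[of \<xi> y])
      then show ?thesis by (simp add: F_def mult_ac)
    qed
    then show ?thesis by (simp add: inverse_fourier_def)
  qed
  ultimately show ?thesis by (simp add: fourier_eq)
qed

lemma fourier_heat_semigroup: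
  fixes \<eta> :: "real ^ 'n \<Rightarrow> complex"
  assumes \<eta>: "integrable lborel \<eta>" and t: "t > 0"
  shows "(\<integral>x. fourier \<eta> x * of_real (heat_kernel t (x - z)) \<partial>lborel)
    = fourier (\<lambda>\<xi>. \<eta> \<xi> * heat_symbol t \<xi>) z"
proof -
  note [measurable] = borel_measurable_integrable[OF \<eta>]
  define F where "F \<xi> x = cis (- (2 * pi * (x \<bullet> \<xi>))) * \<eta> \<xi> * of_real (heat_kernel t (x - z))" for \<xi> x
  have "integrable (lborel \<Otimes>\<^sub>M lborel) (\<lambda>(\<xi>, x). F \<xi> x)"
    by (rule integrable_product_complex[OF \<eta>, where g' = "\<lambda>_ x. complex_of_real (heat_kernel t (x - z))" and c = 1])
      (use integrable_heat_kernel[OF t, of z] in \<open>auto simp: F_def norm_mult cis_conv_exp\<close>)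
  then have "(\<integral>\<xi>. (\<integral>x. F \<xi> x \<partial>lborel) \<partial>lborel) = (\<integral>x. (\<integral>\<xi>. F \<xi> x \<partial>lborel) \<partial>lborel)"
    by (rule integral_swap_complex)
  moreover have "(\<integral>\<xi>. F \<xi> x \<partial>lborel) = fourier \<eta> x * of_real (heat_kernel t (x - z))" for x
    unfolding F_def fourier_eq by simp
  moreover have "(\<integral>x. F \<xi> x \<partial>lborel) = cis (- (2 * pi * (z \<bullet> \<xi>))) * (\<eta> \<xi> * heat_symbol t \<xi>)" for \<xi>
  proof -
    have "(\<integral>x. F \<xi> x \<partial>lborel) = (\<integral>x. F \<xi> (x + z) \<partial>lborel)" by (rule integral_shift[symmetric])
    also have "\<dots> = (\<integral>x. (cis (- (2 * pi * (z \<bullet> \<xi>))) * \<eta> \<xi>) * (of_real (heat_kernel t x) * cis (- (2 * pi * (x \<bullet> \<xi>)))) \<partial>lborel)"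
    proof (rule Bochner_Integration.integral_cong[OF refl])
      fix x
      have "cis (- (2 * pi * ((x + z) \<bullet> \<xi>))) = cis (- (2 * pi * (z \<bullet> \<xi>))) * cis (- (2 * pi * (x \<bullet> \<xi>)))"
        unfolding cis_mult by (rule arg_cong[where f = cis]) (simp add: inner_add_left distrib_left)
      then show "F \<xi> (x + z) = (cis (- (2 * pi * (z \<bullet> \<xi>))) * \<eta> \<xi>) * (of_real (heat_kernel t x) * cis (- (2 * pi * (x \<bullet> \<xi>))))"
        by (simp add: F_def mult_ac)
    qed
    also have "\<dots> = (cis (- (2 * pi * (z \<bullet> \<xi>))) * \<eta> \<xi>) * heat_symbol t \<xi>"
      by (simp only: integral_mult_right_zero fourier_heat_kernel(2)[OF t])
    finally show ?thesis by (simp only: mult.assoc)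
  qed
  ultimately show ?thesis by (simp add: fourier_eq)
qed

lemma measurable_fourier [measurable]:
  fixes f :: "real ^ 'n \<Rightarrow> complex"
  assumes [measurable]: "f \<in> borel_measurable borel"
  shows "fourier f \<in> borel_measurable borel"
proof -
  have "(\<lambda>x. \<integral>\<xi>. cis (- (2 * pi * (\<xi> \<bullet> x))) * f \<xi> \<partial>lborel) \<in> borel_measurable borel"
    unfolding cis_conv_exp by measurable
  then show ?thesis by (simp add: fourier_def[abs_def])
qed

lemma norm_fourier_le: "norm (fourier f x) \<le> (\<integral>\<xi>. norm (f \<xi>) \<partial>lborel)"
  unfolding fourier_def
  using integral_norm_bound[of lborel "\<lambda>\<xi>. cis (- (2 * pi * (\<xi> \<bullet> x))) * f \<xi>"] by (simp add: norm_mult)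

lemma norm_inverse_fourier_le: "norm (inverse_fourier f x) \<le> (\<integral>\<xi>. norm (f \<xi>) \<partial>lborel)"
  unfolding inverse_fourier_def
  using integral_norm_bound[of lborel "\<lambda>\<xi>. cis (2 * pi * (x \<bullet> \<xi>)) * f \<xi>"] by (simp add: norm_mult)

lemma integrable_fourier_mult:
  fixes m \<phi> :: "real ^ 'n \<Rightarrow> complex"
  assumes m: "integrable lborel m" and k: "integrable lborel (inverse_fourier m)" and \<phi>: "integrable lborel \<phi>"
  shows "integrable lborel (fourier (\<lambda>\<xi>. m \<xi> * inverse_fourier \<phi> \<xi>))"
proof -
  note [measurable] = borel_measurable_integrable[OF m] borel_measurable_integrable[OF k] borel_measurable_integrable[OF \<phi>]
  have "integrable (lborel \<Otimes>\<^sub>M lborel) (\<lambda>(y, x). \<phi> y * inverse_fourier m (y - x))"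
    by (rule integrable_product_complex[OF \<phi>, where g' = "\<lambda>y x. inverse_fourier m (y - x)" and c = "\<integral>x. norm (inverse_fourier m x) \<partial>lborel"])
      (use integrable_reflect[OF k] integral_reflect[of "\<lambda>x. norm (inverse_fourier m x)"] in \<open>auto simp: norm_mult\<close>)
  from lborel_pair.integrable_snd[OF this] show ?thesis
    unfolding fourier_mult_inverse_fourier[OF m \<phi>, THEN ext[where f = "fourier _"]] .
qed

section \<open>Riesz potentials on the Fourier side\<close>

lemma has_bochner_integral_Gamma_scaled:
  fixes \<sigma> a :: real
  assumes "\<sigma> > 0" "a > 0"
  shows "has_bochner_integral lborel (\<lambda>t. indicator {0<..} t * t powr (\<sigma> - 1) * exp (- a * t)) (Gamma \<sigma> * a powr (- \<sigma>))"
proof (rule has_bochner_integral_nn_integral)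
  show "0 \<le> Gamma \<sigma> * a powr (- \<sigma>)" using assms by (simp add: Gamma_real_nonneg)
  have "(\<integral>\<^sup>+t. ennreal (indicator {0<..} t * t powr (\<sigma> - 1) * exp (- a * t)) \<partial>lborel)
     = (\<integral>\<^sup>+t\<in>{0<..}. ennreal (t powr (\<sigma> - 1) * exp (- a * t)) \<partial>lborel)"
    by (intro nn_integral_cong) (auto simp: indicator_def)
  then show "(\<integral>\<^sup>+t. ennreal (indicator {0<..} t * t powr (\<sigma> - 1) * exp (- a * t)) \<partial>lborel) = ennreal (Gamma \<sigma> * a powr (- \<sigma>))"
    by (simp only: nn_integral_Gamma_scaled[OF assms])
qed auto

text \<open>
  After interchanging the integrals, the time integral at each frequency is a Gamma integral. As \<open>\<eta>\<close> vanishes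
  near the origin, the negative power of \<open>norm \<xi>\<close> is bounded where it matters, so Fubini applies.
\<close>

lemma fourier_riesz_multiplier:
  fixes \<eta> :: "real ^ 'n \<Rightarrow> complex"
  assumes \<eta>: "integrable lborel \<eta>" and r: "r > 0" "\<forall>\<xi>. norm \<xi> < r \<longrightarrow> \<eta> \<xi> = 0" and \<alpha>: "\<alpha> > 0"
  shows "(\<integral>t. of_real (indicator {0<..} t * t powr (\<alpha> / 2 - 1)) * fourier (\<lambda>\<xi>. \<eta> \<xi> * heat_symbol t \<xi>) y \<partial>lborel)
    = of_real (Gamma (\<alpha> / 2)) * fourier (\<lambda>\<xi>. \<eta> \<xi> * of_real (riesz_multiplier \<alpha> \<xi>)) y"
proof -
  note [measurable] = borel_measurable_integrable[OF \<eta>]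
  define w :: "real \<Rightarrow> real" where "w t = indicator {0<..} t * t powr (\<alpha> / 2 - 1)" for t
  define A :: "real ^ 'n \<Rightarrow> real" where "A \<xi> = 4 * pi\<^sup>2 * (norm \<xi>)\<^sup>2" for \<xi>
  have [measurable]: "w \<in> borel_measurable borel" "A \<in> borel_measurable borel"
    unfolding w_def[abs_def] A_def[abs_def] by measurable
  have w0: "w t \<ge> 0" for t by (simp add: w_def)
  define G where "G \<xi> t = cis (- (2 * pi * (\<xi> \<bullet> y))) * \<eta> \<xi> * of_real (w t * exp (- A \<xi> * t))" for \<xi> t
  have hb: "has_bochner_integral lborel (\<lambda>t. w t * exp (- A \<xi> * t)) (Gamma (\<alpha> / 2) * A \<xi> powr (- \<alpha> / 2))" if "\<eta> \<xi> \<noteq> 0" for \<xi>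
  proof -
    have "\<xi> \<noteq> 0" using that r by force
    then have "A \<xi> > 0" by (simp add: A_def)
    from has_bochner_integral_Gamma_scaled[OF _ this, of "\<alpha> / 2"] \<alpha> show ?thesis by (simp add: w_def[abs_def])
  qed
  have [measurable]: "(\<lambda>(\<xi>, t). G \<xi> t) \<in> borel_measurable (borel \<Otimes>\<^sub>M borel)"
    unfolding G_def cis_conv_exp by measurable
  have nG: "norm (G \<xi> t) = norm (\<eta> \<xi>) * (w t * exp (- A \<xi> * t))" for \<xi> t
    by (simp add: G_def norm_mult w0)
  have iG: "integrable (lborel \<Otimes>\<^sub>M lborel) (\<lambda>(\<xi>, t). G \<xi> t)"
  proof (rule lborel_pair.Fubini_integrable)
    show "(\<lambda>(\<xi>, t). G \<xi> t) \<in> borel_measurable (lborel \<Otimes>\<^sub>M lborel)" by measurable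
    have eq: "(\<integral>t. norm (case (\<xi>, t) of (\<xi>, t) \<Rightarrow> G \<xi> t) \<partial>lborel) = norm (\<eta> \<xi>) * (Gamma (\<alpha> / 2) * A \<xi> powr (- \<alpha> / 2))" for \<xi>
    proof (cases "\<eta> \<xi> = 0")
      case False
      then show ?thesis using has_bochner_integral_integral_eq[OF hb[OF False]] by (simp add: nG)
    qed (simp add: nG)
    have "integrable lborel (\<lambda>\<xi>. (Gamma (\<alpha> / 2) * (4 * pi\<^sup>2 * r\<^sup>2) powr (- \<alpha> / 2)) * norm (\<eta> \<xi>))"
      using \<eta> by auto
    then show "integrable lborel (\<lambda>\<xi>. \<integral>t. norm (case (\<xi>, t) of (\<xi>, t) \<Rightarrow> G \<xi> t) \<partial>lborel)"
      unfolding eq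
    proof (rule Bochner_Integration.integrable_bound)
      show "AE \<xi> in lborel. norm (norm (\<eta> \<xi>) * (Gamma (\<alpha> / 2) * A \<xi> powr (- \<alpha> / 2)))
        \<le> norm ((Gamma (\<alpha> / 2) * (4 * pi\<^sup>2 * r\<^sup>2) powr (- \<alpha> / 2)) * norm (\<eta> \<xi>))"
      proof (intro AE_I2)
        fix \<xi>
        show "norm (norm (\<eta> \<xi>) * (Gamma (\<alpha> / 2) * A \<xi> powr (- \<alpha> / 2)))
          \<le> norm ((Gamma (\<alpha> / 2) * (4 * pi\<^sup>2 * r\<^sup>2) powr (- \<alpha> / 2)) * norm (\<eta> \<xi>))"
        proof (cases "norm \<xi> < r")
          case False
          have "A \<xi> powr (- \<alpha> / 2) \<le> (4 * pi\<^sup>2 * r\<^sup>2) powr (- \<alpha> / 2)"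
            unfolding A_def using False r \<alpha> by (intro powr_mono2' mult_left_mono power_mono) auto
          then have "norm (\<eta> \<xi>) * \<bar>Gamma (\<alpha> / 2)\<bar> * A \<xi> powr (- \<alpha> / 2) \<le> norm (\<eta> \<xi>) * \<bar>Gamma (\<alpha> / 2)\<bar> * (4 * pi\<^sup>2 * r\<^sup>2) powr (- \<alpha> / 2)"
            by (intro mult_left_mono) auto
          then show ?thesis by (simp add: abs_mult mult_ac)
        qed (simp add: r)
      qed
    qed measurable
    show "AE \<xi> in lborel. integrable lborel (\<lambda>t. case (\<xi>, t) of (\<xi>, t) \<Rightarrow> G \<xi> t)"
    proof (intro AE_I2)
      fix \<xi>
      show "integrable lborel (\<lambda>t. case (\<xi>, t) of (\<xi>, t) \<Rightarrow> G \<xi> t)"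
      proof (cases "\<eta> \<xi> = 0")
        case False
        have "integrable lborel (\<lambda>t. w t * exp (- A \<xi> * t))" using hb[OF False] by (rule integrable.intros)
        then show ?thesis by (simp add: G_def complex_of_real_integrable_eq del: of_real_mult)
      qed (simp add: G_def)
    qed
  qed
  have "(\<integral>t. (\<integral>\<xi>. G \<xi> t \<partial>lborel) \<partial>lborel) = (\<integral>\<xi>. (\<integral>t. G \<xi> t \<partial>lborel) \<partial>lborel)"
    by (rule lborel_pair.Fubini_integral[OF iG])
  moreover have "(\<integral>\<xi>. G \<xi> t \<partial>lborel) = of_real (w t) * fourier (\<lambda>\<xi>. \<eta> \<xi> * heat_symbol t \<xi>) y" for t
  proof -
    have "G \<xi> t = of_real (w t) * (cis (- (2 * pi * (y \<bullet> \<xi>))) * (\<eta> \<xi> * heat_symbol t \<xi>))" for \<xi>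
      by (simp add: G_def A_def inner_commute mult_ac)
    then show ?thesis by (simp add: fourier_def inner_commute)
  qed
  moreover have "(\<integral>t. G \<xi> t \<partial>lborel) = of_real (Gamma (\<alpha> / 2)) * (cis (- (2 * pi * (\<xi> \<bullet> y))) * (\<eta> \<xi> * of_real (A \<xi> powr (- \<alpha> / 2))))" for \<xi>
  proof (cases "\<eta> \<xi> = 0")
    case False
    have "(\<integral>t. G \<xi> t \<partial>lborel) = cis (- (2 * pi * (\<xi> \<bullet> y))) * \<eta> \<xi> * of_real (\<integral>t. w t * exp (- A \<xi> * t) \<partial>lborel)"
      unfolding G_def by (simp only: integral_mult_right_zero integral_complex_of_real)
    also have "(\<integral>t. w t * exp (- A \<xi> * t) \<partial>lborel) = Gamma (\<alpha> / 2) * A \<xi> powr (- \<alpha> / 2)"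
      by (rule has_bochner_integral_integral_eq[OF hb[OF False]])
    finally show ?thesis by (simp only: of_real_mult mult_ac)
  qed (simp add: G_def)
  ultimately show ?thesis by (simp add: fourier_def w_def A_def)
qed

text \<open>
  Pairing the Riesz potential of \<open>M\<close> with \<open>fourier \<eta>\<close>, all integrals over space, time and \<open>M\<close> may be
  interchanged. For small times the space integral is bounded by the supremum of \<open>fourier \<eta>\<close> and
  \<open>t powr (\<alpha> / 2 - 1)\<close> is integrable since \<open>\<alpha> > 0\<close>; for large times it is bounded by the \<open>L\<^sup>1\<close> norm times
  \<open>t powr (- d / 2)\<close>, which is integrable against the weight since \<open>\<alpha> < d\<close>. The first statement is about
  points where \<open>fourier \<eta>\<close> does not vanish, since only there integrability of the product gives that of the
  time integral.
\<close>

lemma riesz_fubini: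
  fixes M :: "(real ^ 'n) measure" and \<eta> :: "real ^ 'n \<Rightarrow> complex"
  assumes M: "finite_measure M" and sM [measurable_cong]: "sets M = sets borel"
    and \<alpha>: "0 < \<alpha>" "\<alpha> < real CARD('n)"
    and \<eta>: "integrable lborel \<eta>" and r: "r > 0" "\<forall>\<xi>. norm \<xi> < r \<longrightarrow> \<eta> \<xi> = 0"
    and \<Theta>: "integrable lborel (fourier \<eta>)"
  defines "w \<equiv> \<lambda>t::real. indicator {0<..} t * t powr (\<alpha> / 2 - 1)"
    and "H \<equiv> \<lambda>t x. \<integral>y. heat_kernel t (x - y) \<partial>M"
  shows "AE x in lborel. fourier \<eta> x \<noteq> 0 \<longrightarrow> integrable lborel (\<lambda>t. w t * H t x)" (is ?I1)
    and "integrable lborel (\<lambda>x. fourier \<eta> x * of_real (\<integral>t. w t * H t x \<partial>lborel))" (is ?I2)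
    and "(\<integral>x. fourier \<eta> x * of_real (\<integral>t. w t * H t x \<partial>lborel) \<partial>lborel)
      = of_real (Gamma (\<alpha> / 2)) * (\<integral>z. fourier (\<lambda>\<xi>. \<eta> \<xi> * of_real (riesz_multiplier \<alpha> \<xi>)) z \<partial>M)" (is ?I3)
proof -
  let ?d = "real CARD('n)"
  let ?R = "\<lambda>x. \<integral>t. w t * H t x \<partial>lborel"
  interpret finite_measure M by fact
  have sp: "space M = UNIV" using sets_eq_imp_space_eq[OF sM] by simp
  interpret Q: pair_sigma_finite "lborel :: real measure" M by standard
  interpret B: pair_sigma_finite "lborel :: (real^'n) measure" "(lborel :: real measure) \<Otimes>\<^sub>M M" by standard
  let ?Q = "(lborel :: real measure) \<Otimes>\<^sub>M M"
  note [measurable] = borel_measurable_integrable[OF \<eta>]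
  have [measurable]: "w \<in> borel_measurable borel" unfolding w_def by measurable
  have [measurable]: "(\<lambda>(t, x). H t x) \<in> borel_measurable (borel \<Otimes>\<^sub>M borel)"
    unfolding H_def by (rule measurable_integral_heat_kernel[OF M sM])
  have w0: "w t \<ge> 0" for t by (simp add: w_def)
  let ?\<Theta> = "fourier \<eta>"
  define B0 N1 where "B0 = (\<integral>\<xi>. norm (\<eta> \<xi>) \<partial>lborel)" and "N1 = (\<integral>x. norm (?\<Theta> x) \<partial>lborel)"
  have B0: "norm (?\<Theta> x) \<le> B0" for x unfolding B0_def by (rule norm_fourier_le)
  have B0nn: "B0 \<ge> 0" "N1 \<ge> 0" by (auto simp: B0_def N1_def intro: integral_nonneg)
  have N1: "L1_norm ?\<Theta> = ennreal N1"
    unfolding N1_def using \<Theta> by (intro nn_integral_eq_integral) auto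
  define K where "K x q = w (fst q) * heat_kernel (fst q) (x - snd q)" for x :: "real ^ 'n" and q :: "real \<times> (real ^ 'n)"
  define F where "F x q = ?\<Theta> x * of_real (K x q)" for x q
  have mK [measurable]: "(\<lambda>(x, q). K x q) \<in> borel_measurable (lborel \<Otimes>\<^sub>M ?Q)"
    unfolding K_def by measurable
  have mF [measurable]: "(\<lambda>(x, q). F x q) \<in> borel_measurable (lborel \<Otimes>\<^sub>M ?Q)"
    unfolding F_def by measurable
  have K0: "K x q \<ge> 0" for x q by (simp add: K_def w0)
  \<comment> \<open>Bound for the space integral, weight included: the supremum norm for small, the \<open>L\<^sup>1\<close> norm for large times.\<close>
  define g :: "real \<Rightarrow> ennreal" where "g t = ennreal B0 * (ennreal (t powr (\<alpha> / 2 - 1)) * indicator {0..1} t)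
     + ennreal N1 * (ennreal (t powr (\<alpha> / 2 - 1 - ?d / 2)) * indicator {1..} t)" for t
  have [measurable]: "g \<in> borel_measurable borel" unfolding g_def by measurable
  have inner: "(\<integral>\<^sup>+x. ennreal (norm (F x (t, y))) \<partial>lborel) \<le> g t" for t y
  proof (cases "t > 0")
    case t: True
    have wt: "w t = t powr (\<alpha> / 2 - 1)" using t by (simp add: w_def)
    show ?thesis
    proof (cases "t \<le> 1")
      case True
      have "(\<integral>\<^sup>+x. ennreal (norm (F x (t, y))) \<partial>lborel) \<le> (\<integral>\<^sup>+x. ennreal (B0 * w t) * ennreal (heat_kernel t (x - y)) \<partial>lborel)"
      proof (intro nn_integral_mono)
        fix x
        have "norm (F x (t, y)) = norm (?\<Theta> x) * (w t * heat_kernel t (x - y))"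
          by (simp add: F_def norm_mult K0) (simp add: K_def)
        also have "\<dots> \<le> B0 * (w t * heat_kernel t (x - y))"
          using w0 by (intro mult_right_mono B0) auto
        finally have "ennreal (norm (F x (t, y))) \<le> ennreal (B0 * w t * heat_kernel t (x - y))"
          by (intro ennreal_leI) (simp only: mult.assoc)
        also have "\<dots> = ennreal (B0 * w t) * ennreal (heat_kernel t (x - y))"
          using B0nn w0 by (intro ennreal_mult) auto
        finally show "ennreal (norm (F x (t, y))) \<le> ennreal (B0 * w t) * ennreal (heat_kernel t (x - y))" .
      qed
      also have "\<dots> = ennreal (B0 * w t)"
        by (subst nn_integral_cmult) (auto simp: nn_integral_heat_kernel[OF t])
      finally have "(\<integral>\<^sup>+x. ennreal (norm (F x (t, y))) \<partial>lborel) \<le> ennreal (B0 * w t)" .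
      moreover have "g t = ennreal (B0 * w t) + ennreal N1 * (ennreal (t powr (\<alpha> / 2 - 1 - ?d / 2)) * indicator {1..} t)"
        using t True B0nn by (simp add: g_def wt ennreal_mult)
      ultimately show ?thesis by (simp add: add_increasing2)
    next
      case False
      have "heat_kernel t z \<le> t powr (- ?d / 2)" for z :: "real ^ 'n"
      proof (rule order_trans[OF heat_kernel_le[OF t]], rule powr_mono2')
        have "1 * t \<le> (4 * pi) * t" using t pi_ge_two by (intro mult_right_mono) auto
        then show "t \<le> 4 * pi * t" by simp
      qed (use t in auto)
      note hk = this
      have "(\<integral>\<^sup>+x. ennreal (norm (F x (t, y))) \<partial>lborel) \<le> (\<integral>\<^sup>+x. ennreal (w t * t powr (- ?d / 2)) * ennreal (norm (?\<Theta> x)) \<partial>lborel)"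
      proof (intro nn_integral_mono)
        fix x
        have "norm (F x (t, y)) = w t * heat_kernel t (x - y) * norm (?\<Theta> x)"
          by (simp add: F_def norm_mult K0) (simp add: K_def)
        also have "\<dots> \<le> w t * t powr (- ?d / 2) * norm (?\<Theta> x)"
          using w0 by (intro mult_right_mono mult_left_mono hk) auto
        finally have "ennreal (norm (F x (t, y))) \<le> ennreal (w t * t powr (- ?d / 2) * norm (?\<Theta> x))"
          by (intro ennreal_leI)
        also have "\<dots> = ennreal (w t * t powr (- ?d / 2)) * ennreal (norm (?\<Theta> x))"
          using w0 by (intro ennreal_mult) auto
        finally show "ennreal (norm (F x (t, y))) \<le> ennreal (w t * t powr (- ?d / 2)) * ennreal (norm (?\<Theta> x))" .
      qed
      also have "\<dots> = ennreal (w t * t powr (- ?d / 2)) * ennreal N1"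
        by (subst nn_integral_cmult) (auto simp: N1)
      also have "w t * t powr (- ?d / 2) = t powr (\<alpha> / 2 - 1 - ?d / 2)"
        unfolding wt powr_add[symmetric] by simp
      finally show ?thesis using False by (simp add: g_def mult.commute)
    qed
  qed (simp add: F_def K_def w_def)
  have "(\<integral>\<^sup>+p. ennreal (norm (case p of (x, q) \<Rightarrow> F x q)) \<partial>(lborel \<Otimes>\<^sub>M ?Q))
    = (\<integral>\<^sup>+q. (\<integral>\<^sup>+x. ennreal (norm (F x q)) \<partial>lborel) \<partial>?Q)"
    by (subst B.nn_integral_snd[symmetric]) (auto simp: split_beta')
  also have "\<dots> \<le> (\<integral>\<^sup>+q. g (fst q) \<partial>?Q)"
    using inner by (intro nn_integral_mono) (metis prod.collapse)
  also have "\<dots> = (\<integral>\<^sup>+t. (\<integral>\<^sup>+y. g t \<partial>M) \<partial>lborel)"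
    by (subst nn_integral_fst[symmetric]) auto
  also have "\<dots> = (\<integral>\<^sup>+t. g t \<partial>lborel) * emeasure M UNIV"
    by (simp add: sp nn_integral_multc)
  also have "\<dots> < \<infinity>"
  proof -
    have "(\<integral>\<^sup>+t. g t \<partial>lborel) = ennreal B0 * (\<integral>\<^sup>+t\<in>{0..1}. ennreal (t powr (\<alpha> / 2 - 1)) \<partial>lborel)
       + ennreal N1 * (\<integral>\<^sup>+t\<in>{1..}. ennreal (t powr (\<alpha> / 2 - 1 - ?d / 2)) \<partial>lborel)"
      unfolding g_def by (subst nn_integral_add) (auto simp: nn_integral_cmult)
    also have "\<dots> < \<infinity>"
      using \<alpha> by (simp add: nn_integral_powr_from_0 nn_integral_powr_to_inf ennreal_mult_less_top)
    finally show ?thesis by (simp add: ennreal_mult_less_top emeasure_eq_measure)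
  qed
  finally have fin: "(\<integral>\<^sup>+p. ennreal (norm (case p of (x, q) \<Rightarrow> F x q)) \<partial>(lborel \<Otimes>\<^sub>M ?Q)) < \<infinity>" .
  have intF: "integrable (lborel \<Otimes>\<^sub>M ?Q) (\<lambda>(x, q). F x q)"
    by (rule integrableI_bounded[OF mF fin])
  have ae: "AE x in lborel. ?\<Theta> x \<noteq> 0 \<longrightarrow> integrable lborel (\<lambda>t. w t * H t x) \<and> (\<integral>q. F x q \<partial>?Q) = ?\<Theta> x * of_real (?R x)"
    using B.AE_integrable_fst[OF intF]
  proof eventually_elim
    case (elim x)
    show ?case
    proof
      assume nz: "?\<Theta> x \<noteq> 0"
      have "integrable ?Q (\<lambda>q. complex_of_real (K x q))"
      proof -
        have "integrable ?Q (\<lambda>q. inverse (?\<Theta> x) * F x q)"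
          using elim by (intro integrable_mult_right) simp
        also have "(\<lambda>q. inverse (?\<Theta> x) * F x q) = (\<lambda>q. complex_of_real (K x q))"
          using nz by (simp add: F_def fun_eq_iff)
        finally show ?thesis .
      qed
      then have iK: "integrable ?Q (\<lambda>(t, y). K x (t, y))"
        by (simp add: complex_of_real_integrable_eq)
      have e: "(\<integral>y. K x (t, y) \<partial>M) = w t * H t x" for t by (simp add: K_def H_def)
      have 1: "integrable lborel (\<lambda>t. w t * H t x)" using Q.integrable_fst[OF iK] by (simp add: e)
      have "(\<integral>q. K x q \<partial>?Q) = ?R x"
        using Q.integral_fst[OF iK] by (simp add: e)
      then have "(\<integral>q. F x q \<partial>?Q) = ?\<Theta> x * of_real (?R x)"
        unfolding F_def by (simp only: integral_mult_right_zero integral_complex_of_real)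
      with 1 show "integrable lborel (\<lambda>t. w t * H t x) \<and> (\<integral>q. F x q \<partial>?Q) = ?\<Theta> x * of_real (?R x)" by simp
    qed
  qed
  then show ?I1 by eventually_elim auto
  have ae': "AE x in lborel. (\<integral>q. F x q \<partial>?Q) = ?\<Theta> x * of_real (?R x)"
    using ae by eventually_elim (auto simp: F_def)
  have mR [measurable]: "(\<lambda>x. ?\<Theta> x * of_real (?R x)) \<in> borel_measurable lborel"
    by measurable
  have mI: "(\<lambda>x. \<integral>q. F x q \<partial>?Q) \<in> borel_measurable lborel"
    using B.integrable_fst[OF intF] by (rule borel_measurable_integrable)
  show ?I2
    using B.integrable_fst[OF intF] integrable_cong_AE[OF mI mR ae'] by simp
  have "(\<integral>x. ?\<Theta> x * of_real (?R x) \<partial>lborel) = (\<integral>x. (\<integral>q. F x q \<partial>?Q) \<partial>lborel)"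
    by (rule integral_cong_AE[OF mR mI, symmetric, THEN sym]) (use ae' in auto)
  also have "\<dots> = (\<integral>q. (\<integral>x. F x q \<partial>lborel) \<partial>?Q)"
    by (rule B.Fubini_integral[OF intF, symmetric])
  also have "\<dots> = (\<integral>y. (\<integral>t. (\<integral>x. F x (t, y) \<partial>lborel) \<partial>lborel) \<partial>M)"
  proof -
    have "integrable ?Q (\<lambda>(t, y). \<integral>x. F x (t, y) \<partial>lborel)"
      using B.integrable_snd[OF intF] by (simp add: split_beta')
    from Q.integral_snd[OF this] show ?thesis by (simp add: split_beta')
  qed
  also have "\<dots> = (\<integral>y. of_real (Gamma (\<alpha> / 2)) * fourier (\<lambda>\<xi>. \<eta> \<xi> * of_real (riesz_multiplier \<alpha> \<xi>)) y \<partial>M)"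
  proof (rule Bochner_Integration.integral_cong[OF refl])
    fix y
    have "(\<integral>x. F x (t, y) \<partial>lborel) = of_real (w t) * fourier (\<lambda>\<xi>. \<eta> \<xi> * heat_symbol t \<xi>) y" for t
    proof (cases "t > 0")
      case True
      have "(\<integral>x. F x (t, y) \<partial>lborel) = (\<integral>x. of_real (w t) * (?\<Theta> x * of_real (heat_kernel t (x - y))) \<partial>lborel)"
        by (intro Bochner_Integration.integral_cong) (auto simp: F_def K_def)
      also have "\<dots> = of_real (w t) * (\<integral>x. ?\<Theta> x * of_real (heat_kernel t (x - y)) \<partial>lborel)"
        by (rule integral_mult_right_zero)
      finally show ?thesis by (simp only: fourier_heat_semigroup[OF \<eta> True])
    qed (simp add: F_def K_def w_def)
    then show "(\<integral>t. (\<integral>x. F x (t, y) \<partial>lborel) \<partial>lborel) = of_real (Gamma (\<alpha> / 2)) * fourier (\<lambda>\<xi>. \<eta> \<xi> * of_real (riesz_multiplier \<alpha> \<xi>)) y"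
      using fourier_riesz_multiplier[OF \<eta> r \<alpha>(1), of y] by (simp add: w_def)
  qed
  also have "\<dots> = of_real (Gamma (\<alpha> / 2)) * (\<integral>y. fourier (\<lambda>\<xi>. \<eta> \<xi> * of_real (riesz_multiplier \<alpha> \<xi>)) y \<partial>M)"
    by (rule integral_mult_right_zero)
  finally show ?I3 .
qed

lemma integral_fourier_mult_exp:
  fixes M :: "(real ^ 'n) measure" and \<eta> :: "real ^ 'n \<Rightarrow> complex"
  assumes M: "finite_measure M" and sM [measurable_cong]: "sets M = sets borel"
    and \<eta>: "integrable lborel \<eta>" and \<Theta>: "integrable lborel (fourier \<eta>)" and s: "s > 0"
  shows "integrable lborel (\<lambda>x. fourier \<eta> x * of_real (heat_of M s x))"
    and "(\<integral>z. fourier (\<lambda>\<xi>. \<eta> \<xi> * heat_symbol s \<xi>) z \<partial>M)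
      = (\<integral>x. fourier \<eta> x * of_real (heat_of M s x) \<partial>lborel)"
proof -
  interpret finite_measure M by fact
  interpret Q: pair_sigma_finite "lborel :: (real^'n) measure" M by standard
  note [measurable] = borel_measurable_integrable[OF \<eta>]
  have "integrable (lborel \<Otimes>\<^sub>M M) (\<lambda>(x, y). fourier \<eta> x * of_real (heat_kernel s (x - y)))"
  proof (rule Q.Fubini_integrable)
    show "(\<lambda>(x, y). fourier \<eta> x * complex_of_real (heat_kernel s (x - y))) \<in> borel_measurable (lborel \<Otimes>\<^sub>M M)"
      by measurable
    have e: "(\<integral>y. norm (case (x, y) of (x, y) \<Rightarrow> fourier \<eta> x * complex_of_real (heat_kernel s (x - y))) \<partial>M)
      = norm (fourier \<eta> x) * heat_of M s x" for x
      by (simp add: norm_mult)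
    have [measurable]: "(\<lambda>x. \<integral>y. heat_kernel s (x - y) \<partial>M) \<in> borel_measurable borel"
      using measurable_integral_heat_kernel[OF M sM] by measurable
    have H: "heat_of M s x \<le> measure M (space M) * (4 * pi * s) powr (- real CARD('n) / 2)" for x :: "real ^ 'n"
      using integral_mono[OF integrable_heat_kernel_measure[OF M sM s, of x] _ heat_kernel_le[OF s]] by simp
    show "integrable lborel (\<lambda>x. \<integral>y. norm (case (x, y) of (x, y) \<Rightarrow> fourier \<eta> x * complex_of_real (heat_kernel s (x - y))) \<partial>M)"
      unfolding e
    proof (rule Bochner_Integration.integrable_bound)
      show "integrable lborel (\<lambda>x. (measure M (space M) * (4 * pi * s) powr (- real CARD('n) / 2)) * norm (fourier \<eta> x))"
        using \<Theta> by auto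
      show "AE x in lborel. norm (norm (fourier \<eta> x) * heat_of M s x)
        \<le> norm ((measure M (space M) * (4 * pi * s) powr (- real CARD('n) / 2)) * norm (fourier \<eta> x))"
      proof (intro AE_I2)
        fix x
        have "0 \<le> heat_of M s x" by (auto intro: integral_nonneg)
        then show "norm (norm (fourier \<eta> x) * heat_of M s x)
          \<le> norm ((measure M (space M) * (4 * pi * s) powr (- real CARD('n) / 2)) * norm (fourier \<eta> x))"
          using mult_right_mono[OF H[of x] norm_ge_zero[of "fourier \<eta> x"]]
          by (simp add: abs_mult mult.commute)
      qed
    qed measurable
    show "AE x in lborel. integrable M (\<lambda>y. case (x, y) of (x, y) \<Rightarrow> fourier \<eta> x * complex_of_real (heat_kernel s (x - y)))"
      using integrable_heat_kernel_measure[OF M sM s] by (intro AE_I2) (simp add: complex_of_real_integrable_eq)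
  qed
  note i = this
  show "integrable lborel (\<lambda>x. fourier \<eta> x * of_real (heat_of M s x))"
    using Q.integrable_fst[OF i] by simp
  have "(\<integral>z. fourier (\<lambda>\<xi>. \<eta> \<xi> * heat_symbol s \<xi>) z \<partial>M)
    = (\<integral>z. (\<integral>x. fourier \<eta> x * of_real (heat_kernel s (x - z)) \<partial>lborel) \<partial>M)"
    by (simp only: fourier_heat_semigroup[OF \<eta> s])
  also have "\<dots> = (\<integral>x. (\<integral>y. fourier \<eta> x * of_real (heat_kernel s (x - y)) \<partial>M) \<partial>lborel)"
    by (rule Q.Fubini_integral[OF i])
  also have "\<dots> = (\<integral>x. fourier \<eta> x * of_real (heat_of M s x) \<partial>lborel)"
    by simp
  finally show "(\<integral>z. fourier (\<lambda>\<xi>. \<eta> \<xi> * heat_symbol s \<xi>) z \<partial>M)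
      = (\<integral>x. fourier \<eta> x * of_real (heat_of M s x) \<partial>lborel)" .
qed

lemma integral_fourier_mult_heat:
  fixes m \<phi> :: "real ^ 'n \<Rightarrow> complex"
  assumes m: "integrable lborel m" and k: "integrable lborel (inverse_fourier m)" and \<phi>: "integrable lborel \<phi>"
    and [measurable]: "h \<in> borel_measurable borel" and h: "\<And>x. \<bar>h x\<bar> \<le> B"
  shows "(\<integral>x. fourier (\<lambda>\<xi>. m \<xi> * inverse_fourier \<phi> \<xi>) x * of_real (h x) \<partial>lborel)
    = (\<integral>y. kernel_conv (inverse_fourier m) h y * \<phi> y \<partial>lborel)"
proof -
  note [measurable] = borel_measurable_integrable[OF m] borel_measurable_integrable[OF k] borel_measurable_integrable[OF \<phi>]
  have "integrable (lborel \<Otimes>\<^sub>M lborel) (\<lambda>(y, x). \<phi> y * inverse_fourier m (y - x))"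
    by (rule integrable_product_complex[OF \<phi>, where g' = "\<lambda>y x. inverse_fourier m (y - x)" and c = "\<integral>x. norm (inverse_fourier m x) \<partial>lborel"])
      (use integrable_reflect[OF k] integral_reflect[of "\<lambda>x. norm (inverse_fourier m x)"] in \<open>auto simp: norm_mult\<close>)
  then have "integrable (lborel \<Otimes>\<^sub>M lborel) (\<lambda>p. (case p of (y, x) \<Rightarrow> \<phi> y * inverse_fourier m (y - x)) * of_real (h (snd p)))"
    by (rule integrable_mult_bounded) (use h in auto)
  then have "integrable (lborel \<Otimes>\<^sub>M lborel) (\<lambda>(y, x). \<phi> y * inverse_fourier m (y - x) * of_real (h x))"
    by (simp add: split_beta')
  note swap = integral_swap_complex[OF this]
  have 1: "fourier (\<lambda>\<xi>. m \<xi> * inverse_fourier \<phi> \<xi>) x * of_real (h x) = (\<integral>y. \<phi> y * inverse_fourier m (y - x) * of_real (h x) \<partial>lborel)" for x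
    by (simp only: fourier_mult_inverse_fourier[OF m \<phi>] integral_mult_left_zero)
  have 2: "kernel_conv (inverse_fourier m) h y * \<phi> y = (\<integral>x. \<phi> y * inverse_fourier m (y - x) * of_real (h x) \<partial>lborel)" for y
    unfolding kernel_conv_def mult.assoc integral_mult_right_zero by (rule mult.commute)
  show ?thesis unfolding 1 2 by (rule swap[symmetric])
qed

text \<open>
  The cutoff Riesz potential as a smoothed heat flow. The symbol of \<open>mt\<close> carries the inverse of the heat
  symbol at time \<open>s\<close>, and this is what produces the heat flow of \<open>\<mu>\<close> on the right-hand side.
  The two Jordan components are treated separately. They recombine at almost every point where
  \<open>fourier \<eta>\<close> does not vanish, because both time integrals converge there.
\<close>

lemma riesz_potential_fourier_cutoff:
  fixes m \<phi> :: "real ^ 'n \<Rightarrow> complex"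
  assumes \<mu>: "signed_measure \<mu>" and \<alpha>: "0 < \<alpha>" "\<alpha> < real CARD('n)"
    and m: "integrable lborel m" and r: "r > 0" "\<forall>\<xi>. norm \<xi> < r \<longrightarrow> m \<xi> = 0"
    and k: "integrable lborel (inverse_fourier m)" and s: "s > 0"
  defines "mt \<equiv> \<lambda>\<xi>. m \<xi> * of_real (riesz_multiplier \<alpha> \<xi> * exp (4 * pi\<^sup>2 * s * (norm \<xi>)\<^sup>2))"
  assumes mt: "integrable lborel mt" and kt: "integrable lborel (inverse_fourier mt)" and \<phi>: "integrable lborel \<phi>"
  shows "distribution_of (\<lambda>x. of_real (riesz_potential \<alpha> \<mu> x)) (fourier (\<lambda>\<xi>. m \<xi> * inverse_fourier \<phi> \<xi>))
    = distribution_of (kernel_conv (inverse_fourier mt) (heat s \<mu>)) \<phi>"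
proof -
  note [measurable] = borel_measurable_integrable[OF m] borel_measurable_integrable[OF \<phi>] borel_measurable_integrable[OF mt]
  let ?P = "pos_part \<mu>" and ?N = "neg_part \<mu>"
  note fP = finite_pos_part[OF \<mu>] and fN = finite_neg_part[OF \<mu>]
  let ?c = "Gamma (\<alpha> / 2)"
  have c0: "?c > 0" using \<alpha> by (intro Gamma_real_pos) auto
  then have c1: "?c \<noteq> 0" by linarith
  define \<eta> where "\<eta> \<xi> = m \<xi> * inverse_fourier \<phi> \<xi>" for \<xi>
  define \<eta>t where "\<eta>t \<xi> = mt \<xi> * inverse_fourier \<phi> \<xi>" for \<xi>
  have i\<eta>: "integrable lborel \<eta>" and i\<eta>t: "integrable lborel \<eta>t"
    unfolding \<eta>_def \<eta>t_def
    by (rule integrable_mult_bounded[OF m] integrable_mult_bounded[OF mt], measurable, rule norm_inverse_fourier_le)+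
  note [measurable] = borel_measurable_integrable[OF i\<eta>]
  have i\<Theta>: "integrable lborel (fourier \<eta>)" and i\<Theta>t: "integrable lborel (fourier \<eta>t)"
    unfolding \<eta>_def \<eta>t_def by (rule integrable_fourier_mult m mt k kt \<phi>)+
  have r': "\<forall>\<xi>. norm \<xi> < r \<longrightarrow> \<eta> \<xi> = 0" using r(2) by (simp add: \<eta>_def)
  define w where "w t = indicator {0<..} t * t powr (\<alpha> / 2 - 1)" for t :: real
  define H where "H M t x = heat_of M t x" for M t and x :: "real ^ 'n"
  have [measurable]: "w \<in> borel_measurable borel" unfolding w_def by measurable
  note RP = riesz_fubini[OF fP sets_pos_part \<alpha> i\<eta> r(1) r' i\<Theta>, folded w_def H_def]
  note RN = riesz_fubini[OF fN sets_neg_part \<alpha> i\<eta> r(1) r' i\<Theta>, folded w_def H_def]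
  have he: "heat t \<mu> x = H ?P t x - H ?N t x" for t x by (simp add: heat_eq H_def)
  have riesz: "riesz_potential \<alpha> \<mu> x = 1 / ?c * (\<integral>t. w t * H ?P t x - w t * H ?N t x \<partial>lborel)" for x
  proof -
    have "(LBINT t:{0<..}. t powr (\<alpha> / 2 - 1) * heat t \<mu> x) = (\<integral>t. w t * H ?P t x - w t * H ?N t x \<partial>lborel)"
      unfolding set_lebesgue_integral_def
      by (intro Bochner_Integration.integral_cong) (auto simp: w_def he right_diff_distrib mult.assoc)
    then show ?thesis by (simp add: riesz_potential_def)
  qed
  let ?RP = "\<lambda>x. fourier \<eta> x * of_real (\<integral>t. w t * H ?P t x \<partial>lborel)"
  let ?RN = "\<lambda>x. fourier \<eta> x * of_real (\<integral>t. w t * H ?N t x \<partial>lborel)"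
  have [measurable]: "(\<lambda>(t, x). H ?P t x) \<in> borel_measurable (borel \<Otimes>\<^sub>M borel)" "(\<lambda>(t, x). H ?N t x) \<in> borel_measurable (borel \<Otimes>\<^sub>M borel)"
    unfolding H_def using measurable_integral_heat_kernel[OF fP sets_pos_part] measurable_integral_heat_kernel[OF fN sets_neg_part] by simp_all
  have mI: "(\<lambda>x. complex_of_real (riesz_potential \<alpha> \<mu> x) * fourier \<eta> x) \<in> borel_measurable lborel"
    unfolding riesz by measurable
  have ae: "AE x in lborel. complex_of_real (riesz_potential \<alpha> \<mu> x) * fourier \<eta> x = of_real (1 / ?c) * (?RP x - ?RN x)"
    using RP(1) RN(1)
  proof eventually_elim
    case (elim x)
    show ?case
    proof (cases "fourier \<eta> x = 0")
      case False
      then have eq: "(\<integral>t. w t * H ?P t x - w t * H ?N t x \<partial>lborel) = (\<integral>t. w t * H ?P t x \<partial>lborel) - (\<integral>t. w t * H ?N t x \<partial>lborel)"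
        using elim by (intro Bochner_Integration.integral_diff) auto
      show ?thesis unfolding riesz eq by (simp add: algebra_simps)
    qed simp
  qed
  have ident: "(\<integral>x. fourier \<eta> x * of_real (\<integral>t. w t * H M t x \<partial>lborel) \<partial>lborel) = of_real ?c * (\<integral>x. fourier \<eta>t x * of_real (H M s x) \<partial>lborel)"
    if M: "finite_measure M" "sets M = sets borel" for M
  proof -
    have "\<eta> \<xi> * of_real (riesz_multiplier \<alpha> \<xi>) = \<eta>t \<xi> * heat_symbol s \<xi>" for \<xi>
    proof -
      have e1: "exp (4 * pi\<^sup>2 * s * (norm \<xi>)\<^sup>2) * exp (- 4 * pi\<^sup>2 * s * (norm \<xi>)\<^sup>2) = 1"
        by (simp add: exp_add[symmetric])
      have "\<eta>t \<xi> * heat_symbol s \<xi> = \<eta> \<xi> * of_real (riesz_multiplier \<alpha> \<xi> * (exp (4 * pi\<^sup>2 * s * (norm \<xi>)\<^sup>2) * exp (- 4 * pi\<^sup>2 * s * (norm \<xi>)\<^sup>2)))"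
        by (simp only: \<eta>t_def \<eta>_def mt_def of_real_mult mult_ac)
      then show ?thesis unfolding e1 by simp
    qed
    then show ?thesis
      unfolding w_def H_def
      using riesz_fubini(3)[OF M \<alpha> i\<eta> r(1) r' i\<Theta>] integral_fourier_mult_exp(2)[OF M i\<eta>t i\<Theta>t s] by simp
  qed
  have iH: "integrable lborel (\<lambda>x. fourier \<eta>t x * of_real (H ?P s x))" "integrable lborel (\<lambda>x. fourier \<eta>t x * of_real (H ?N s x))"
    unfolding H_def by (rule integral_fourier_mult_exp(1)[OF _ _ i\<eta>t i\<Theta>t s]; simp add: fP fN)+
  have "distribution_of (\<lambda>x. of_real (riesz_potential \<alpha> \<mu> x)) (fourier \<eta>) = (\<integral>x. of_real (1 / ?c) * (?RP x - ?RN x) \<partial>lborel)"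
    unfolding distribution_of_def
    by (rule integral_cong_AE[OF mI _ ae]) measurable
  also have "\<dots> = of_real (1 / ?c) * ((\<integral>x. ?RP x \<partial>lborel) - (\<integral>x. ?RN x \<partial>lborel))"
    by (subst integral_mult_right_zero, subst Bochner_Integration.integral_diff[OF RP(2) RN(2)]) simp
  also have "\<dots> = (\<integral>x. fourier \<eta>t x * of_real (H ?P s x) \<partial>lborel) - (\<integral>x. fourier \<eta>t x * of_real (H ?N s x) \<partial>lborel)"
    unfolding ident[OF fP sets_pos_part] ident[OF fN sets_neg_part] using c1 by (simp add: field_simps)
  also have "\<dots> = (\<integral>x. fourier \<eta>t x * of_real (heat s \<mu> x) \<partial>lborel)"
    by (subst Bochner_Integration.integral_diff[OF iH, symmetric]) (simp add: he right_diff_distrib)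
  also have "\<dots> = (\<integral>y. kernel_conv (inverse_fourier mt) (heat s \<mu>) y * \<phi> y \<partial>lborel)"
    unfolding \<eta>t_def
  proof (rule integral_fourier_mult_heat[OF mt kt \<phi>])
    show "heat s \<mu> \<in> borel_measurable borel" using measurable_heat[OF \<mu>] by measurable
    show "\<bar>heat s \<mu> x\<bar> \<le> (4 * pi * s) powr (- real CARD('n) / 2) * total_mass \<mu>" for x
      by (rule heat_bounded[OF \<mu> s])
  qed
  finally show ?thesis by (simp add: distribution_of_def \<eta>_def[abs_def])
qed

section \<open>Littlewood-Paley blocks of a Riesz potential\<close>

lemma schwartz_integrable:
  fixes \<phi> :: "real ^ 'n \<Rightarrow> complex"
  assumes "\<phi> \<in> schwartz"
  shows "integrable lborel \<phi>"
proof -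
  let ?d = "CARD('n)"
  have sm: "smooth \<phi>" and bd: "bounded (range (\<lambda>x. (1 + norm x) ^ (2 * ?d) *\<^sub>R iterated_derivative [] \<phi> x))"
    using assms unfolding schwartz_def by blast+
  from sm have "iterated_derivative [] \<phi> differentiable_on UNIV" unfolding smooth_def by blast
  then have "continuous_on UNIV \<phi>" by (simp add: differentiable_imp_continuous_on)
  then have [measurable]: "\<phi> \<in> borel_measurable borel" by (rule borel_measurable_continuous_onI)
  obtain C where C: "\<And>x. norm ((1 + norm x) ^ (2 * ?d) *\<^sub>R \<phi> x) \<le> C"
    using bd by (auto simp: bounded_iff)
  have bound: "norm (\<phi> x) \<le> C * (1 / (1 + (norm x)\<^sup>2) ^ ?d)" for x
  proof -
    have "1 + (norm x)\<^sup>2 \<le> (1 + norm x)\<^sup>2" by (simp add: power2_sum)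
    then have "(1 + (norm x)\<^sup>2) ^ ?d \<le> ((1 + norm x)\<^sup>2) ^ ?d" by (intro power_mono) auto
    then have "(1 + (norm x)\<^sup>2) ^ ?d * norm (\<phi> x) \<le> (1 + norm x) ^ (2 * ?d) * norm (\<phi> x)"
      by (intro mult_right_mono) (simp_all add: power_mult)
    also have "\<dots> \<le> C" using C[of x] by simp
    finally show ?thesis by (simp add: field_simps add_pos_nonneg)
  qed
  have "integrable lborel (\<lambda>x. C * (1 / (1 + (norm (x::real^'n))\<^sup>2) ^ ?d))"
    using nn_integral_Bessel_weight_finite[where 'n = 'n]
    by (intro integrable_mult_right integrableI_nonneg) auto
  then show ?thesis
  proof (rule Bochner_Integration.integrable_bound)
    show "AE x in lborel. norm (\<phi> x) \<le> norm (C * (1 / (1 + (norm x)\<^sup>2) ^ ?d))"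
      unfolding real_norm_def by (intro AE_I2 order_trans[OF bound abs_ge_self])
  qed measurable
qed

lemma inverse_fourier_scale_integrable:
  fixes m :: "real ^ 'n \<Rightarrow> complex"
  assumes "\<rho> > 0" and k: "integrable lborel (inverse_fourier m)"
  shows "integrable lborel (inverse_fourier (\<lambda>\<xi>. m (\<rho> *\<^sub>R \<xi>)))"
    and "(\<integral>x. norm (inverse_fourier (\<lambda>\<xi>. m (\<rho> *\<^sub>R \<xi>)) x) \<partial>lborel) = (\<integral>x. norm (inverse_fourier m x) \<partial>lborel)"
proof -
  have eq: "inverse_fourier (\<lambda>\<xi>. m (\<rho> *\<^sub>R \<xi>)) = (\<lambda>x. of_real (1 / \<rho> ^ CARD('n)) * inverse_fourier m (0 + (1 / \<rho>) *\<^sub>R x))"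
    by (rule ext) (simp add: inverse_fourier_scale[OF assms(1)] inverse_eq_divide)
  show "integrable lborel (inverse_fourier (\<lambda>\<xi>. m (\<rho> *\<^sub>R \<xi>)))"
    unfolding eq using assms by (intro integrable_mult_right integrable_lborel_affine) auto
  have "(\<integral>x. norm (inverse_fourier m x) \<partial>lborel) = \<bar>1 / \<rho>\<bar> ^ CARD('n) * (\<integral>x. norm (inverse_fourier m (0 + (1 / \<rho>) *\<^sub>R x)) \<partial>lborel)"
    using assms integral_lborel_affine[of "1 / \<rho>" "\<lambda>x. norm (inverse_fourier m x)" 0] by simp
  then show "(\<integral>x. norm (inverse_fourier (\<lambda>\<xi>. m (\<rho> *\<^sub>R \<xi>)) x) \<partial>lborel) = (\<integral>x. norm (inverse_fourier m x) \<partial>lborel)"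
    unfolding eq using assms by (simp add: norm_mult norm_divide norm_power power_divide)
qed

lemma generator_smooth_along:
  fixes \<psi> :: "real ^ 'n \<Rightarrow> complex"
  assumes \<psi>: "littlewood_paley_generator \<psi>"
  shows "smooth_along v (closure {\<xi>. \<psi> \<xi> \<noteq> 0}) N \<psi>"
    and "smooth_along v (closure {\<xi>. \<psi> \<xi> \<noteq> 0}) N
      (\<lambda>\<xi>. \<psi> \<xi> * of_real (riesz_multiplier \<alpha> \<xi> * exp (4 * pi\<^sup>2 * (norm \<xi>)\<^sup>2)))"
proof -
  have 0: "smooth_along v (closure {\<xi>. \<psi> \<xi> \<noteq> 0}) N \<psi>" for N
    using smooth_along_iterated_derivative[of \<psi> v N 0] \<psi> by (simp add: littlewood_paley_generator_def)
  then show "smooth_along v (closure {\<xi>. \<psi> \<xi> \<noteq> 0}) N \<psi>" .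
  have "0 \<notin> closure {\<xi>. \<psi> \<xi> \<noteq> 0}" using \<psi> by (simp add: littlewood_paley_generator_def)
  note gm = smooth_along_gauss_monomial[OF closed_closure this 0, where c = "4 * pi\<^sup>2" and k = 0 and b = "- \<alpha> / 2"]
  from smooth_along_cmult[OF gm, where c = "of_real ((4 * pi\<^sup>2) powr (- \<alpha> / 2))"]
  show "smooth_along v (closure {\<xi>. \<psi> \<xi> \<noteq> 0}) N
      (\<lambda>\<xi>. \<psi> \<xi> * of_real (riesz_multiplier \<alpha> \<xi> * exp (4 * pi\<^sup>2 * (norm \<xi>)\<^sup>2)))"
    by (simp add: gauss_monomial_def power2_norm_eq_inner powr_mult mult_ac)
qed

text \<open>
  The symbol of the unit-scale block with the heat symbol at time one divided out, so that
  \<open>riesz_symbol \<psi> \<alpha> \<xi> * heat_symbol 1 \<xi>\<close> is \<open>\<psi> \<xi>\<close> times the Riesz multiplier.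
\<close>

definition riesz_symbol :: "(real ^ 'n \<Rightarrow> complex) \<Rightarrow> real \<Rightarrow> real ^ 'n \<Rightarrow> complex" where
  "riesz_symbol \<psi> \<alpha> \<xi> = \<psi> \<xi> * of_real (riesz_multiplier \<alpha> \<xi> * exp (4 * pi\<^sup>2 * (norm \<xi>)\<^sup>2))"

text \<open>
  The function that represents the Littlewood-Paley block at length scale \<open>\<rho>\<close> of the Riesz potential of
  \<open>\<mu>\<close>. Homogeneity of the Riesz multiplier produces the factor \<open>\<rho> powr \<alpha>\<close>.
\<close>

definition riesz_block :: "(real ^ 'n \<Rightarrow> complex) \<Rightarrow> real \<Rightarrow> real \<Rightarrow> ((real ^ 'n) set \<Rightarrow> real) \<Rightarrow> real ^ 'n \<Rightarrow> complex" where
  "riesz_block \<psi> \<alpha> \<rho> \<mu> = kernel_conv (inverse_fourier (\<lambda>\<xi>. of_real (\<rho> powr \<alpha>) * riesz_symbol \<psi> \<alpha> (\<rho> *\<^sub>R \<xi>))) (heat (\<rho>\<^sup>2) \<mu>)"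

lemma generator_integrable:
  fixes \<psi> :: "real ^ 'n \<Rightarrow> complex"
  assumes \<psi>: "littlewood_paley_generator \<psi>"
  shows "integrable lborel \<psi>" "integrable lborel (inverse_fourier \<psi>)"
    "integrable lborel (riesz_symbol \<psi> \<alpha>)" "integrable lborel (inverse_fourier (riesz_symbol \<psi> \<alpha>))"
proof -
  have S: "compact (closure {\<xi>. \<psi> \<xi> \<noteq> 0})" using \<psi> by (simp add: littlewood_paley_generator_def)
  have e: "riesz_symbol \<psi> \<alpha> = (\<lambda>\<xi>. \<psi> \<xi> * of_real (riesz_multiplier \<alpha> \<xi> * exp (4 * pi\<^sup>2 * (norm \<xi>)\<^sup>2)))"
    by (rule ext) (simp add: riesz_symbol_def)
  note sm = generator_smooth_along[OF \<psi>]
  show "integrable lborel \<psi>" by (rule smooth_along_integrable[OF sm(1) S])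
  show "integrable lborel (inverse_fourier \<psi>)" by (rule integrable_inverse_fourier[OF S sm(1)])
  show "integrable lborel (riesz_symbol \<psi> \<alpha>)" unfolding e by (rule smooth_along_integrable[OF sm(2) S])
  show "integrable lborel (inverse_fourier (riesz_symbol \<psi> \<alpha>))" unfolding e by (rule integrable_inverse_fourier[OF S sm(2)])
qed

lemma inverse_fourier_cmult: "inverse_fourier (\<lambda>\<xi>. c * m \<xi>) = (\<lambda>x. c * inverse_fourier m x)"
proof
  fix x
  have "inverse_fourier (\<lambda>\<xi>. c * m \<xi>) x = (\<integral>\<xi>. c * (cis (2 * pi * (x \<bullet> \<xi>)) * m \<xi>) \<partial>lborel)"
    unfolding inverse_fourier_def by (simp only: mult.left_commute)
  then show "inverse_fourier (\<lambda>\<xi>. c * m \<xi>) x = c * inverse_fourier m x"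
    unfolding inverse_fourier_def by (simp only: integral_mult_right_zero)
qed

text \<open>
  Dilations of the symbol preserve the \<open>L\<^sup>1\<close> norm of the kernel, so only the factor \<open>\<rho> powr \<alpha>\<close> remains.
\<close>

lemma riesz_block_kernel:
  fixes \<psi> :: "real ^ 'n \<Rightarrow> complex" and \<alpha> \<rho> :: real
  assumes \<psi>: "littlewood_paley_generator \<psi>" and \<rho>: "\<rho> > 0"
  defines "k \<equiv> inverse_fourier (\<lambda>\<xi>. of_real (\<rho> powr \<alpha>) * riesz_symbol \<psi> \<alpha> (\<rho> *\<^sub>R \<xi>))"
  shows "integrable lborel k"
    and "(\<integral>x. norm (k x) \<partial>lborel) = \<rho> powr \<alpha> * (\<integral>x. norm (inverse_fourier (riesz_symbol \<psi> \<alpha>) x) \<partial>lborel)"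
  unfolding k_def inverse_fourier_cmult
  using inverse_fourier_scale_integrable[OF \<rho> generator_integrable(4)[OF \<psi>, of \<alpha>]]
  by (auto simp: norm_mult)

lemma riesz_block_represents:
  fixes \<psi> :: "real ^ 'n \<Rightarrow> complex"
  assumes \<psi>: "littlewood_paley_generator \<psi>" and \<alpha>: "0 < \<alpha>" "\<alpha> < real CARD('n)" and \<mu>: "signed_measure \<mu>"
  shows "represented_by (littlewood_paley \<psi> j (distribution_of (\<lambda>x. of_real (riesz_potential \<alpha> \<mu> x))))
    (riesz_block \<psi> \<alpha> (2 powi (- j)) \<mu>)"
proof -
  define \<rho> :: real where "\<rho> = 2 powi (- j)"
  have \<rho>: "\<rho> > 0" by (simp add: \<rho>_def)
  have s: "\<rho>\<^sup>2 > 0" using \<rho> by simp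
  note gi = generator_integrable[OF \<psi>]
  define m where "m \<xi> = \<psi> (\<rho> *\<^sub>R \<xi>)" for \<xi>
  define mt where "mt = (\<lambda>\<xi>. m \<xi> * of_real (riesz_multiplier \<alpha> \<xi> * exp (4 * pi\<^sup>2 * \<rho>\<^sup>2 * (norm \<xi>)\<^sup>2)))"
  \<comment> \<open>The symbol at scale \<open>\<rho>\<close> is a dilation of the symbol at unit scale, by homogeneity of the multiplier.\<close>
  have mt: "mt = (\<lambda>\<xi>. of_real (\<rho> powr \<alpha>) * riesz_symbol \<psi> \<alpha> (\<rho> *\<^sub>R \<xi>))"
  proof
    fix \<xi> :: "real ^ 'n"
    have n: "(norm (\<rho> *\<^sub>R \<xi>))\<^sup>2 = \<rho>\<^sup>2 * (norm \<xi>)\<^sup>2" by (simp add: power_mult_distrib)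
    have e: "4 * pi\<^sup>2 * (\<rho>\<^sup>2 * (norm \<xi>)\<^sup>2) = \<rho>\<^sup>2 * (4 * pi\<^sup>2 * (norm \<xi>)\<^sup>2)" by simp
    have "\<rho> powr \<alpha> * (4 * pi\<^sup>2 * (\<rho>\<^sup>2 * (norm \<xi>)\<^sup>2)) powr (- \<alpha> / 2) = \<rho> powr \<alpha> * (\<rho>\<^sup>2) powr (- \<alpha> / 2) * riesz_multiplier \<alpha> \<xi>"
      unfolding e by (subst powr_mult) simp_all
    also have "\<rho> powr \<alpha> * (\<rho>\<^sup>2) powr (- \<alpha> / 2) = 1"
    proof -
      have "(\<rho>\<^sup>2) powr (- \<alpha> / 2) = \<rho> powr (- \<alpha>)"
      proof -
        have "\<rho>\<^sup>2 = \<rho> powr 2" using \<rho> by (simp add: powr_numeral)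
        then show ?thesis by (simp only: powr_powr) simp
      qed
      then show ?thesis using \<rho> by (simp add: powr_add[symmetric])
    qed
    finally have "\<rho> powr \<alpha> * (4 * pi\<^sup>2 * (\<rho>\<^sup>2 * (norm \<xi>)\<^sup>2)) powr (- \<alpha> / 2) = riesz_multiplier \<alpha> \<xi>" by simp
    then have "riesz_multiplier \<alpha> \<xi> * exp (4 * pi\<^sup>2 * \<rho>\<^sup>2 * (norm \<xi>)\<^sup>2)
       = \<rho> powr \<alpha> * ((4 * pi\<^sup>2 * (\<rho>\<^sup>2 * (norm \<xi>)\<^sup>2)) powr (- \<alpha> / 2) * exp (4 * pi\<^sup>2 * (\<rho>\<^sup>2 * (norm \<xi>)\<^sup>2)))"
      by (simp only: mult.assoc[symmetric])
    then show "mt \<xi> = of_real (\<rho> powr \<alpha>) * riesz_symbol \<psi> \<alpha> (\<rho> *\<^sub>R \<xi>)"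
      unfolding mt_def m_def riesz_symbol_def n by (simp only: of_real_mult mult_ac)
  qed
  have im: "integrable lborel m"
    using integrable_lborel_affine[OF gi(1), of \<rho> 0] \<rho> by (simp add: m_def[abs_def])
  have ik: "integrable lborel (inverse_fourier m)"
    using inverse_fourier_scale_integrable(1)[OF \<rho> gi(2)] by (simp add: m_def[abs_def])
  have imt: "integrable lborel mt"
    unfolding mt using integrable_lborel_affine[OF gi(3)[of \<alpha>], of \<rho> 0] \<rho> by (intro integrable_mult_right) simp
  have ikt: "integrable lborel (inverse_fourier mt)"
    unfolding mt by (rule riesz_block_kernel(1)[OF \<psi> \<rho>])
  have "open (- closure {\<xi>. \<psi> \<xi> \<noteq> 0})" "0 \<in> - closure {\<xi>. \<psi> \<xi> \<noteq> 0}"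
    using \<psi> by (auto simp: littlewood_paley_generator_def)
  then obtain e where e: "e > 0" "ball 0 e \<subseteq> - closure {\<xi>. \<psi> \<xi> \<noteq> 0}"
    using openE by blast
  have m0: "\<forall>\<xi>. norm \<xi> < e / \<rho> \<longrightarrow> m \<xi> = 0"
  proof (intro allI impI)
    fix \<xi> :: "real ^ 'n" assume "norm \<xi> < e / \<rho>"
    then have "\<rho> *\<^sub>R \<xi> \<in> ball 0 e" using \<rho> by (simp add: field_simps)
    then have "\<rho> *\<^sub>R \<xi> \<notin> {\<xi>. \<psi> \<xi> \<noteq> 0}" using e(2) closure_subset[of "{\<xi>. \<psi> \<xi> \<noteq> 0}"] by (meson ComplD subsetD)
    then show "m \<xi> = 0" by (simp add: m_def)
  qed
  have er: "e / \<rho> > 0" using e \<rho> by simp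
  have block: "riesz_block \<psi> \<alpha> \<rho> \<mu> = kernel_conv (inverse_fourier mt) (heat (\<rho>\<^sup>2) \<mu>)"
    by (simp add: riesz_block_def mt)
  have mh [measurable]: "heat (\<rho>\<^sup>2) \<mu> \<in> borel_measurable borel" using measurable_heat[OF \<mu>] by measurable
  have mg [measurable]: "riesz_block \<psi> \<alpha> \<rho> \<mu> \<in> borel_measurable borel"
    unfolding block by (rule kernel_conv_measurable[OF ikt mh])
  show ?thesis
    unfolding represented_by_def \<rho>_def[symmetric]
  proof (intro conjI ballI mg)
    fix \<phi> :: "real ^ 'n \<Rightarrow> complex" assume "\<phi> \<in> schwartz"
    then have \<phi>: "integrable lborel \<phi>" by (rule schwartz_integrable)
    have "integrable lborel (\<lambda>x. \<phi> x * riesz_block \<psi> \<alpha> \<rho> \<mu> x)"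
      by (rule integrable_mult_bounded[OF \<phi>], measurable, unfold block, rule kernel_conv_bounded[OF ikt mh heat_bounded[OF \<mu> s]])
    then show "integrable lborel (\<lambda>x. riesz_block \<psi> \<alpha> \<rho> \<mu> x * \<phi> x)" by (simp only: mult.commute)
    show "littlewood_paley \<psi> j (distribution_of (\<lambda>x. of_real (riesz_potential \<alpha> \<mu> x))) \<phi> = distribution_of (riesz_block \<psi> \<alpha> \<rho> \<mu>) \<phi>"
      using riesz_potential_fourier_cutoff[OF \<mu> \<alpha> im er m0 ik s imt[unfolded mt_def] ikt[unfolded mt_def] \<phi>]
      unfolding block mt_def
      by (simp add: littlewood_paley_def inverse_fourier_distribution_def mult_distribution_def fourier_distribution_def m_def \<rho>_def)
  qed
qed

text \<open>
  The bound, up to a factor that depends on \<open>p\<close> only, for the \<open>L\<^bsup>p,1\<^esup>\<close> norm of one block of an atom, as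
  a function of the ratio \<open>u\<close> of side length to length scale. The first branch comes from cancellation, the
  second from the bound on the heat flow in the definition of an atom.
\<close>

definition atom_weight :: "real \<Rightarrow> real \<Rightarrow> real \<Rightarrow> real \<Rightarrow> real" where
  "atom_weight K \<gamma> N u = (if u \<le> 1 then N * K * u else N * u powr (- \<gamma>))"

lemma sum_geometric_le:
  fixes q :: real
  assumes "0 \<le> q" "q < 1" "finite F"
  shows "(\<Sum>n\<in>F. q ^ n) \<le> 1 / (1 - q)"
  using sum_le_suminf[OF summable_geometric[of q] assms(3)] suminf_geometric[of q] assms by simp

text \<open>
  Let \<open>j0\<close> be the scale at which the ratio crosses one. Below it the weights are dominated by powers of \<open>1/2\<close>,
  above it by powers of \<open>2 powr - \<gamma>\<close>; the position of \<open>j0\<close>, and hence \<open>l\<close>, does not matter.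
\<close>

lemma sum_atom_weight_le:
  assumes K: "K \<ge> 0" and N: "N \<ge> 0" and \<gamma>: "\<gamma> > 0" and l: "l > 0" and F: "finite F"
  shows "(\<Sum>j\<in>F. atom_weight K \<gamma> N (l * 2 powi j)) \<le> 2 * N * K + N / (1 - 2 powr (- \<gamma>))"
proof -
  \<comment> \<open>The last scale at which the ratio is at most one.\<close>
  define j0 where "j0 = \<lfloor>- log 2 l\<rfloor>"
  have pw: "(2::real) powi j = 2 powr j" for j by (simp add: powr_real_of_int')
  have lp: "l = 2 powr (log 2 l)" using l by simp
  have u: "l * 2 powi j = 2 powr (log 2 l + j)" for j by (subst lp) (simp add: powr_add pw)
  have j0: "of_int j0 \<le> - log 2 l" "- log 2 l < of_int j0 + 1" unfolding j0_def by linarith+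
  have A: "atom_weight K \<gamma> N (l * 2 powi j) \<le> N * K * (1 / 2) ^ nat (j0 - j)" if "j \<le> j0" for j
  proof -
    have le: "log 2 l + j \<le> - real (nat (j0 - j))" using j0 that by simp
    also have "\<dots> \<le> 0" by simp
    finally have "l * 2 powi j \<le> 1" unfolding u using powr_mono[of "log 2 l + j" 0 2] by simp
    moreover have "l * 2 powi j \<le> (1 / 2) ^ nat (j0 - j)"
    proof -
      have "l * 2 powi j \<le> 2 powr (- real (nat (j0 - j)))" unfolding u by (intro powr_mono le) auto
      also have "\<dots> = (1 / 2) ^ nat (j0 - j)" by (simp add: powr_minus_divide powr_realpow power_one_over)
      finally show ?thesis .
    qed
    ultimately show ?thesis using K N by (auto simp: atom_weight_def intro!: mult_left_mono)
  qed
  have B: "atom_weight K \<gamma> N (l * 2 powi j) \<le> N * (2 powr (- \<gamma>)) ^ nat (j - j0 - 1)" if "j > j0" for j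
  proof -
    have ge: "log 2 l + j > real (nat (j - j0 - 1))" using j0 that by simp
    then have "log 2 l + j > 0" using of_nat_0_le_iff le_less_trans by blast
    then have "l * 2 powi j > 1" unfolding u by simp
    moreover have "(l * 2 powi j) powr (- \<gamma>) \<le> (2 powr (- \<gamma>)) ^ nat (j - j0 - 1)"
    proof -
      have "(l * 2 powi j) powr (- \<gamma>) = 2 powr ((log 2 l + j) * (- \<gamma>))" unfolding u powr_powr ..
      also have "\<dots> \<le> 2 powr (real (nat (j - j0 - 1)) * (- \<gamma>))"
        using ge \<gamma> by (intro powr_mono) (auto simp: mult_right_mono)
      also have "\<dots> = (2 powr (- \<gamma>)) ^ nat (j - j0 - 1)" by (simp add: powr_power mult.commute)
      finally show ?thesis .
    qed
    ultimately show ?thesis using N by (auto simp: atom_weight_def intro!: mult_left_mono)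
  qed
  let ?F1 = "{j \<in> F. j \<le> j0}" and ?F2 = "{j \<in> F. j > j0}"
  have q: "0 \<le> 2 powr (- \<gamma>)" "2 powr (- \<gamma>) < (1::real)" using \<gamma> powr_less_mono[of "- \<gamma>" 0 2] by auto
  have "(\<Sum>j\<in>F. atom_weight K \<gamma> N (l * 2 powi j)) = (\<Sum>j\<in>?F1. atom_weight K \<gamma> N (l * 2 powi j)) + (\<Sum>j\<in>?F2. atom_weight K \<gamma> N (l * 2 powi j))"
    using F by (subst sum.union_disjoint[symmetric]) (auto intro!: sum.cong)
  moreover have "(\<Sum>j\<in>?F1. atom_weight K \<gamma> N (l * 2 powi j)) \<le> N * K * (1 / (1 - 1 / 2))"
  proof -
    have "(\<Sum>j\<in>?F1. atom_weight K \<gamma> N (l * 2 powi j)) \<le> N * K * (\<Sum>j\<in>?F1. (1 / 2) ^ nat (j0 - j))"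
      unfolding sum_distrib_left by (intro sum_mono A) auto
    also have "(\<Sum>j\<in>?F1. (1 / 2) ^ nat (j0 - j)) = (\<Sum>n\<in>(\<lambda>j. nat (j0 - j)) ` ?F1. (1 / 2 :: real) ^ n)"
      by (subst sum.reindex) (auto simp: inj_on_def)
    also have "N * K * \<dots> \<le> N * K * (1 / (1 - 1 / 2))"
      using F K N by (intro mult_left_mono sum_geometric_le) auto
    finally show ?thesis .
  qed
  moreover have "(\<Sum>j\<in>?F2. atom_weight K \<gamma> N (l * 2 powi j)) \<le> N * (1 / (1 - 2 powr (- \<gamma>)))"
  proof -
    have "(\<Sum>j\<in>?F2. atom_weight K \<gamma> N (l * 2 powi j)) \<le> N * (\<Sum>j\<in>?F2. (2 powr (- \<gamma>)) ^ nat (j - j0 - 1))"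
      unfolding sum_distrib_left by (intro sum_mono B) auto
    also have "(\<Sum>j\<in>?F2. (2 powr (- \<gamma>)) ^ nat (j - j0 - 1)) = (\<Sum>n\<in>(\<lambda>j. nat (j - j0 - 1)) ` ?F2. (2 powr (- \<gamma>)) ^ n)"
      by (subst sum.reindex) (auto simp: inj_on_def)
    also have "N * \<dots> \<le> N * (1 / (1 - 2 powr (- \<gamma>)))"
      using F q N by (intro mult_left_mono sum_geometric_le) auto
    finally show ?thesis .
  qed
  ultimately show ?thesis by simp
qed

section \<open>The endpoint estimate\<close>

lemma riesz_block_measurable [measurable]:
  assumes "littlewood_paley_generator \<psi>" "\<rho> > 0" "signed_measure \<mu>"
  shows "riesz_block \<psi> \<alpha> \<rho> \<mu> \<in> borel_measurable borel"
proof -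
  have "heat (\<rho>\<^sup>2) \<mu> \<in> borel_measurable borel" using measurable_heat[OF assms(3)] by measurable
  then show ?thesis
    unfolding riesz_block_def by (intro kernel_conv_measurable riesz_block_kernel(1) assms(1,2))
qed

lemma cancel_const_pos: "d > 0 \<Longrightarrow> cancel_const d > 0"
  unfolding cancel_const_def by (intro mult_pos_pos) (auto intro: add_pos_nonneg)

text \<open>
  One is added so that the constant is positive, as the bounds in \<open>lorentz_layers_sum_le\<close> must be.
\<close>

definition symbol_mass :: "(real ^ 'n \<Rightarrow> complex) \<Rightarrow> real \<Rightarrow> real" where
  "symbol_mass \<psi> \<alpha> = (\<integral>x. norm (inverse_fourier (riesz_symbol \<psi> \<alpha>) x) \<partial>lborel) + 1"

lemma symbol_mass_ge_1: "symbol_mass \<psi> \<alpha> \<ge> 1"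
  by (auto simp: symbol_mass_def intro: integral_nonneg)

lemma riesz_block_bounds:
  fixes \<psi> :: "real ^ 'n \<Rightarrow> complex"
  assumes \<psi>: "littlewood_paley_generator \<psi>" and \<rho>: "\<rho> > 0" and a: "signed_measure a"
  shows "(\<And>x. \<bar>heat (\<rho>\<^sup>2) a x\<bar> \<le> B) \<Longrightarrow> norm (riesz_block \<psi> \<alpha> \<rho> a y) \<le> \<rho> powr \<alpha> * symbol_mass \<psi> \<alpha> * B"
    and "A \<ge> 0 \<Longrightarrow> (\<integral>\<^sup>+x. ennreal \<bar>heat (\<rho>\<^sup>2) a x\<bar> \<partial>lborel) \<le> ennreal A \<Longrightarrow>
      L1_norm (riesz_block \<psi> \<alpha> \<rho> a) \<le> ennreal (\<rho> powr \<alpha> * symbol_mass \<psi> \<alpha> * A)"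
proof -
  let ?k = "inverse_fourier (\<lambda>\<xi>. of_real (\<rho> powr \<alpha>) * riesz_symbol \<psi> \<alpha> (\<rho> *\<^sub>R \<xi>))"
  have h: "heat (\<rho>\<^sup>2) a \<in> borel_measurable borel" using measurable_heat[OF a] by measurable
  note k = riesz_block_kernel[OF \<psi> \<rho>, of \<alpha>]
  have m: "(\<integral>x. norm (?k x) \<partial>lborel) \<le> \<rho> powr \<alpha> * symbol_mass \<psi> \<alpha>"
    unfolding k(2) symbol_mass_def by (intro mult_left_mono) auto
  show "norm (riesz_block \<psi> \<alpha> \<rho> a y) \<le> \<rho> powr \<alpha> * symbol_mass \<psi> \<alpha> * B" if B: "\<And>x. \<bar>heat (\<rho>\<^sup>2) a x\<bar> \<le> B"
  proof -
    have "B \<ge> 0" using order_trans[OF abs_ge_zero B] by blast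
    then show ?thesis
      unfolding riesz_block_def using mult_right_mono[OF m] kernel_conv_bounded[OF k(1) h B] order_trans by blast
  qed
  show "L1_norm (riesz_block \<psi> \<alpha> \<rho> a) \<le> ennreal (\<rho> powr \<alpha> * symbol_mass \<psi> \<alpha> * A)"
    if A: "A \<ge> 0" "(\<integral>\<^sup>+x. ennreal \<bar>heat (\<rho>\<^sup>2) a x\<bar> \<partial>lborel) \<le> ennreal A"
  proof -
    have "L1_norm (riesz_block \<psi> \<alpha> \<rho> a) \<le> ennreal (\<integral>x. norm (?k x) \<partial>lborel) * (\<integral>\<^sup>+x. ennreal \<bar>heat (\<rho>\<^sup>2) a x\<bar> \<partial>lborel)"
      unfolding riesz_block_def by (rule nn_integral_kernel_conv_le[OF k(1) h])
    also have "\<dots> \<le> ennreal (\<rho> powr \<alpha> * symbol_mass \<psi> \<alpha>) * ennreal A"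
      by (intro mult_mono ennreal_leI m A) auto
    also have "\<dots> = ennreal (\<rho> powr \<alpha> * symbol_mass \<psi> \<alpha> * A)"
      using A symbol_mass_ge_1[of \<psi> \<alpha>] by (intro ennreal_mult[symmetric]) auto
    finally show ?thesis .
  qed
qed

text \<open>
  With \<open>X = \<rho> powr \<alpha> * symbol_mass \<psi> \<alpha>\<close> the two norms are at most \<open>X y\<close> and \<open>X z \<rho> powr (- d)\<close>, where \<open>y\<close>
  and \<open>z\<close> depend on \<open>u\<close> only. In the geometric mean the factor \<open>\<rho> powr (- d)\<close> contributes \<open>\<rho> powr (- \<alpha>)\<close>, which
  cancels the power in \<open>X\<close>: this is the scaling invariance that singles out \<open>p = d / (d - \<alpha>)\<close>.
\<close>

lemma riesz_block_atom:
  fixes \<psi> :: "real ^ 'n \<Rightarrow> complex" and \<alpha> \<beta> :: real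
  defines "d \<equiv> real CARD('n)"
  assumes \<psi>: "littlewood_paley_generator \<psi>" and \<alpha>: "0 < \<alpha>" "\<alpha> < d" and a: "atom \<beta> a"
  shows "\<exists>l>0. \<forall>\<rho>>0. \<exists>A>0. \<exists>B>0.
    L1_norm (riesz_block \<psi> \<alpha> \<rho> a) \<le> ennreal A \<and>
    (\<forall>y. norm (riesz_block \<psi> \<alpha> \<rho> a y) \<le> B) \<and>
    A powr ((d - \<alpha>) / d) * B powr (1 - (d - \<alpha>) / d) = atom_weight (cancel_const CARD('n)) (\<beta> * \<alpha> / d) (symbol_mass \<psi> \<alpha>) (l / \<rho>)"
proof -
  let ?K = "cancel_const CARD('n)" and ?N = "symbol_mass \<psi> \<alpha>"
  obtain l where l: "l > 0"
    and h1: "\<And>t x. t > 0 \<Longrightarrow> \<bar>heat t a x\<bar> \<le> (l / sqrt t) powr (- \<beta>) * t powr (- real CARD('n) / 2)"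
    and h2: "\<And>t x. t > 0 \<Longrightarrow> l \<le> sqrt t \<Longrightarrow> \<bar>heat t a x\<bar> \<le> ?K * (l / sqrt t) * t powr (- real CARD('n) / 2)"
    and h3: "\<And>t. t > 0 \<Longrightarrow> l \<le> sqrt t \<Longrightarrow> (\<integral>\<^sup>+x. ennreal \<bar>heat t a x\<bar> \<partial>lborel) \<le> ennreal (?K * (l / sqrt t))"
    using atom_heat_estimates[OF a] by blast
  note am = atom_total_mass[OF a]
  have d: "d > 0" by (simp add: d_def)
  have K: "?K > 0" by (intro cancel_const_pos) simp
  have N: "?N > 0" using symbol_mass_ge_1[of \<psi> \<alpha>] by linarith
  have th: "1 - (d - \<alpha>) / d = \<alpha> / d" using d by (simp add: field_simps)
  \<comment> \<open>The common factor \<open>X\<close> has total exponent one in the geometric mean.\<close>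
  have combine: "(X * y) powr ((d - \<alpha>) / d) * (X * z * \<rho> powr (- d)) powr (\<alpha> / d) = X * \<rho> powr (- \<alpha>) * (y powr ((d - \<alpha>) / d) * z powr (\<alpha> / d))"
    if "X > 0" "y > 0" "z > 0" "\<rho> > 0" for X y z \<rho> :: real
  proof -
    have "X powr ((d - \<alpha>) / d) * X powr (\<alpha> / d) = X"
      unfolding powr_add[symmetric] using d that by (simp add: field_simps)
    moreover have "(\<rho> powr (- d)) powr (\<alpha> / d) = \<rho> powr (- \<alpha>)" using d by (simp add: powr_powr)
    moreover have "(X * y) powr ((d - \<alpha>) / d) * (X * z * \<rho> powr (- d)) powr (\<alpha> / d)
      = (X powr ((d - \<alpha>) / d) * X powr (\<alpha> / d)) * (\<rho> powr (- d)) powr (\<alpha> / d) * (y powr ((d - \<alpha>) / d) * z powr (\<alpha> / d))"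
      using that by (simp add: powr_mult mult_ac)
    ultimately show ?thesis by simp
  qed
  show ?thesis
  proof (rule exI[of _ l], intro conjI l allI impI)
    fix \<rho> :: real assume \<rho>: "\<rho> > 0"
    have r2: "\<rho>\<^sup>2 > 0" "sqrt (\<rho>\<^sup>2) = \<rho>" using \<rho> by auto
    have rp: "(\<rho>\<^sup>2) powr (- real CARD('n) / 2) = \<rho> powr (- d)"
    proof -
      have "\<rho>\<^sup>2 = \<rho> powr 2" using \<rho> by (simp add: powr_numeral)
      then show ?thesis by (simp add: powr_powr d_def)
    qed
    define u where "u = l / \<rho>"
    have u: "u > 0" using l \<rho> by (simp add: u_def)
    note bb = riesz_block_bounds[OF \<psi> \<rho> am(1), where \<alpha> = \<alpha>]
    have X: "\<rho> powr \<alpha> * ?N > 0" using \<rho> N by simp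
    have XX: "\<rho> powr \<alpha> * ?N * \<rho> powr (- \<alpha>) = ?N" using \<rho> by (simp add: powr_minus)
    show "\<exists>A>0. \<exists>B>0.
      L1_norm (riesz_block \<psi> \<alpha> \<rho> a) \<le> ennreal A \<and>
      (\<forall>y. norm (riesz_block \<psi> \<alpha> \<rho> a y) \<le> B) \<and>
      A powr ((d - \<alpha>) / d) * B powr (1 - (d - \<alpha>) / d) = atom_weight ?K (\<beta> * \<alpha> / d) ?N (l / \<rho>)"
    proof (cases "u \<le> 1")
      case True
      then have lr: "l \<le> sqrt (\<rho>\<^sup>2)" using \<rho> unfolding r2(2) by (simp add: u_def)
      have Ku: "?K * u > 0" using K u by simp
      have "(?K * u) powr ((d - \<alpha>) / d) * (?K * u) powr (\<alpha> / d) = ?K * u"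
        unfolding powr_add[symmetric] using d Ku by (simp add: field_simps)
      then have W: "(\<rho> powr \<alpha> * ?N * (?K * u)) powr ((d - \<alpha>) / d) * (\<rho> powr \<alpha> * ?N * (?K * u) * \<rho> powr (- d)) powr (\<alpha> / d) = ?N * ?K * u"
        unfolding combine[OF X Ku Ku \<rho>] XX by simp
      show ?thesis
      proof (rule exI[of _ "\<rho> powr \<alpha> * ?N * (?K * u)"], intro conjI exI[of _ "\<rho> powr \<alpha> * ?N * (?K * u) * \<rho> powr (- d)"] allI)
        show "L1_norm (riesz_block \<psi> \<alpha> \<rho> a) \<le> ennreal (\<rho> powr \<alpha> * ?N * (?K * u))"
          using h3[OF r2(1) lr] Ku unfolding r2(2) u_def[symmetric] by (intro bb(2)) auto
        show "norm (riesz_block \<psi> \<alpha> \<rho> a y) \<le> \<rho> powr \<alpha> * ?N * (?K * u) * \<rho> powr (- d)" for y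
          using bb(1)[of "?K * u * \<rho> powr (- d)" y] h2[OF r2(1) lr] unfolding r2(2) u_def[symmetric] rp by (simp add: mult.assoc)
        show "(\<rho> powr \<alpha> * ?N * (?K * u)) powr ((d - \<alpha>) / d) * (\<rho> powr \<alpha> * ?N * (?K * u) * \<rho> powr (- d)) powr (1 - (d - \<alpha>) / d)
            = atom_weight ?K (\<beta> * \<alpha> / d) ?N (l / \<rho>)"
          unfolding th W u_def[symmetric] using True by (simp add: atom_weight_def)
      qed (use X Ku \<rho> in \<open>auto intro!: mult_pos_pos\<close>)
    next
      case False
      have z: "u powr (- \<beta>) > 0" using u by simp
      have "(u powr (- \<beta>)) powr (\<alpha> / d) = u powr (- (\<beta> * \<alpha> / d))" by (simp add: powr_powr)
      then have W: "(\<rho> powr \<alpha> * ?N * 1) powr ((d - \<alpha>) / d) * (\<rho> powr \<alpha> * ?N * u powr (- \<beta>) * \<rho> powr (- d)) powr (\<alpha> / d) = ?N * u powr (- (\<beta> * \<alpha> / d))"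
        unfolding combine[OF X zero_less_one z \<rho>] XX by simp
      show ?thesis
      proof (rule exI[of _ "\<rho> powr \<alpha> * ?N * 1"], intro conjI exI[of _ "\<rho> powr \<alpha> * ?N * u powr (- \<beta>) * \<rho> powr (- d)"] allI)
        have "(\<integral>\<^sup>+x. ennreal \<bar>heat (\<rho>\<^sup>2) a x\<bar> \<partial>lborel) \<le> ennreal 1"
          by (rule order_trans[OF nn_integral_heat_le[OF am(1) r2(1)]]) (intro ennreal_leI am(2))
        then show "L1_norm (riesz_block \<psi> \<alpha> \<rho> a) \<le> ennreal (\<rho> powr \<alpha> * ?N * 1)"
          by (intro bb(2)) auto
        show "norm (riesz_block \<psi> \<alpha> \<rho> a y) \<le> \<rho> powr \<alpha> * ?N * u powr (- \<beta>) * \<rho> powr (- d)" for y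
          using bb(1)[of "u powr (- \<beta>) * \<rho> powr (- d)" y] h1[OF r2(1)] unfolding r2(2) u_def[symmetric] rp by (simp add: mult.assoc)
        show "(\<rho> powr \<alpha> * ?N * 1) powr ((d - \<alpha>) / d) * (\<rho> powr \<alpha> * ?N * u powr (- \<beta>) * \<rho> powr (- d)) powr (1 - (d - \<alpha>) / d)
            = atom_weight ?K (\<beta> * \<alpha> / d) ?N (l / \<rho>)"
          unfolding th W u_def[symmetric] using False by (simp add: atom_weight_def)
      qed (use X z \<rho> in \<open>auto intro!: mult_pos_pos\<close>)
    qed
  qed
qed

text \<open>
  The approximating heat flows converge pointwise and, for large \<open>n\<close>, are bounded by a multiple of the
  supremum of the heat kernel, since the sums of coefficients are eventually bounded.
\<close>

lemma riesz_block_limit: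
  fixes \<psi> :: "real ^ 'n \<Rightarrow> complex"
  assumes \<psi>: "littlewood_paley_generator \<psi>" and \<rho>: "\<rho> > 0"
    and \<mu>: "signed_measure \<mu>" and rep: "DS_representation \<beta> \<mu> c a"
  shows "(\<lambda>n. \<Sum>i=1..n. of_real (c i n) * riesz_block \<psi> \<alpha> \<rho> (a i n) y) \<longlonglongrightarrow> riesz_block \<psi> \<alpha> \<rho> \<mu> y"
proof -
  let ?k = "inverse_fourier (\<lambda>\<xi>. of_real (\<rho> powr \<alpha>) * riesz_symbol \<psi> \<alpha> (\<rho> *\<^sub>R \<xi>))"
  let ?t = "\<rho>\<^sup>2"
  have t: "?t > 0" using \<rho> by simp
  let ?P = "(4 * pi * ?t) powr (- real CARD('n) / 2)"
  have k: "integrable lborel ?k" by (rule riesz_block_kernel(1)[OF \<psi> \<rho>])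
  have at: "atom \<beta> (a i n)" if "i \<in> {1..n}" for i n
    using rep that by (simp add: DS_representation_def)
  define h where "h n x = (\<Sum>i=1..n. c i n * heat ?t (a i n) x)" for n x
  have hlim: "(\<lambda>n. h n x) \<longlonglongrightarrow> heat ?t \<mu> x" for x
  proof -
    have C: "(\<lambda>y. heat_kernel ?t (x - y)) \<in> C0" by (rule heat_kernel_C0[OF t])
    have e: "heat ?t \<nu> x = signed_integral \<nu> (\<lambda>y. heat_kernel ?t (x - y))" for \<nu>
      by (simp add: heat_def heat_kernel_def)
    show ?thesis
      unfolding h_def e using rep C unfolding DS_representation_def by blast
  qed
  have mh: "heat ?t \<nu> \<in> borel_measurable borel" if "signed_measure \<nu>" for \<nu> :: "(real ^ 'n) set \<Rightarrow> real"
    using measurable_heat[OF that] by measurable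
  have mhn: "h n \<in> borel_measurable borel" for n
    unfolding h_def[abs_def] by (intro borel_measurable_sum borel_measurable_times borel_measurable_const mh atom_total_mass(1)[OF at]) auto
  have hb: "\<bar>heat ?t (a i n) x\<bar> \<le> ?P" if "i \<in> {1..n}" for i n x
  proof -
    have "\<bar>heat ?t (a i n) x\<bar> \<le> ?P * total_mass (a i n)"
      by (rule heat_bounded[OF atom_total_mass(1)[OF at[OF that]] t])
    also have "\<dots> \<le> ?P * 1"
      by (intro mult_left_mono atom_total_mass(2)[OF at[OF that]]) auto
    finally show ?thesis by simp
  qed
  have "limsup (\<lambda>n. ennreal (\<Sum>i=1..n. \<bar>c i n\<bar>)) < \<top>"
    using rep by (simp add: DS_representation_def)
  from dense[OF this] obtain z where z: "limsup (\<lambda>n. ennreal (\<Sum>i=1..n. \<bar>c i n\<bar>)) < z" "z < \<top>"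
    by blast
  then obtain C where C: "limsup (\<lambda>n. ennreal (\<Sum>i=1..n. \<bar>c i n\<bar>)) < ennreal C"
    by (cases z) auto
  have "\<forall>\<^sub>F n in sequentially. ennreal (\<Sum>i=1..n. \<bar>c i n\<bar>) < ennreal C"
    by (rule Limsup_lessD[OF C])
  then obtain n0 where n0': "\<And>n. n \<ge> n0 \<Longrightarrow> ennreal (\<Sum>i=1..n. \<bar>c i n\<bar>) < ennreal C"
    unfolding eventually_sequentially by blast
  have n0: "(\<Sum>i=1..n. \<bar>c i n\<bar>) < C" if "n \<ge> n0" for n
    using n0'[OF that] by (subst (asm) ennreal_less_iff) (auto intro: sum_nonneg)
  \<comment> \<open>The dominating function exists only for indices from \<open>n0\<close> on, so the sequence is shifted.\<close>
  have hnb: "\<bar>h (n + n0) x\<bar> \<le> C * ?P" for n x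
  proof -
    let ?m = "n + n0"
    have "\<bar>h ?m x\<bar> \<le> (\<Sum>i=1..?m. \<bar>c i ?m\<bar> * \<bar>heat ?t (a i ?m) x\<bar>)"
      unfolding h_def using sum_abs[of "\<lambda>i. c i ?m * heat ?t (a i ?m) x" "{1..?m}"] by (simp add: abs_mult)
    also have "\<dots> \<le> (\<Sum>i=1..?m. \<bar>c i ?m\<bar> * ?P)"
      by (intro sum_mono mult_left_mono hb) auto
    also have "\<dots> = (\<Sum>i=1..?m. \<bar>c i ?m\<bar>) * ?P" by (simp add: sum_distrib_right)
    also have "\<dots> \<le> C * ?P" using n0[of ?m] by (intro mult_right_mono) auto
    finally show ?thesis .
  qed
  have sum_eq: "(\<Sum>i=1..n. of_real (c i n) * riesz_block \<psi> \<alpha> \<rho> (a i n) y) = kernel_conv ?k (h n) y" for n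
  proof -
    have i: "integrable lborel (\<lambda>x. of_real (c i n) * (?k (y - x) * of_real (heat ?t (a i n) x)))" if "i \<in> {1..n}" for i
      by (intro integrable_mult_right integrable_mult_bounded[OF integrable_reflect[OF k]])
        (use hb[OF that] mh[OF atom_total_mass(1)[OF at[OF that]]] in auto)
    have "kernel_conv ?k (h n) y = (\<integral>x. (\<Sum>i=1..n. of_real (c i n) * (?k (y - x) * of_real (heat ?t (a i n) x))) \<partial>lborel)"
      unfolding kernel_conv_def h_def by (simp add: sum_distrib_left mult.left_commute)
    also have "\<dots> = (\<Sum>i=1..n. (\<integral>x. of_real (c i n) * (?k (y - x) * of_real (heat ?t (a i n) x)) \<partial>lborel))"
      by (rule Bochner_Integration.integral_sum[OF i])
    finally show ?thesis by (simp add: riesz_block_def kernel_conv_def)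
  qed
  have mk: "(\<lambda>x. ?k (y - x) * of_real (f x)) \<in> borel_measurable lborel" if f: "f \<in> borel_measurable borel" for f :: "real ^ 'n \<Rightarrow> real"
  proof (rule borel_measurable_times)
    show "(\<lambda>x. ?k (y - x)) \<in> borel_measurable lborel"
      by (rule borel_measurable_integrable[OF integrable_reflect[OF k]])
    show "(\<lambda>x. complex_of_real (f x)) \<in> borel_measurable lborel"
      using measurable_compose[OF f borel_measurable_of_real] by simp
  qed
  have "(\<lambda>n. kernel_conv ?k (h (n + n0)) y) \<longlonglongrightarrow> kernel_conv ?k (heat ?t \<mu>) y"
    unfolding kernel_conv_def
  proof (rule integral_dominated_convergence[where w = "\<lambda>x. norm (?k (y - x)) * (C * ?P)"])
    show "integrable lborel (\<lambda>x. norm (?k (y - x)) * (C * ?P))"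
      by (intro integrable_mult_left integrable_norm integrable_reflect k)
    show "AE x in lborel. (\<lambda>n. ?k (y - x) * of_real (h (n + n0) x)) \<longlonglongrightarrow> ?k (y - x) * of_real (heat ?t \<mu> x)"
      by (intro AE_I2 tendsto_intros LIMSEQ_ignore_initial_segment hlim)
    show "AE x in lborel. norm (?k (y - x) * of_real (h (n + n0) x)) \<le> norm (?k (y - x)) * (C * ?P)" for n
      using hnb by (intro AE_I2) (simp add: norm_mult mult_left_mono)
    show "(\<lambda>x. ?k (y - x) * of_real (heat ?t \<mu> x)) \<in> borel_measurable lborel"
      by (rule mk[OF mh[OF \<mu>]])
    show "(\<lambda>x. ?k (y - x) * of_real (h (n + n0) x)) \<in> borel_measurable lborel" for n
      by (rule mk[OF mhn])
  qed
  then have "(\<lambda>n. kernel_conv ?k (h n) y) \<longlonglongrightarrow> kernel_conv ?k (heat ?t \<mu>) y"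
    by (rule LIMSEQ_offset)
  then show ?thesis unfolding sum_eq by (simp add: riesz_block_def)
qed

lemma ennreal_mult_liminf_le: "c * liminf F \<le> liminf (\<lambda>n. c * F n)" for c :: ennreal and F :: "nat \<Rightarrow> ennreal"
  unfolding liminf_SUP_INF SUP_mult_left_ennreal
  by (intro SUP_mono' INF_greatest mult_left_mono INF_lower) auto

lemma sum_liminf_le:
  fixes X :: "'j \<Rightarrow> nat \<Rightarrow> ennreal"
  assumes "finite F"
  shows "(\<Sum>j\<in>F. liminf (X j)) \<le> liminf (\<lambda>n. \<Sum>j\<in>F. X j n)"
proof -
  have "(\<Sum>j\<in>F. liminf (X j)) = (\<integral>\<^sup>+j. liminf (\<lambda>n. X j n) \<partial>count_space F)"
    using assms by (simp add: nn_integral_count_space_finite)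
  also have "\<dots> \<le> liminf (\<lambda>n. \<integral>\<^sup>+j. X j n \<partial>count_space F)"
    by (rule nn_integral_liminf) auto
  finally show ?thesis using assms by (simp add: nn_integral_count_space_finite)
qed

lemma liminf_cmult_le_limsup:
  fixes F :: "nat \<Rightarrow> ennreal"
  assumes "C > 0"
  shows "liminf (\<lambda>n. ennreal C * F n) \<le> ennreal C * limsup F"
proof -
  \<comment> \<open>Moving \<open>C\<close> out of the lower limit amounts to moving its inverse in.\<close>
  have inv: "ennreal (1 / C) * ennreal C = 1" using assms by (simp add: ennreal_mult[symmetric])
  have "ennreal (1 / C) * liminf (\<lambda>n. ennreal C * F n) \<le> liminf (\<lambda>n. ennreal (1 / C) * (ennreal C * F n))"
    by (rule ennreal_mult_liminf_le)
  also have "\<dots> = liminf F" by (simp add: mult.assoc[symmetric] inv)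
  also have "\<dots> \<le> limsup F" by (intro Liminf_le_Limsup) auto
  finally have "ennreal C * (ennreal (1 / C) * liminf (\<lambda>n. ennreal C * F n)) \<le> ennreal C * limsup F"
    by (rule mult_left_mono) auto
  then show ?thesis by (simp add: mult.assoc[symmetric] mult.commute[of "ennreal C"] inv)
qed

text \<open>
  The constant does not depend on the representation, so the infimum over representations can be taken
  afterwards.
\<close>

lemma besov_le_representation:
  fixes \<psi> :: "real ^ 'n \<Rightarrow> complex" and \<alpha> \<beta> :: real
  defines "d \<equiv> real CARD('n)"
  defines "C \<equiv> d / (d - \<alpha>) * (2 * symbol_mass \<psi> \<alpha> * cancel_const CARD('n) + symbol_mass \<psi> \<alpha> / (1 - 2 powr (- (\<beta> * \<alpha> / d))))"
  assumes \<psi>: "littlewood_paley_generator \<psi>" and \<beta>: "0 < \<beta>" and \<alpha>: "0 < \<alpha>" "\<alpha> < d"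
    and \<mu>: "signed_measure \<mu>" and rep: "DS_representation \<beta> \<mu> c a"
  shows "C > 0"
    and "besov_lorentz_norm \<psi> (d / (d - \<alpha>)) (distribution_of (\<lambda>x. complex_of_real (riesz_potential \<alpha> \<mu> x)))
      \<le> ennreal C * limsup (\<lambda>n. ennreal (\<Sum>i=1..n. \<bar>c i n\<bar>))"
proof -
  let ?K = "cancel_const CARD('n)" and ?N = "symbol_mass \<psi> \<alpha>"
  let ?T = "distribution_of (\<lambda>x. complex_of_real (riesz_potential \<alpha> \<mu> x))"
  have d: "d > 0" by (simp add: d_def)
  define \<theta> \<gamma> where "\<theta> = (d - \<alpha>) / d" and "\<gamma> = \<beta> * \<alpha> / d"
  have \<theta>: "0 < \<theta>" "\<theta> < 1" using \<alpha> d by (auto simp: \<theta>_def)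
  have \<gamma>: "\<gamma> > 0" using \<alpha> \<beta> d by (simp add: \<gamma>_def)
  have p: "1 / (d / (d - \<alpha>)) = \<theta>" "d / (d - \<alpha>) = 1 / \<theta>" by (auto simp: \<theta>_def)
  have K: "?K > 0" by (intro cancel_const_pos) simp
  have N: "?N > 0" using symbol_mass_ge_1[of \<psi> \<alpha>] by linarith
  have q: "1 - 2 powr (- \<gamma>) > 0" using \<gamma> powr_less_mono[of "- \<gamma>" 0 2] by simp
  define W where "W = 2 * ?N * ?K + ?N / (1 - 2 powr (- \<gamma>))"
  have W: "W > 0" unfolding W_def using K N q by (intro add_pos_pos) auto
  have CW: "C = 1 / \<theta> * W" by (simp add: C_def W_def p(2) \<gamma>_def)
  show C: "C > 0" unfolding CW using \<theta> W by simp
  have at: "atom \<beta> (a i n)" if "i \<in> {1..n}" for i n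
    using rep that by (simp add: DS_representation_def)
  have "\<forall>i n. \<exists>l. i \<in> {1..n} \<longrightarrow> l > 0 \<and> (\<forall>\<rho>>0. \<exists>A>0. \<exists>B>0.
    L1_norm (riesz_block \<psi> \<alpha> \<rho> (a i n)) \<le> ennreal A \<and>
    (\<forall>y. norm (riesz_block \<psi> \<alpha> \<rho> (a i n) y) \<le> B) \<and>
    A powr \<theta> * B powr (1 - \<theta>) = atom_weight ?K \<gamma> ?N (l / \<rho>))"
    using riesz_block_atom[OF \<psi> \<alpha>(1) \<alpha>(2)[unfolded d_def] at] unfolding \<theta>_def \<gamma>_def d_def by blast
  then obtain l where l: "\<And>i n. i \<in> {1..n} \<Longrightarrow> l i n > 0"
    and lab: "\<And>i n \<rho>. i \<in> {1..n} \<Longrightarrow> \<rho> > 0 \<Longrightarrow> \<exists>A>0. \<exists>B>0.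
    L1_norm (riesz_block \<psi> \<alpha> \<rho> (a i n)) \<le> ennreal A \<and>
    (\<forall>y. norm (riesz_block \<psi> \<alpha> \<rho> (a i n) y) \<le> B) \<and>
    A powr \<theta> * B powr (1 - \<theta>) = atom_weight ?K \<gamma> ?N (l i n / \<rho>)"
    by metis
  define X where "X j n = ennreal (1 / \<theta> * (\<Sum>i=1..n. \<bar>c i n\<bar> * atom_weight ?K \<gamma> ?N (l i n * 2 powi j)))" for j :: int and n
  have block: "lorentz1_norm_distribution (d / (d - \<alpha>)) (littlewood_paley \<psi> j ?T) \<le> liminf (X j)" for j
  proof -
    define \<rho> :: real where "\<rho> = 2 powi (- j)"
    have \<rho>: "\<rho> > 0" by (simp add: \<rho>_def)
    have div: "x / \<rho> = x * 2 powi j" for x by (simp add: \<rho>_def power_int_minus divide_inverse)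
    let ?g = "riesz_block \<psi> \<alpha> \<rho> \<mu>"
    have mg: "?g \<in> borel_measurable borel" by (rule riesz_block_measurable[OF \<psi> \<rho> \<mu>])
    have ma: "riesz_block \<psi> \<alpha> \<rho> (a i n) \<in> borel_measurable borel" if "i \<in> {1..n}" for i n
      by (rule riesz_block_measurable[OF \<psi> \<rho> atom_total_mass(1)[OF at[OF that]]])
    have "lorentz1_norm_distribution (d / (d - \<alpha>)) (littlewood_paley \<psi> j ?T) \<le> lorentz1_norm (d / (d - \<alpha>)) ?g"
      unfolding lorentz1_norm_distribution_def \<rho>_def
      using riesz_block_represents[OF \<psi> \<alpha>(1) \<alpha>(2)[unfolded d_def] \<mu>] by (intro INF_lower) simp
    also have "\<dots> \<le> lorentz_layers \<theta> ?g"
      using lorentz1_norm_le_layers[OF mg, of "d / (d - \<alpha>)"] unfolding p(1) .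
    also have "\<dots> \<le> liminf (\<lambda>n. lorentz_layers \<theta> (\<lambda>x. \<Sum>i=1..n. of_real (c i n) * riesz_block \<psi> \<alpha> \<rho> (a i n) x))"
    proof (rule lorentz_layers_liminf[OF mg])
      show "(\<lambda>x. \<Sum>i=1..n. complex_of_real (c i n) * riesz_block \<psi> \<alpha> \<rho> (a i n) x) \<in> borel_measurable borel" for n
        by (intro borel_measurable_sum borel_measurable_times borel_measurable_const ma) auto
    qed (rule riesz_block_limit[OF \<psi> \<rho> \<mu> rep])
    also have "\<dots> \<le> liminf (X j)"
    proof (intro Liminf_mono always_eventually allI)
      fix n
      have "\<forall>i. \<exists>A B. i \<in> {1..n} \<longrightarrow> A > 0 \<and> B > 0 \<and>
        L1_norm (riesz_block \<psi> \<alpha> \<rho> (a i n)) \<le> ennreal A \<and>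
        (\<forall>y. norm (riesz_block \<psi> \<alpha> \<rho> (a i n) y) \<le> B) \<and>
        A powr \<theta> * B powr (1 - \<theta>) = atom_weight ?K \<gamma> ?N (l i n / \<rho>)"
        using lab[OF _ \<rho>] by meson
      then obtain A B where AB: "\<And>i. i \<in> {1..n} \<Longrightarrow> A i > 0" "\<And>i. i \<in> {1..n} \<Longrightarrow> B i > 0"
        "\<And>i. i \<in> {1..n} \<Longrightarrow> L1_norm (riesz_block \<psi> \<alpha> \<rho> (a i n)) \<le> ennreal (A i)"
        "\<And>i y. i \<in> {1..n} \<Longrightarrow> norm (riesz_block \<psi> \<alpha> \<rho> (a i n) y) \<le> B i"
        "\<And>i. i \<in> {1..n} \<Longrightarrow> A i powr \<theta> * B i powr (1 - \<theta>) = atom_weight ?K \<gamma> ?N (l i n / \<rho>)"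
        by metis
      have "lorentz_layers \<theta> (\<lambda>x. \<Sum>i=1..n. of_real (c i n) * riesz_block \<psi> \<alpha> \<rho> (a i n) x)
        \<le> ennreal (1 / \<theta> * (\<Sum>i=1..n. \<bar>c i n\<bar> * (A i powr \<theta> * B i powr (1 - \<theta>))))"
        by (rule lorentz_layers_sum_le[where A = A and B = B]) (use ma \<theta> AB in auto)
      also have "(\<Sum>i=1..n. \<bar>c i n\<bar> * (A i powr \<theta> * B i powr (1 - \<theta>))) = (\<Sum>i=1..n. \<bar>c i n\<bar> * atom_weight ?K \<gamma> ?N (l i n * 2 powi j))"
        by (intro sum.cong refl) (simp only: AB(5) div)
      finally show "lorentz_layers \<theta> (\<lambda>x. \<Sum>i=1..n. of_real (c i n) * riesz_block \<psi> \<alpha> \<rho> (a i n) x) \<le> X j n"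
        by (simp only: X_def)
    qed
    finally show ?thesis .
  qed
  show "besov_lorentz_norm \<psi> (d / (d - \<alpha>)) ?T \<le> ennreal C * limsup (\<lambda>n. ennreal (\<Sum>i=1..n. \<bar>c i n\<bar>))"
    unfolding besov_lorentz_norm_def
  proof (rule infsum_le_finite_sums)
    show "(\<lambda>j. lorentz1_norm_distribution (d / (d - \<alpha>)) (littlewood_paley \<psi> j ?T)) summable_on UNIV"
      by (rule nonneg_summable_on_complete) simp
    fix F :: "int set" assume F: "finite F"
    have "(\<Sum>j\<in>F. lorentz1_norm_distribution (d / (d - \<alpha>)) (littlewood_paley \<psi> j ?T)) \<le> (\<Sum>j\<in>F. liminf (X j))"
      by (intro sum_mono block)
    also have "\<dots> \<le> liminf (\<lambda>n. \<Sum>j\<in>F. X j n)" by (rule sum_liminf_le[OF F])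
    also have "\<dots> \<le> liminf (\<lambda>n. ennreal C * ennreal (\<Sum>i=1..n. \<bar>c i n\<bar>))"
    proof (intro Liminf_mono always_eventually allI)
      fix n
      have aw0: "0 \<le> atom_weight ?K \<gamma> ?N (l i n * 2 powi j)" if "i \<in> {1..n}" for i j
        using K N l[OF that] by (auto simp: atom_weight_def)
      have "(\<Sum>j\<in>F. X j n) = ennreal (\<Sum>j\<in>F. 1 / \<theta> * (\<Sum>i=1..n. \<bar>c i n\<bar> * atom_weight ?K \<gamma> ?N (l i n * 2 powi j)))"
        unfolding X_def using \<theta> aw0 by (intro sum_ennreal mult_nonneg_nonneg sum_nonneg) auto
      also have "(\<Sum>j\<in>F. 1 / \<theta> * (\<Sum>i=1..n. \<bar>c i n\<bar> * atom_weight ?K \<gamma> ?N (l i n * 2 powi j)))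
        = 1 / \<theta> * (\<Sum>i=1..n. \<bar>c i n\<bar> * (\<Sum>j\<in>F. atom_weight ?K \<gamma> ?N (l i n * 2 powi j)))"
        unfolding sum_distrib_left by (rule sum.swap)
      also have "ennreal \<dots> \<le> ennreal (1 / \<theta> * (\<Sum>i=1..n. \<bar>c i n\<bar> * W))"
        unfolding W_def using \<theta> K N l F \<gamma>
        by (intro ennreal_leI mult_left_mono sum_mono sum_atom_weight_le) auto
      also have "1 / \<theta> * (\<Sum>i=1..n. \<bar>c i n\<bar> * W) = C * (\<Sum>i=1..n. \<bar>c i n\<bar>)"
        unfolding sum_distrib_right[symmetric] CW by (simp only: mult_ac)
      also have "ennreal \<dots> = ennreal C * ennreal (\<Sum>i=1..n. \<bar>c i n\<bar>)"
        using C by (intro ennreal_mult) (auto intro: sum_nonneg)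
      finally show "(\<Sum>j\<in>F. X j n) \<le> ennreal C * ennreal (\<Sum>i=1..n. \<bar>c i n\<bar>)" .
    qed
    also have "\<dots> \<le> ennreal C * limsup (\<lambda>n. ennreal (\<Sum>i=1..n. \<bar>c i n\<bar>))"
      by (rule liminf_cmult_le_limsup[OF C])
    finally show "(\<Sum>j\<in>F. lorentz1_norm_distribution (d / (d - \<alpha>)) (littlewood_paley \<psi> j ?T)) \<le> \<dots>" .
  qed
qed

theorem theorem1:
  fixes \<psi> :: "real ^ 'n \<Rightarrow> complex" and \<alpha> \<beta> :: real
  assumes "littlewood_paley_generator \<psi>"
    and "0 < \<beta>" and "\<beta> \<le> real CARD('n)"
    and "0 < \<alpha>" and "\<alpha> < real CARD('n)"
  shows "\<exists>C::real. C > 0 \<and> (\<forall>\<mu> \<in> (DS \<beta> :: ((real ^ 'n) set \<Rightarrow> real) set).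
    besov_lorentz_norm \<psi> (real CARD('n) / (real CARD('n) - \<alpha>))
      (distribution_of (\<lambda>x. complex_of_real (riesz_potential \<alpha> \<mu> x)))
    \<le> ennreal C * DS_norm \<beta> \<mu>)"
proof (cases "(DS \<beta> :: ((real ^ 'n) set \<Rightarrow> real) set) = {}")
  case True
  then show ?thesis by (intro exI[of _ 1]) simp
next
  case False
  define C where "C = real CARD('n) / (real CARD('n) - \<alpha>) * (2 * symbol_mass \<psi> \<alpha> * cancel_const CARD('n)
    + symbol_mass \<psi> \<alpha> / (1 - 2 powr (- (\<beta> * \<alpha> / real CARD('n)))))"
  note main = besov_le_representation[OF assms(1,2,4,5), folded C_def]
  have C: "C > 0" using False main(1) by (auto simp: DS_def)
  have "besov_lorentz_norm \<psi> (real CARD('n) / (real CARD('n) - \<alpha>)) (distribution_of (\<lambda>x. complex_of_real (riesz_potential \<alpha> \<mu> x)))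
      \<le> ennreal C * DS_norm \<beta> \<mu>" (is "?L \<le> _") if "\<mu> \<in> DS \<beta>" for \<mu> :: "(real ^ 'n) set \<Rightarrow> real"
  proof -
    have inv: "ennreal (1 / C) * ennreal C = 1" using C by (simp add: ennreal_mult[symmetric])
    have \<mu>: "signed_measure \<mu>" using that by (simp add: DS_def)
    have "ennreal (1 / C) * ?L \<le> DS_norm \<beta> \<mu>"
      unfolding DS_norm_def
    proof (rule Inf_greatest, clarify)
      fix c a assume "DS_representation \<beta> \<mu> c a"
      from mult_left_mono[OF main(2)[OF \<mu> this], of "ennreal (1 / C)"]
      show "ennreal (1 / C) * ?L \<le> limsup (\<lambda>n. ennreal (\<Sum>i=1..n. \<bar>c i n\<bar>))"
        by (simp add: mult.assoc[symmetric] inv)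
    qed
    then have "ennreal C * (ennreal (1 / C) * ?L) \<le> ennreal C * DS_norm \<beta> \<mu>"
      by (rule mult_left_mono) auto
    then show ?thesis by (simp add: mult.assoc[symmetric] mult.commute[of "ennreal C"] inv)
  qed
  with C show ?thesis by blast
qed

end
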